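(* Let $\mathbf p=(0,0)$ and $\mathbf q=(0,\frac ab)$, where $a,b$ are integers with $b\ge2$ and $\gcd(a,b)=1$, and suppose that $\alpha\in\mathcal W(\nu,b)$ for some $\nu>0$. If $\phi^t$ is a reparametrized linear flow (in the sense of the context) with angle $\alpha$ and stopping points at $\mathbf p$ and $\mathbf q$, then $\phi^t$ has an extreme historic behaviour.
   Context: For an irrational $\alpha=[a_0;a_1,a_2,\dots]$ (continued fraction), $p_n/q_n=[a_0;a_1,\dots,a_n]$ denotes its $n$-th convergent in lowest terms, $q_n>0$. For $\nu>0$ and an integer $k\ge2$, $\mathcal W(\nu,k)$ is the set of irrational real numbers $\alpha$ for which there are infinitely many $n\in\mathbb N$ with both $a_{n+1}\ge q_n^{\nu}$ and $\gcd(q_n,k)=1$. Let $\mathbb T^2=\mathbb R^2/\mathbb Z^2$, and let $\lambda^2$ be Lebesgue (Haar) measure on $\mathbb T^2$. A reparametrized linear flow with angle $\alpha$ and stopping points at $\mathbf p$ and $\mathbf q$ is the flow $\phi^t$ on $\mathbb T^2$ generated by a vector field $X=\varphi X_0$ such that: $X_0=(1,\alpha)$ with $\alpha\in\mathbb R$ irrational; $\varphi:\mathbb T^2\to[0,\infty)$ is of class $C^3$; $\varphi$ vanishes at two distinct points $\mathbf p,\mathbf q$ and is positive elsewhere; the Hessians $D^2\varphi(\mathbf p)$ and $D^2\varphi(\mathbf q)$ are positive definite. For $\mathbf x\in\mathbb T^2$ and $t>0$ the empirical measure $\mu^t_{\mathbf x}$ is the Borel probability with $\int f\,d\mu^t_{\mathbf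 x}=\frac1t\int_0^t f(\phi^s(\mathbf x))\,ds$ for continuous $f$, and $p\omega(\mathbf x)=\bigcap_{T>0}\overline{\{\mu^t_{\mathbf x}:t\ge T\}}$ (weak-* closure). The flow has an extreme historic behaviour if $p\omega(\mathbf x)=\{s\delta_{\mathbf p}+(1-s)\delta_{\mathbf q}:0\le s\le1\}$ for $\lambda^2$-a.e. $\mathbf x$. *)

theory Defs
  imports "HOL-Probability.Probability"
begin

fun cf_eval :: "int list \<Rightarrow> rat" where
  "cf_eval [] = 0"
| "cf_eval [a] = of_int a"
| "cf_eval (a # b # as) = of_int a + 1 / cf_eval (b # as)"

primrec cf_tail :: "real \<Rightarrow> nat \<Rightarrow> real" where
  "cf_tail \<alpha> 0 = \<alpha>"
| "cf_tail \<alpha> (Suc n) = 1 / frac (cf_tail \<alpha> n)"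

definition cf_coeff :: "real \<Rightarrow> nat \<Rightarrow> int" where
  "cf_coeff \<alpha> n = \<lfloor>cf_tail \<alpha> n\<rfloor>"

definition cf_convergent :: "real \<Rightarrow> nat \<Rightarrow> rat" where
  "cf_convergent \<alpha> n = cf_eval (map (cf_coeff \<alpha>) [0..<Suc n])"

text \<open>\<open>quotient_of\<close> returns the numerator and the positive denominator of the reduced fraction.\<close>

definition cf_denom :: "real \<Rightarrow> nat \<Rightarrow> int" where
  "cf_denom \<alpha> n = snd (quotient_of (cf_convergent \<alpha> n))"

definition W_set :: "real \<Rightarrow> int \<Rightarrow> real set" where
  "W_set \<nu> k = {\<alpha>. \<alpha> \<notin> \<rat> \<and>
     infinite {n. real_of_int (cf_coeff \<alpha> (Suc n)) \<ge> real_of_int (cf_denom \<alpha> n) powr \<nu> \<and>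
                  gcd (cf_denom \<alpha> n) k = 1}}"

definition torus_rel :: "real \<times> real \<Rightarrow> real \<times> real \<Rightarrow> bool" where
  "torus_rel x y \<longleftrightarrow> fst x - fst y \<in> \<int> \<and> snd x - snd y \<in> \<int>"

lemma equivp_torus_rel: "equivp torus_rel"
proof (rule equivpI)
  show "reflp torus_rel"
    by (simp add: reflp_def torus_rel_def)
  show "symp torus_rel"
    unfolding symp_def torus_rel_def by (metis Ints_minus minus_diff_eq)
  show "transp torus_rel"
    unfolding transp_def torus_rel_def
  proof (intro allI impI)
    fix x y z :: "real \<times> real"
    assume "fst x - fst y \<in> \<int> \<and> snd x - snd y \<in> \<int>"
      and "fst y - fst z \<in> \<int> \<and> snd y - snd z \<in> \<int>"
    then have "(fst x - fst y) + (fst y - fst z) \<in> \<int> \<and> (snd x - snd y) + (snd y - snd z) \<in> \<int>"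
      by (blast intro: Ints_add)
    then show "fst x - fst z \<in> \<int> \<and> snd x - snd z \<in> \<int>"
      by simp
  qed
qed

quotient_type torus = "real \<times> real" / torus_rel
  morphisms torus_rep torus_proj
  by (rule equivp_torus_rel)

lemma torus_proj_eq_iff:
  "torus_proj x = torus_proj y \<longleftrightarrow> fst x - fst y \<in> \<int> \<and> snd x - snd y \<in> \<int>"
  using torus.abs_eq_iff[of x y] by (simp add: torus_rel_def)

instantiation torus :: topological_space
begin

definition open_torus :: "torus set \<Rightarrow> bool" where
  "open_torus U \<longleftrightarrow> open (torus_proj -` U)"

instance
proof
  show "open (UNIV :: torus set)"
    by (simp add: open_torus_def)
  show "open (S \<inter> T)" if "open S" "open T" for S T :: "torus set"
    using that by (simp add: open_torus_def open_Int)
  show "open (\<Union>K)" if "\<forall>S\<in>K. open S" for K :: "torus set set"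
    using that by (auto simp: open_torus_def vimage_Union)
qed

end

lemma continuous_torus_proj: "continuous_on UNIV torus_proj"
  by (simp add: continuous_on_open_vimage open_torus_def)

definition haar_torus :: "torus measure" where
  "haar_torus = distr (restrict_space lborel ({0..<1} \<times> {0..<1})) borel torus_proj"

text \<open>Derivatives are taken direction by direction; on a finite-dimensional space this is
  the usual class of k times continuously differentiable functions.\<close>

fun Ck :: "nat \<Rightarrow> ('a::real_normed_vector \<Rightarrow> real) \<Rightarrow> bool" where
  "Ck 0 f \<longleftrightarrow> continuous_on UNIV f"
| "Ck (Suc k) f \<longleftrightarrow> (\<forall>x. f differentiable (at x)) \<and>
     (\<forall>v. Ck k (\<lambda>x. frechet_derivative f (at x) v))"

definition hessian :: "('a::real_normed_vector \<Rightarrow> real) \<Rightarrow> 'a \<Rightarrow> 'a \<Rightarrow> 'a \<Rightarrow> real" where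
  "hessian f x v w = frechet_derivative (\<lambda>y. frechet_derivative f (at y) w) (at x) v"

definition Ck_torus :: "nat \<Rightarrow> (torus \<Rightarrow> real) \<Rightarrow> bool" where
  "Ck_torus k \<phi> \<longleftrightarrow> Ck k (\<phi> \<circ> torus_proj)"

text \<open>By periodicity of the lift, the Hessian does not depend on the representative chosen
  by \<open>torus_rep\<close>.\<close>

definition hessian_pos_def_at :: "(torus \<Rightarrow> real) \<Rightarrow> torus \<Rightarrow> bool" where
  "hessian_pos_def_at \<phi> x \<longleftrightarrow>
     (\<forall>v. v \<noteq> 0 \<longrightarrow> hessian (\<phi> \<circ> torus_proj) (torus_rep x) v v > 0)"

text \<open>Vector fields on the torus are given in the canonical trivialization of the tangent bundle;
  curves are differentiated through a lift to the plane.\<close>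

definition torus_integral_curve :: "(torus \<Rightarrow> real \<times> real) \<Rightarrow> (real \<Rightarrow> torus) \<Rightarrow> bool" where
  "torus_integral_curve X \<gamma> \<longleftrightarrow>
     (\<exists>c. (\<forall>t. \<gamma> t = torus_proj (c t)) \<and> (\<forall>t. (c has_vector_derivative X (\<gamma> t)) (at t)))"

definition generated_flow :: "(torus \<Rightarrow> real \<times> real) \<Rightarrow> (real \<Rightarrow> torus \<Rightarrow> torus) \<Rightarrow> bool" where
  "generated_flow X \<Phi> \<longleftrightarrow>
     (\<forall>x. \<Phi> 0 x = x) \<and> (\<forall>s t x. \<Phi> (s + t) x = \<Phi> s (\<Phi> t x)) \<and>
     (\<forall>x. torus_integral_curve X (\<lambda>t. \<Phi> t x))"

definition reparametrized_linear_flow ::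
    "real \<Rightarrow> torus \<Rightarrow> torus \<Rightarrow> (real \<Rightarrow> torus \<Rightarrow> torus) \<Rightarrow> bool" where
  "reparametrized_linear_flow \<alpha> p q \<Phi> \<longleftrightarrow> \<alpha> \<notin> \<rat> \<and> p \<noteq> q \<and>
     (\<exists>\<phi>. Ck_torus 3 \<phi> \<and> \<phi> p = 0 \<and> \<phi> q = 0 \<and> (\<forall>x. x \<noteq> p \<and> x \<noteq> q \<longrightarrow> \<phi> x > 0) \<and>
          hessian_pos_def_at \<phi> p \<and> hessian_pos_def_at \<phi> q \<and>
          generated_flow (\<lambda>x. \<phi> x *\<^sub>R (1, \<alpha>)) \<Phi>)"

definition borel_probs :: "torus measure set" where
  "borel_probs = {\<mu>. prob_space \<mu> \<and> sets \<mu> = sets borel}"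

definition weak_star :: "torus measure topology" where
  "weak_star = topology_generated_by
     {{\<mu> \<in> borel_probs. (\<integral>x. f x \<partial>\<mu>) \<in> U} | (f :: torus \<Rightarrow> real) U.
        continuous_on UNIV f \<and> open U}"

definition is_empirical_measure ::
    "(real \<Rightarrow> torus \<Rightarrow> torus) \<Rightarrow> torus \<Rightarrow> real \<Rightarrow> torus measure \<Rightarrow> bool" where
  "is_empirical_measure \<Phi> x t \<mu> \<longleftrightarrow> \<mu> \<in> borel_probs \<and>
     (\<forall>f :: torus \<Rightarrow> real. continuous_on UNIV f \<longrightarrow>
        (\<integral>y. f y \<partial>\<mu>) = (1 / t) * integral {0..t} (\<lambda>s. f (\<Phi> s x)))"

text \<open>The defining property above pins down a unique measure by its integrals; along an
  integral curve it is realized by the image of normalized Lebesgue measure.\<close>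

lemma is_empirical_measure_distr:
  assumes t: "t > 0" and curve: "torus_integral_curve X (\<lambda>s. \<Phi> s x)"
  shows "is_empirical_measure \<Phi> x t (distr (uniform_measure lborel {0..t}) borel (\<lambda>s. \<Phi> s x))"
proof -
  obtain c where c: "\<And>s. \<Phi> s x = torus_proj (c s)"
      and "\<And>s. (c has_vector_derivative X (\<Phi> s x)) (at s)"
    using curve unfolding torus_integral_curve_def by blast
  then have "continuous_on UNIV c"
    by (meson continuous_at_imp_continuous_on has_vector_derivative_continuous)
  then have "continuous_on UNIV (torus_proj \<circ> c)"
    by (intro continuous_on_compose continuous_on_subset[OF continuous_torus_proj]) auto
  then have cont: "continuous_on UNIV (\<lambda>s. \<Phi> s x)"
    by (simp add: c comp_def)
  then have meas: "(\<lambda>s. \<Phi> s x) \<in> borel_measurable (uniform_measure lborel {0..t})"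
    using borel_measurable_continuous_onI[OF cont]
    by (subst measurable_cong_sets[OF sets_uniform_measure refl]) simp
  have prob: "prob_space (uniform_measure lborel {0..t})"
    using t by (intro prob_space_uniform_measure) auto
  have "(\<integral>y. f y \<partial>distr (uniform_measure lborel {0..t}) borel (\<lambda>s. \<Phi> s x)) =
      (1 / t) * integral {0..t} (\<lambda>s. f (\<Phi> s x))"
    if f: "continuous_on UNIV f" for f :: "torus \<Rightarrow> real"
  proof -
    have contf: "continuous_on UNIV (\<lambda>s. f (\<Phi> s x))"
      using continuous_on_compose2[OF f cont] by simp
    have "(\<integral>y. f y \<partial>distr (uniform_measure lborel {0..t}) borel (\<lambda>s. \<Phi> s x)) =
        (\<integral>s. f (\<Phi> s x) \<partial>uniform_measure lborel {0..t})"
      by (rule integral_distr[OF meas borel_measurable_continuous_onI[OF f]])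
    also have "\<dots> = (LINT s:{0..t}|lborel. f (\<Phi> s x)) / t"
    proof -
      have *: "uniform_measure lborel {0..t} =
          density lborel (\<lambda>s. ennreal (indicator {0..t} s / t))"
        unfolding uniform_measure_def using t
        by (intro density_cong) (auto simp: indicator_def divide_ennreal[of 1 t, simplified])
      have "(\<integral>s. f (\<Phi> s x) \<partial>uniform_measure lborel {0..t}) =
          (\<integral>s. (indicator {0..t} s / t) * f (\<Phi> s x) \<partial>lborel)"
        unfolding * using t borel_measurable_continuous_onI[OF contf]
        by (subst integral_density) auto
      also have "\<dots> = (LINT s:{0..t}|lborel. f (\<Phi> s x)) / t"
        unfolding set_lebesgue_integral_def
        by (simp flip: integral_divide_zero)
      finally show ?thesis .
    qed
    also have "(LINT s:{0..t}|lborel. f (\<Phi> s x)) = integral {0..t} (\<lambda>s. f (\<Phi> s x))"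
      by (rule set_borel_integral_eq_integral(2))
        (rule borel_integrable_atLeastAtMost'[OF continuous_on_subset[OF contf subset_UNIV]])
    finally show ?thesis by simp
  qed
  moreover have "prob_space (distr (uniform_measure lborel {0..t}) borel (\<lambda>s. \<Phi> s x))"
    by (rule prob_space.prob_space_distr[OF prob meas])
  ultimately show ?thesis
    by (simp add: is_empirical_measure_def borel_probs_def)
qed

definition p_omega :: "(real \<Rightarrow> torus \<Rightarrow> torus) \<Rightarrow> torus \<Rightarrow> torus measure set" where
  "p_omega \<Phi> x =
     (\<Inter>T\<in>{0<..}. weak_star closure_of {\<mu>. \<exists>t\<ge>T. is_empirical_measure \<Phi> x t \<mu>})"

definition dirac_mix :: "real \<Rightarrow> torus \<Rightarrow> torus \<Rightarrow> torus measure" where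
  "dirac_mix s p q = measure_of UNIV (sets borel)
     (\<lambda>A. ennreal s * emeasure (return borel p) A + ennreal (1 - s) * emeasure (return borel q) A)"

lemma emeasure_dirac_mix:
  assumes "A \<in> sets borel"
  shows "emeasure (dirac_mix s p q) A =
    ennreal s * emeasure (return borel p) A + ennreal (1 - s) * emeasure (return borel q) A"
proof (rule emeasure_measure_of[OF dirac_mix_def])
  show "sets borel \<subseteq> Pow (UNIV :: torus set)" by simp
  show "A \<in> sets (dirac_mix s p q)"
    using assms by (simp add: dirac_mix_def sets.sigma_sets_eq[of borel, simplified])
  show "positive (sets (dirac_mix s p q)) (\<lambda>A. ennreal s * emeasure (return borel p) A +
      ennreal (1 - s) * emeasure (return borel q) A)"
    by (simp add: positive_def)
  show "countably_additive (sets (dirac_mix s p q)) (\<lambda>A. ennreal s * emeasure (return borel p) A +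
      ennreal (1 - s) * emeasure (return borel q) A)"
  proof (rule countably_additiveI)
    fix B :: "nat \<Rightarrow> torus set"
    assume B: "range B \<subseteq> sets (dirac_mix s p q)" and disj: "disjoint_family B"
    have B': "range B \<subseteq> sets borel"
      using B by (simp add: dirac_mix_def sets.sigma_sets_eq[of borel, simplified])
    show "(\<Sum>i. ennreal s * emeasure (return borel p) (B i) +
          ennreal (1 - s) * emeasure (return borel q) (B i)) =
        ennreal s * emeasure (return borel p) (\<Union>i. B i) +
          ennreal (1 - s) * emeasure (return borel q) (\<Union>i. B i)"
      using suminf_emeasure[of B "return borel p"] suminf_emeasure[of B "return borel q"] B' disj
      by (simp add: suminf_add[symmetric] del: emeasure_return)
  qed
qed

definition extreme_historic_behaviour ::
    "torus \<Rightarrow> torus \<Rightarrow> (real \<Rightarrow> torus \<Rightarrow> torus) \<Rightarrow> bool" where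
  "extreme_historic_behaviour p q \<Phi> \<longleftrightarrow>
     (AE x in haar_torus. p_omega \<Phi> x = {dirac_mix s p q | s. 0 \<le> s \<and> s \<le> 1})"

end

theory Submission
  imports Defs
begin

text \<open>
  Up to a time change the orbit of a point is a line of slope \<open>\<alpha>\<close>, traversed with speed \<open>\<phi>\<close>, and the
  speed is comparable to the product of the squared distances to \<open>p\<close> and \<open>q\<close>. Hence the times spent
  near \<open>p\<close> and near \<open>q\<close> are comparable to the sums of \<open>1 / \<parallel>y + k \<alpha>\<parallel>\<close> and of
  \<open>1 / \<parallel>y - a / b + k \<alpha>\<parallel>\<close>, where \<open>y\<close> is the intercept of the line and \<open>\<parallel>\<cdot>\<parallel>\<close> is the distance to the
  nearest integer. These sums grow superlinearly, so empirical measures only accumulate at mixtures of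
  the two Dirac measures.

  Let \<open>P / Q\<close> be a convergent with \<open>Q\<close> coprime to \<open>b\<close> and \<open>Q \<bar>Q \<alpha> - P\<bar> \<le> Q powr - \<nu>\<close>. Over blocks of
  length \<open>Q\<close> the rotation orbit is periodic up to a slow drift. If \<open>Q y\<close> lies at distance about
  \<open>\<epsilon>\<close> from the integers on the side from which it drifts towards them, then until it reaches them
  the first sum exceeds the second one by a factor of order \<open>\<nu> / \<epsilon>\<close>: at that time
  \<open>Q (y - a / b)\<close> is still away from the integers, as \<open>Q a / b\<close> is not an integer. For every \<open>\<epsilon>\<close>
  almost every \<open>y\<close> is so placed infinitely often, and the same holds with \<open>p\<close> and \<open>q\<close> exchanged.
  So the fraction of time spent near \<open>p\<close> oscillates between \<open>0\<close> and \<open>1\<close>.\<close>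

text \<open>Why every exponent \<nu> > 0 is enough: in a block of Q steps the points other than the
  approaching one are about 1/Q apart and contribute a harmonic sum, of order Q ln Q, to either sum.
  Let d = Q |Q \<alpha> - P|. The approaching point comes closer by d/Q per block, so over M blocks
  it contributes Q/d times a harmonic sum of M terms, where M d is about \<epsilon>. This is about
  (M Q / \<epsilon>) ln (1/d), and ln (1/d) \<ge> \<nu> ln Q has the order of the other harmonic
  sum, so the factor 1/\<epsilon> decides. The placement condition selects the proportion
  \<epsilon>/2 of every period 1/Q, however fast the Q grow. It therefore has a uniform positive
  density in every interval once Q is large, which makes the set of points that eventually fail it a
  null set. Limit measures live on {p, q} because the time average of \<phi> is the mean
  displacement along the line, and superlinear growth of the sums forces it to 0. Mixtures strictly
  between the two Dirac measures arise by continuity in time of the fraction of time spent near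
  p.\<close>

section \<open>Continued fractions\<close>

text \<open>Numerator and denominator of the convergents, by recursion from the front: with
  \<open>\<alpha> = \<lfloor>\<alpha>\<rfloor> + 1 / \<beta>\<close> they are obtained from those of \<open>\<beta>\<close>. The usual backward recurrence of the
  convergents is never needed.\<close>

fun cf_num_den :: "real \<Rightarrow> nat \<Rightarrow> int \<times> int" where
  "cf_num_den \<alpha> 0 = (\<lfloor>\<alpha>\<rfloor>, 1)"
| "cf_num_den \<alpha> (Suc n) =
     (let (h, k) = cf_num_den (1 / frac \<alpha>) n in (\<lfloor>\<alpha>\<rfloor> * h + k, h))"

lemma cf_tail_shift: "cf_tail (1 / frac \<alpha>) n = cf_tail \<alpha> (Suc n)"
  by (induction n) auto

lemma inverse_frac_irrational:
  fixes \<alpha> :: real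
  assumes "\<alpha> \<notin> \<rat>"
  shows "1 / frac \<alpha> \<notin> \<rat>" "1 / frac \<alpha> > 1"
proof -
  have fr: "frac \<alpha> \<notin> \<rat>"
  proof
    assume "frac \<alpha> \<in> \<rat>"
    then have "frac \<alpha> + of_int \<lfloor>\<alpha>\<rfloor> \<in> \<rat>" by (intro Rats_add Rats_of_int)
    then show False using assms by (simp add: frac_def)
  qed
  show "1 / frac \<alpha> \<notin> \<rat>"
  proof
    assume "1 / frac \<alpha> \<in> \<rat>"
    then have "1 / (1 / frac \<alpha>) \<in> \<rat>" using Rats_divide[OF Rats_1] by blast
    then show False using fr by simp
  qed
  have "frac \<alpha> \<noteq> 0" using fr by (metis Rats_0)
  then have "0 < frac \<alpha>" using frac_ge_0[of \<alpha>] by linarith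
  then show "1 / frac \<alpha> > 1" using frac_lt_1[of \<alpha>] by simp
qed

text \<open>The bound by \<open>n\<close> makes the denominators unbounded, so good approximations
  exist beyond every \<open>N\<close>. The numerator bound carries the induction: a denominator is
  the numerator of the preceding stage for \<open>1 / frac \<alpha>\<close>, which exceeds
  1.\<close>

lemma cf_num_den_pos:
  fixes \<alpha> :: real
  assumes "\<alpha> \<notin> \<rat>"
  shows "snd (cf_num_den \<alpha> n) \<ge> int n" "snd (cf_num_den \<alpha> n) \<ge> 1"
    "\<alpha> > 1 \<Longrightarrow> fst (cf_num_den \<alpha> n) \<ge> int n + 1"
proof -
  have "snd (cf_num_den \<alpha> n) \<ge> int n \<and> snd (cf_num_den \<alpha> n) \<ge> 1 \<and>
     (\<alpha> > 1 \<longrightarrow> fst (cf_num_den \<alpha> n) \<ge> int n + 1)"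
    using assms
  proof (induction n arbitrary: \<alpha>)
    case 0
    then show ?case by simp
  next
    case (Suc n)
    define \<beta> where "\<beta> = 1 / frac \<alpha>"
    obtain h k where hk: "cf_num_den \<beta> n = (h, k)" by (cases "cf_num_den \<beta> n")
    have b: "\<beta> \<notin> \<rat>" "\<beta> > 1" using inverse_frac_irrational[OF Suc.prems] by (auto simp: \<beta>_def)
    from Suc.IH[OF b(1)] b(2) hk have h: "h \<ge> int n + 1" "k \<ge> 1" by auto
    have "h \<le> \<lfloor>\<alpha>\<rfloor> * h" if "\<alpha> > 1"
    proof -
      have "1 \<le> \<lfloor>\<alpha>\<rfloor>" using that by linarith
      then show ?thesis using h mult_right_mono[of 1 "\<lfloor>\<alpha>\<rfloor>" h] by simp
    qed
    moreover have "cf_num_den \<alpha> (Suc n) = (\<lfloor>\<alpha>\<rfloor> * h + k, h)" using hk by (simp add: \<beta>_def)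
    moreover have "int (Suc n) + 1 \<le> \<lfloor>\<alpha>\<rfloor> * h + k" if "\<alpha> > 1"
      using \<open>\<alpha> > 1 \<Longrightarrow> h \<le> \<lfloor>\<alpha>\<rfloor> * h\<close>[OF that] h by linarith
    ultimately show ?case using h by (simp del: cf_num_den.simps)
  qed
  then show "snd (cf_num_den \<alpha> n) \<ge> int n" "snd (cf_num_den \<alpha> n) \<ge> 1"
    "\<alpha> > 1 \<Longrightarrow> fst (cf_num_den \<alpha> n) \<ge> int n + 1" by auto
qed

lemma coprime_cf_num_den: "coprime (fst (cf_num_den \<alpha> n)) (snd (cf_num_den \<alpha> n))"
proof (induction n arbitrary: \<alpha>)
  case 0
  then show ?case by simp
next
  case (Suc n)
  obtain h k where hk: "cf_num_den (1 / frac \<alpha>) n = (h, k)"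
    by (cases "cf_num_den (1 / frac \<alpha>) n")
  have "coprime h k" using Suc.IH[of "1 / frac \<alpha>"] hk by simp
  then have "gcd (\<lfloor>\<alpha>\<rfloor> * h + k) h = 1"
    by (metis add.commute coprime_iff_gcd_eq_1 gcd.commute gcd_add_mult mult.commute)
  then show ?case using hk by (simp add: coprime_iff_gcd_eq_1)
qed

lemma cf_eval_num_den:
  fixes \<alpha> :: real
  assumes "\<alpha> \<notin> \<rat>"
  shows "cf_eval (map (cf_coeff \<alpha>) [0..<Suc n]) =
    of_int (fst (cf_num_den \<alpha> n)) / of_int (snd (cf_num_den \<alpha> n))"
  using assms
proof (induction n arbitrary: \<alpha>)
  case 0
  then show ?case by (simp add: cf_coeff_def)
next
  case (Suc n)
  define \<beta> where "\<beta> = 1 / frac \<alpha>"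
  obtain h k where hk: "cf_num_den \<beta> n = (h, k)" by (cases "cf_num_den \<beta> n")
  have b: "\<beta> \<notin> \<rat>" "\<beta> > 1" using inverse_frac_irrational[OF Suc.prems] by (auto simp: \<beta>_def)
  have pos: "h \<ge> 1" "k \<ge> 1" using cf_num_den_pos[OF b(1), of n] b(2) hk by auto
  have shift: "cf_coeff \<alpha> (Suc j) = cf_coeff \<beta> j" for j
    unfolding cf_coeff_def \<beta>_def cf_tail_shift ..
  have "map (cf_coeff \<alpha>) [0..<Suc (Suc n)] = cf_coeff \<alpha> 0 # map (cf_coeff \<beta>) [0..<Suc n]"
    unfolding upt_conv_Cons[OF zero_less_Suc[of "Suc n"]] list.map map_Suc_upt[symmetric]
    by (simp add: shift)
  \<comment> \<open>The head is exposed because the recursive equation of \<open>cf_eval\<close>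
    applies only to lists with at least two elements.\<close>
  moreover have "map (cf_coeff \<beta>) [0..<Suc n] = cf_coeff \<beta> 0 # map (cf_coeff \<beta>) [1..<Suc n]"
    by (simp add: upt_conv_Cons del: upt_Suc)
  ultimately have "cf_eval (map (cf_coeff \<alpha>) [0..<Suc (Suc n)]) =
      of_int (cf_coeff \<alpha> 0) + 1 / cf_eval (map (cf_coeff \<beta>) [0..<Suc n])"
    by (simp del: upt_Suc)
  also have "\<dots> = of_int \<lfloor>\<alpha>\<rfloor> + of_int k / of_int h"
    unfolding Suc.IH[OF b(1)] hk by (simp add: cf_coeff_def)
  also have "\<dots> = of_int (\<lfloor>\<alpha>\<rfloor> * h + k) / of_int h"
    using pos by (simp add: field_simps)
  finally show ?case using hk by (simp add: \<beta>_def)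
qed

lemma cf_denom_eq:
  fixes \<alpha> :: real
  assumes "\<alpha> \<notin> \<rat>"
  shows "cf_denom \<alpha> n = snd (cf_num_den \<alpha> n)"
proof -
  obtain h k where hk: "cf_num_den \<alpha> n = (h, k)" by (cases "cf_num_den \<alpha> n")
  have "k > 0" "coprime h k"
    using cf_num_den_pos[OF assms, of n] coprime_cf_num_den[of \<alpha> n] hk by auto
  then have "quotient_of (of_int h / of_int k) = (h, k)"
    by (metis Fract_of_int_quotient quotient_of_Fract normalize_stable)
  then show ?thesis
    unfolding cf_denom_def cf_convergent_def cf_eval_num_den[OF assms] hk by simp
qed

text \<open>With \<alpha> = a0 + 1/\<beta>, the error of \<alpha> at stage n + 1 is the error of
  \<beta> at stage n divided by \<beta>. Iterating gives an exact formula in terms of the complete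
  quotients \<open>cf_tail\<close>.\<close>

lemma cf_error:
  fixes \<alpha> :: real
  assumes "\<alpha> \<notin> \<rat>"
  shows "\<bar>snd (cf_num_den \<alpha> n) * \<alpha> - fst (cf_num_den \<alpha> n)\<bar> * (\<Prod>i\<in>{1..Suc n}. cf_tail \<alpha> i) = 1"
  using assms
proof (induction n arbitrary: \<alpha>)
  case 0
  have "1 / frac \<alpha> > 1" using inverse_frac_irrational[OF 0] by simp
  then have "frac \<alpha> \<noteq> 0" by (metis div_by_0 not_one_less_zero)
  then show ?case by (simp add: frac_def)
next
  case (Suc n)
  define \<beta> where "\<beta> = 1 / frac \<alpha>"
  obtain h k where hk: "cf_num_den \<beta> n = (h, k)" by (cases "cf_num_den \<beta> n")
  have b: "\<beta> \<notin> \<rat>" "\<beta> > 1" using inverse_frac_irrational[OF Suc.prems] by (auto simp: \<beta>_def)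
  have \<alpha>: "\<alpha> = \<lfloor>\<alpha>\<rfloor> + 1 / \<beta>" by (simp add: \<beta>_def frac_def)
  have "h * \<alpha> - (\<lfloor>\<alpha>\<rfloor> * h + k) = (h - k * \<beta>) / \<beta>"
  proof -
    have "h * \<alpha> = h * \<lfloor>\<alpha>\<rfloor> + h / \<beta>" using arg_cong[OF \<alpha>, of "\<lambda>x. h * x"] by (simp add: distrib_left)
    then show ?thesis using b(2) by (simp add: field_simps)
  qed
  then have e: "\<bar>h * \<alpha> - (\<lfloor>\<alpha>\<rfloor> * h + k)\<bar> = \<bar>k * \<beta> - h\<bar> / \<beta>"
    using b(2) by (simp add: abs_minus_commute)
  have "(\<Prod>i\<in>{1..Suc (Suc n)}. cf_tail \<alpha> i) = cf_tail \<alpha> 1 * (\<Prod>i\<in>{Suc 1..Suc (Suc n)}. cf_tail \<alpha> i)"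
    by (rule prod.atLeast_Suc_atMost) simp
  also have "(\<Prod>i\<in>{Suc 1..Suc (Suc n)}. cf_tail \<alpha> i) = (\<Prod>i\<in>{1..Suc n}. cf_tail \<alpha> (Suc i))"
    by (rule prod.atLeast_Suc_atMost_Suc_shift[unfolded comp_def])
  also have "\<dots> = (\<Prod>i\<in>{1..Suc n}. cf_tail \<beta> i)"
    unfolding \<beta>_def cf_tail_shift ..
  finally have p: "(\<Prod>i\<in>{1..Suc (Suc n)}. cf_tail \<alpha> i) = \<beta> * (\<Prod>i\<in>{1..Suc n}. cf_tail \<beta> i)"
    by (simp add: \<beta>_def)
  show ?case
    unfolding p using Suc.IH[OF b(1)] hk e b(2)
    by (simp add: \<beta>_def[symmetric] del: prod.cl_ivl_Suc cf_tail.simps)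
qed

text \<open>Inserting \<alpha> = \<lfloor>\<alpha>\<rfloor> + 1/\<beta> into the product of tails
  gives it the same recursion as the numerator, and \<alpha> > 1 makes the coefficient
  \<lfloor>\<alpha>\<rfloor> nonnegative. The denominator bound is the numerator bound of the
  preceding stage.\<close>

lemma cf_num_den_le_prod:
  fixes \<alpha> :: real
  assumes "\<alpha> \<notin> \<rat>"
  shows "snd (cf_num_den \<alpha> n) \<le> (\<Prod>i\<in>{1..n}. cf_tail \<alpha> i) \<and>
    (\<alpha> > 1 \<longrightarrow> fst (cf_num_den \<alpha> n) \<le> (\<Prod>i\<in>{0..n}. cf_tail \<alpha> i))"
  using assms
proof (induction n arbitrary: \<alpha>)
  case 0
  then show ?case by simp
next
  case (Suc n)
  define \<beta> where "\<beta> = 1 / frac \<alpha>"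
  obtain h k where hk: "cf_num_den \<beta> n = (h, k)" by (cases "cf_num_den \<beta> n")
  have b: "\<beta> \<notin> \<rat>" "\<beta> > 1" using inverse_frac_irrational[OF Suc.prems] by (auto simp: \<beta>_def)
  have \<alpha>: "\<alpha> = \<lfloor>\<alpha>\<rfloor> + 1 / \<beta>" by (simp add: \<beta>_def frac_def)
  have IH: "k \<le> (\<Prod>i\<in>{1..n}. cf_tail \<beta> i)" "h \<le> (\<Prod>i\<in>{0..n}. cf_tail \<beta> i)"
    using Suc.IH[OF b(1)] b(2) hk by auto
  have p: "(\<Prod>i\<in>{1..Suc n}. cf_tail \<alpha> i) = (\<Prod>i\<in>{0..n}. cf_tail \<beta> i)"
    unfolding \<beta>_def cf_tail_shift
    using prod.atLeast_Suc_atMost_Suc_shift[of "cf_tail \<alpha>" 0 n] by (simp add: comp_def)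
  have p0: "(\<Prod>i\<in>{0..n}. cf_tail \<beta> i) = \<beta> * (\<Prod>i\<in>{1..n}. cf_tail \<beta> i)"
    by (simp add: prod.atLeast_Suc_atMost)
  have p1: "(\<Prod>i\<in>{0..Suc n}. cf_tail \<alpha> i) = \<alpha> * (\<Prod>i\<in>{1..Suc n}. cf_tail \<alpha> i)"
    by (simp add: prod.atLeast_Suc_atMost)
  have "\<lfloor>\<alpha>\<rfloor> * h + k \<le> (\<Prod>i\<in>{0..Suc n}. cf_tail \<alpha> i)" if "\<alpha> > 1"
  proof -
    have "(\<Prod>i\<in>{0..Suc n}. cf_tail \<alpha> i) = (\<lfloor>\<alpha>\<rfloor> + 1 / \<beta>) * (\<beta> * (\<Prod>i\<in>{1..n}. cf_tail \<beta> i))"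
      unfolding p1 p p0 using \<alpha> by simp
    also have "\<dots> = \<lfloor>\<alpha>\<rfloor> * (\<Prod>i\<in>{0..n}. cf_tail \<beta> i) + (\<Prod>i\<in>{1..n}. cf_tail \<beta> i)"
      unfolding p0 using b(2) by (simp add: field_simps)
    also have "\<dots> \<ge> \<lfloor>\<alpha>\<rfloor> * h + k"
      using IH that unfolding of_int_add of_int_mult by (intro add_mono mult_left_mono) auto
    finally show ?thesis by simp
  qed
  then show ?case using hk IH(2) p by (simp add: \<beta>_def[symmetric])
qed

text \<open>By \<open>cf_error\<close> the error is the reciprocal of a product of n + 1 tails: the
  first n of them bound the denominator, the last one bounds the next coefficient. This plays the
  role of the classical estimate by 1/q_{n+1}.\<close>

lemma cf_approximation:
  fixes \<alpha> :: real
  assumes "\<alpha> \<notin> \<rat>"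
  shows "\<bar>snd (cf_num_den \<alpha> n) * \<alpha> - fst (cf_num_den \<alpha> n)\<bar> *
    (snd (cf_num_den \<alpha> n) * cf_coeff \<alpha> (Suc n)) \<le> 1"
proof -
  let ?h = "fst (cf_num_den \<alpha> n)" and ?k = "snd (cf_num_den \<alpha> n)"
  have pos: "cf_tail \<alpha> (Suc j) \<notin> \<rat> \<and> cf_tail \<alpha> (Suc j) > 1" for j
    by (induction j) (use inverse_frac_irrational assms in auto)
  have "?k * cf_coeff \<alpha> (Suc n) \<le> (\<Prod>i\<in>{1..n}. cf_tail \<alpha> i) * cf_tail \<alpha> (Suc n)"
    using cf_num_den_le_prod[OF assms, of n] cf_num_den_pos(2)[OF assms, of n] pos[of n]
    unfolding cf_coeff_def of_int_mult
    by (intro mult_mono order_trans[OF _ conjunct1[OF cf_num_den_le_prod[OF assms, of n]]])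
      (auto simp: less_imp_le)
  also have "\<dots> = (\<Prod>i\<in>{1..Suc n}. cf_tail \<alpha> i)" by simp
  finally have "\<bar>?k * \<alpha> - ?h\<bar> * (?k * cf_coeff \<alpha> (Suc n)) \<le>
      \<bar>?k * \<alpha> - ?h\<bar> * (\<Prod>i\<in>{1..Suc n}. cf_tail \<alpha> i)"
    by (intro mult_left_mono) auto
  then show ?thesis unfolding cf_error[OF assms, of n] .
qed

text \<open>All that is retained of the continued fraction. Coprimality of P and Q makes j P run
  through all residues mod Q; coprimality of Q and b keeps Q a / b away from the integers.\<close>

definition good_approx :: "real \<Rightarrow> real \<Rightarrow> int \<Rightarrow> int \<Rightarrow> nat \<Rightarrow> bool" where
  "good_approx \<alpha> \<nu> b P Q \<longleftrightarrow> coprime P (int Q) \<and> coprime (int Q) b \<and>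
     real Q * \<bar>real Q * \<alpha> - P\<bar> \<le> real Q powr (- \<nu>)"

lemma W_set_good_approx:
  assumes "\<alpha> \<in> W_set \<nu> b"
  shows "\<exists>P Q. Q \<ge> N \<and> good_approx \<alpha> \<nu> b P Q"
proof -
  have irr: "\<alpha> \<notin> \<rat>" and inf: "infinite {n. real_of_int (cf_coeff \<alpha> (Suc n)) \<ge> real_of_int (cf_denom \<alpha> n) powr \<nu> \<and>
                  gcd (cf_denom \<alpha> n) b = 1}" (is "infinite ?A")
    using assms by (auto simp: W_set_def)
  obtain n where n: "n \<ge> N" "n \<in> ?A"
    using inf infinite_nat_iff_unbounded_le by blast
  obtain h k where hk: "cf_num_den \<alpha> n = (h, k)" by (cases "cf_num_den \<alpha> n")
  have k: "k \<ge> int n" "k \<ge> 1" using cf_num_den_pos[OF irr, of n] hk by auto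
  have kd: "cf_denom \<alpha> n = k" using cf_denom_eq[OF irr] hk by simp
  have ge: "real_of_int (cf_coeff \<alpha> (Suc n)) \<ge> real_of_int k powr \<nu>" and cop: "coprime k b"
    using n by (auto simp: kd coprime_iff_gcd_eq_1)
  have "k * \<bar>k * \<alpha> - h\<bar> * real_of_int k powr \<nu> \<le> k * \<bar>k * \<alpha> - h\<bar> * cf_coeff \<alpha> (Suc n)"
    using ge k by (intro mult_left_mono) auto
  also have "\<dots> \<le> 1" using cf_approximation[OF irr, of n] hk by (simp add: mult_ac)
  finally have "k * \<bar>k * \<alpha> - h\<bar> \<le> real_of_int k powr (- \<nu>)"
    using k by (simp add: powr_minus field_simps)
  then have "good_approx \<alpha> \<nu> b h (nat k)"
    using k cop coprime_cf_num_den[of \<alpha> n] hk by (simp add: good_approx_def)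
  moreover have "nat k \<ge> N" using k n by linarith
  ultimately show ?thesis by blast
qed

section \<open>Sums along a rotation\<close>

definition dist_int :: "real \<Rightarrow> real" where
  "dist_int x = \<bar>x - of_int (round x)\<bar>"

lemma dist_int_le: "dist_int x \<le> \<bar>x - of_int m\<bar>"
  unfolding dist_int_def by (rule round_diff_minimal)

lemma dist_int_nonneg [simp]: "dist_int x \<ge> 0"
  by (simp add: dist_int_def)

lemma dist_int_le_half: "dist_int x \<le> 1 / 2"
  unfolding dist_int_def using of_int_round_abs_le[of x] by (simp add: abs_minus_commute)

lemma dist_int_lipschitz: "dist_int x \<le> dist_int y + \<bar>x - y\<bar>"
  using dist_int_le[of x "round y"] unfolding dist_int_def[of y] by linarith

lemma dist_int_add_int [simp]: "dist_int (x + of_int m) = dist_int x"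
proof -
  have "dist_int (x + of_int m) \<le> dist_int x"
    using dist_int_le[of "x + of_int m" "round x + m"] unfolding dist_int_def[of x] by simp
  moreover have "dist_int x \<le> dist_int (x + of_int m)"
    using dist_int_le[of x "round (x + of_int m) - m"] unfolding dist_int_def[of "x + of_int m"]
    by (simp add: algebra_simps)
  ultimately show ?thesis by simp
qed

lemma dist_int_eqI: "x - y \<in> \<int> \<Longrightarrow> dist_int x = dist_int y"
  by (metis Ints_cases add.commute diff_add_cancel dist_int_add_int)

lemma dist_int_eq_0_iff: "dist_int x = 0 \<longleftrightarrow> x \<in> \<int>"
proof
  assume "dist_int x = 0"
  then have "x = of_int (round x)" by (simp add: dist_int_def)
  then show "x \<in> \<int>" by (metis Ints_of_int)
next
  assume "x \<in> \<int>"
  then show "dist_int x = 0" using dist_int_eqI[of x 0] by (simp add: dist_int_def)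
qed

lemma dist_int_pos_iff: "dist_int x > 0 \<longleftrightarrow> x \<notin> \<int>"
  using dist_int_eq_0_iff[of x] dist_int_nonneg[of x] by linarith

lemma dist_int_small: "\<bar>x\<bar> \<le> 1 / 2 \<Longrightarrow> dist_int x = \<bar>x\<bar>"
proof -
  assume x: "\<bar>x\<bar> \<le> 1 / 2"
  show ?thesis
  proof (cases "round x = 0")
    case False
    then have "\<bar>real_of_int (round x)\<bar> \<ge> 1" by linarith
    then have "dist_int x \<ge> \<bar>x\<bar>" unfolding dist_int_def using x by linarith
    then show ?thesis using dist_int_le[of x 0] by simp
  qed (simp add: dist_int_def)
qed

lemma continuous_on_dist_int [continuous_intros]:
  assumes "continuous_on S f"
  shows "continuous_on S (\<lambda>x. dist_int (f x))"
proof -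
  have "continuous_on UNIV dist_int"
  proof (rule continuous_onI)
    fix x e :: real assume "e > 0"
    then show "\<exists>d>0. \<forall>x'\<in>UNIV. dist x' x < d \<longrightarrow> dist (dist_int x') (dist_int x) \<le> e"
    proof (intro exI[of _ e] conjI ballI impI)
      fix x' assume "dist x' x < e"
      then show "dist (dist_int x') (dist_int x) \<le> e"
        using dist_int_lipschitz[of x x'] dist_int_lipschitz[of x' x] unfolding dist_real_def by linarith
    qed
  qed
  then show ?thesis using assms by (rule continuous_on_compose2) auto
qed

lemma dist_int_ge_fraction:
  fixes a b :: int
  assumes "b \<ge> 1" "\<not> b dvd a"
  shows "dist_int (of_int a / of_int b) \<ge> 1 / of_int b"
proof -
  define m where "m = round (of_int a / of_int b :: real)"
  have "a - b * m \<noteq> 0" using assms(2) by auto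
  then have "1 \<le> \<bar>a - b * m\<bar>" by linarith
  then have "1 \<le> \<bar>of_int a - of_int b * of_int m :: real\<bar>"
    by (metis of_int_1_le_iff of_int_abs of_int_diff of_int_mult)
  moreover have "\<bar>of_int a / of_int b - of_int m :: real\<bar> = \<bar>of_int a - of_int b * of_int m\<bar> / of_int b"
    using assms(1) by (simp add: field_simps abs_divide flip: abs_mult)
  ultimately show ?thesis using assms(1)
    unfolding dist_int_def m_def[symmetric] by (simp add: divide_right_mono)
qed

text \<open>The shift \<open>c\<close> absorbs the integer part of the intercept and the starting
  index of a block.\<close>

lemma bij_betw_residues:
  fixes P c :: int
  assumes "coprime P (int Q)" "Q > 0"
  shows "bij_betw (\<lambda>j. nat ((c + int j * P) mod int Q)) {..<Q} {..<Q}"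
proof -
  let ?f = "\<lambda>j. nat ((c + int j * P) mod int Q)"
  have sub: "?f ` {..<Q} \<subseteq> {..<Q}" using assms(2) by (auto simp: nat_less_iff)
  have inj: "inj_on ?f {..<Q}"
  proof (rule inj_onI)
    fix i j assume ij: "i \<in> {..<Q}" "j \<in> {..<Q}" and eq: "?f i = ?f j"
    have "(c + int i * P) mod int Q = (c + int j * P) mod int Q"
      using eq assms(2) by (metis (no_types, opaque_lifting) nat_eq_iff2 of_nat_0_less_iff pos_mod_sign)
    then have "int Q dvd (int i - int j) * P"
      by (simp add: mod_eq_dvd_iff left_diff_distrib)
    then have "int Q dvd int i - int j"
      using assms(1) by (simp add: coprime_commute coprime_dvd_mult_left_iff)
    then show "i = j" using ij
      by (metis dvd_imp_le_int lessThan_iff abs_of_nat eq_iff_diff_eq_0 linorder_not_less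
          mod_eq_dvd_iff mod_less nat_int of_nat_eq_iff zmod_int)
  qed
  then have "?f ` {..<Q} = {..<Q}"
    using sub by (intro card_subset_eq) (auto simp: card_image)
  then show ?thesis using inj by (simp add: bij_betw_def)
qed

section \<open>Harmonic sums and sums split into blocks of length Q\<close>

lemma sum_inverse_ge_ln: "ln (real (Suc n)) \<le> (\<Sum>j<n. 1 / real (Suc j))"
proof -
  have "ln (real n + 1) \<le> harm n" by (rule ln_le_harm)
  also have "harm n = (\<Sum>j<n. 1 / real (Suc j))"
    unfolding harm_altdef by (simp add: inverse_eq_divide)
  finally show ?thesis by (simp add: add.commute)
qed

lemma sum_inverse_le_ln: "n > 0 \<Longrightarrow> (\<Sum>j<n. 1 / real (Suc j)) \<le> 1 + ln (real n)"
proof (induction n)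
  case (Suc n)
  show ?case
  proof (cases "n = 0")
    case False
    have "ln (real n / real (Suc n)) \<le> real n / real (Suc n) - 1"
      using False by (intro ln_le_minus_one) auto
    then have "1 / real (Suc n) \<le> ln (real (Suc n)) - ln (real n)"
      using False by (simp add: ln_div field_simps)
    then show ?thesis using Suc False by simp
  qed simp
qed simp

lemma sum_lessThan_blocks:
  fixes f :: "nat \<Rightarrow> real"
  shows "(\<Sum>k<M * Q. f k) = (\<Sum>m<M. \<Sum>j<Q. f (m * Q + j))"
proof -
  have "(\<Sum>k\<in>{m * Q..<m * Q + Q}. f k) = (\<Sum>j<Q. f (m * Q + j))" for m
    using sum.shift_bounds_nat_ivl[of f 0 "m * Q" Q] by (simp add: add.commute lessThan_atLeast0)
  then show ?thesis by (simp flip: sum.nat_group)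
qed

lemma sum_atLeastLessThan_blocks:
  fixes f :: "nat \<Rightarrow> real"
  assumes "M \<ge> 1"
  shows "(\<Sum>k\<in>{Q..<M * Q}. f k) = (\<Sum>m\<in>{1..<M}. \<Sum>j<Q. f (m * Q + j))"
proof -
  have "(\<Sum>k<M * Q. f k) = (\<Sum>j<Q. f j) + (\<Sum>m\<in>{1..<M}. \<Sum>j<Q. f (m * Q + j))"
    unfolding sum_lessThan_blocks using assms by (simp add: lessThan_atLeast0 sum.atLeast_Suc_lessThan)
  then show ?thesis
    using sum.atLeastLessThan_concat[of 0 Q "M * Q" f] assms by (simp add: lessThan_atLeast0)
qed

text \<open>Modulo 1 the Q points are the multiples of 1/Q up to an error of at most 2/Q: less than
  1/Q from the fractional part of Q y, and at most 1/Q from the drift. Hence the sum is at least Q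
  times a harmonic sum starting at 1/2; its missing first term is the -1.\<close>

lemma block_rotation_lower:
  fixes y \<alpha> :: real
  assumes cop: "coprime P (int Q)" and Q: "Q > 0"
    and appr: "\<bar>real Q * \<alpha> - of_int P\<bar> \<le> 1 / real Q"
    and pos: "\<And>j. j < Q \<Longrightarrow> dist_int (y + \<alpha> * real j) > 0"
  shows "(\<Sum>j<Q. 1 / dist_int (y + \<alpha> * real j)) \<ge> real Q * (ln (real Q) - 1)"
proof -
  define c where "c = \<lfloor>real Q * y\<rfloor>"
  define \<sigma> where "\<sigma> j = nat ((c + int j * P) mod int Q)" for j
  define \<eta> where "\<eta> = real Q * \<alpha> - of_int P"
  have bij: "bij_betw \<sigma> {..<Q} {..<Q}" unfolding \<sigma>_def by (rule bij_betw_residues[OF cop Q])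
  have bd: "dist_int (y + \<alpha> * real j) \<le> (real (\<sigma> j) + 2) / real Q" if j: "j < Q" for j
  proof -
    define m where "m = (c + int j * P) div int Q"
    have s: "real (\<sigma> j) = of_int (c + int j * P) - real Q * of_int m"
    proof -
      have "int (\<sigma> j) = (c + int j * P) mod int Q" using Q by (simp add: \<sigma>_def)
      also have "\<dots> = (c + int j * P) - int Q * m"
        unfolding m_def by (simp add: minus_mult_div_eq_mod)
      finally show ?thesis
        by (metis of_int_diff of_int_mult of_int_of_nat_eq)
    qed
    have "real Q * (y + \<alpha> * real j - of_int m) = frac (real Q * y) + real (\<sigma> j) + real j * \<eta>"
      unfolding s frac_def c_def[symmetric] \<eta>_def by (simp add: algebra_simps)
    moreover have "real j * \<bar>\<eta>\<bar> \<le> 1"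
    proof -
      have "real j * \<bar>\<eta>\<bar> \<le> real Q * (1 / real Q)"
        using j appr by (intro mult_mono) (auto simp: \<eta>_def)
      then show ?thesis using Q by simp
    qed
    then have "\<bar>real j * \<eta>\<bar> \<le> 1" by (simp add: abs_mult)
    ultimately have "\<bar>real Q * (y + \<alpha> * real j - of_int m)\<bar> \<le> real (\<sigma> j) + 2"
      using frac_lt_1[of "real Q * y"] frac_ge_0[of "real Q * y"] by linarith
    then have "\<bar>y + \<alpha> * real j - of_int m\<bar> \<le> (real (\<sigma> j) + 2) / real Q"
      using Q by (simp add: abs_mult pos_le_divide_eq mult.commute)
    then show ?thesis using dist_int_le[of "y + \<alpha> * real j" m] by linarith
  qed
  have "real Q * (ln (real Q) - 1) \<le> real Q * (\<Sum>i<Q. 1 / (real i + 2))"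
  proof -
    have "ln (real (Suc (Suc Q))) \<le> (\<Sum>j<Suc Q. 1 / real (Suc j))" by (rule sum_inverse_ge_ln)
    also have "\<dots> = 1 + (\<Sum>i<Q. 1 / (real i + 2))"
      unfolding sum.lessThan_Suc_shift by (simp add: add.commute)
    finally have "ln (real (Suc (Suc Q))) - 1 \<le> (\<Sum>i<Q. 1 / (real i + 2))" by simp
    moreover have "ln (real Q) \<le> ln (real (Suc (Suc Q)))" using Q by simp
    ultimately show ?thesis by (intro mult_left_mono) auto
  qed
  also have "\<dots> = (\<Sum>i<Q. real Q / (real i + 2))" by (simp add: sum_distrib_left)
  also have "\<dots> = (\<Sum>j<Q. real Q / (real (\<sigma> j) + 2))"
    by (rule sum.reindex_bij_betw[OF bij, symmetric])
  also have "\<dots> \<le> (\<Sum>j<Q. 1 / dist_int (y + \<alpha> * real j))"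
  proof (rule sum_mono)
    fix j assume "j \<in> {..<Q}"
    then have "1 / ((real (\<sigma> j) + 2) / real Q) \<le> 1 / dist_int (y + \<alpha> * real j)"
      using bd pos by (intro divide_left_mono mult_pos_pos) (auto simp: Q)
    then show "real Q / (real (\<sigma> j) + 2) \<le> 1 / dist_int (y + \<alpha> * real j)" by simp
  qed
  finally show ?thesis .
qed

text \<open>Separates the contributions of the two neighbouring integers, so that each can be summed
  over residues on its own.\<close>

lemma inverse_dist_int_le:
  assumes "0 < x" "x < 1"
  shows "1 / dist_int x \<le> 1 / x + 1 / (1 - x)"
proof -
  have "dist_int x = x \<or> dist_int x = 1 - x"
  proof (cases "round x = 0 \<or> round x = 1")
    case False
    then have "round x \<le> -1 \<or> round x \<ge> 2" by linarith
    then have "dist_int x \<ge> 1" unfolding dist_int_def using assms by linarith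
    then show ?thesis using dist_int_le_half[of x] by linarith
  qed (use assms in \<open>auto simp: dist_int_def\<close>)
  then show ?thesis using assms by auto
qed

text \<open>
  Write \<open>\<eta> = Q \<alpha> - P\<close>. Up to integers, \<open>Q y = - sgn \<eta> * w\<close>, hence
  \<open>y + k \<alpha>\<close> is \<open>(n + k P - sgn \<eta> * (w - k \<bar>\<eta>\<bar>)) / Q\<close>: the orbit is a drifting copy of a
  period \<open>Q\<close> orbit, and during the first \<open>w / (Q \<bar>\<eta>\<bar>)\<close> periods one of its points moves
  towards \<open>0\<close> in steps of length \<open>\<bar>\<eta>\<bar>\<close>, whereas the drift is too small for a point to come
  closer than about \<open>1 / (b Q)\<close> to \<open>a / b\<close>.\<close>

lemma rotation_drift:
  fixes y \<alpha> \<epsilon> :: real and a b P :: int and Q :: nat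
  defines "\<eta> \<equiv> real Q * \<alpha> - of_int P"
  assumes PQ: "coprime P (int Q)" and Qb: "coprime (int Q) b" and ab: "coprime a b"
    and b: "b \<ge> 2" and Q: "Q \<ge> 2" and \<eta>: "\<eta> \<noteq> 0"
    and \<epsilon>: "\<epsilon> > 0" "\<epsilon> \<le> 1 / (2 * of_int b)"
    and small: "real Q * \<bar>\<eta>\<bar> \<le> \<epsilon> / 8"
    and hit: "frac (- sgn \<eta> * (real Q * y)) \<in> {\<epsilon> / 2<..<\<epsilon>}"
    and pos: "\<And>k. dist_int (y + \<alpha> * real k) > 0"
  obtains M where "M \<ge> 2"
    "(\<Sum>k\<in>{Q..<M * Q}. 1 / dist_int (y + \<alpha> * real k)) \<ge>
       real M * real Q / \<epsilon> * (ln (\<epsilon> / (2 * (real Q * \<bar>\<eta>\<bar>))) - 1)"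
    "(\<Sum>k<M * Q. 1 / dist_int (y - of_int a / of_int b + \<alpha> * real k)) \<le>
       real M * (2 * real Q * (2 * of_int b + 1 + ln (real Q)))"
proof -
  define d where "d = real Q * \<bar>\<eta>\<bar>"
  define s :: int where "s = (if \<eta> > 0 then 1 else - 1)"
  have s: "sgn \<eta> = of_int s" "s * s = 1" "\<eta> = of_int s * \<bar>\<eta>\<bar>" "\<bar>of_int s\<bar> = (1::real)"
    using \<eta> by (auto simp: s_def sgn_if)
  have d: "d > 0" "d \<le> \<epsilon> / 8" using Q \<eta> small by (auto simp: d_def)
  define w0 where "w0 = frac (- sgn \<eta> * (real Q * y))"
  define n0 where "n0 = - s * \<lfloor>- sgn \<eta> * (real Q * y)\<rfloor>"
  have w0: "\<epsilon> / 2 < w0" "w0 < \<epsilon>" using hit by (auto simp: w0_def)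
  have Qy: "real Q * y = of_int n0 - of_int s * w0"
  proof -
    have "of_int s * w0 = - (of_int (s * s) * (real Q * y)) + of_int n0"
      unfolding w0_def n0_def frac_def s(1) by (simp add: algebra_simps)
    then show ?thesis unfolding s(2) by simp
  qed
  \<comment> \<open>The number of whole blocks during which the point has not yet reached the
    integers. Taking the ceiling minus 1 gives M d < w0 strictly, so \<open>w\<close> stays
    positive; w0 > \<epsilon>/2 and d \<le> \<epsilon>/8 give w0/d > 4.\<close>
  define M where "M = nat (\<lceil>w0 / d\<rceil> - 1)"
  have "w0 / d > 4" using w0 d by (simp add: field_simps)
  then have M: "M \<ge> 2" "real M < w0 / d" "w0 / d \<le> real M + 1"
    unfolding M_def by linarith+
  then have M': "real M * d < w0" "w0 \<le> (real M + 1) * d" using d by (auto simp: field_simps)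
  define w where "w k = w0 - real k * \<bar>\<eta>\<bar>" for k
  have rot: "real Q * (y + \<alpha> * real k) = of_int (n0 + int k * P) - of_int s * w k" for k
  proof -
    have "real Q * (y + \<alpha> * real k) = real Q * y + real k * of_int P + real k * \<eta>"
      unfolding \<eta>_def by (simp add: algebra_simps)
    also have "\<dots> = real Q * y + real k * of_int P + real k * (of_int s * \<bar>\<eta>\<bar>)"
      using s(3) by simp
    finally show ?thesis unfolding Qy w_def by (simp add: algebra_simps)
  qed
  have wpos: "w k > 0" "w k < \<epsilon>" if "k < M * Q" for k
  proof -
    have "real k * \<bar>\<eta>\<bar> \<le> real (M * Q) * \<bar>\<eta>\<bar>" using that by (intro mult_right_mono) linarith+
    also have "\<dots> = real M * d" by (simp add: d_def)
    finally show "w k > 0" using M' by (simp add: w_def)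
    have "0 \<le> real k * \<bar>\<eta>\<bar>" by simp
    then show "w k < \<epsilon>" using w0 unfolding w_def by linarith
  qed
  have lower: "(\<Sum>j<Q. 1 / dist_int (y + \<alpha> * real (m * Q + j))) \<ge> real Q / ((real (M + 1) - real m) * d)"
    if m: "m < M" for m
  proof -
    \<comment> \<open>Only one term of each block is kept: that of the index with residue 0, whose
      distance to the integers is at most w k / Q.\<close>
    have "0 \<in> (\<lambda>j. nat ((n0 + int m * int Q * P + int j * P) mod int Q)) ` {..<Q}"
      using bij_betw_residues[OF PQ, of "n0 + int m * int Q * P"] Q by (simp add: bij_betw_def)
    then obtain j where j: "j < Q" "nat ((n0 + int m * int Q * P + int j * P) mod int Q) = 0"
      by auto
    define k where "k = m * Q + j"
    have "(n0 + int k * P) mod int Q = 0"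
      using j Q by (simp add: k_def algebra_simps order_antisym)
    then obtain t where t: "n0 + int k * P = int Q * t" by (metis mod_0_imp_dvd dvdE)
    have kM: "k < M * Q"
    proof -
      have "k < (m + 1) * Q" using j by (simp add: k_def)
      also have "\<dots> \<le> M * Q" using m by (intro mult_right_mono) auto
      finally show ?thesis .
    qed
    have "real Q * (y + \<alpha> * real k - of_int t) = - (of_int s * w k)"
      using rot[of k] unfolding t by (simp add: algebra_simps)
    then have "\<bar>real Q * (y + \<alpha> * real k - of_int t)\<bar> = w k"
      using s(4) wpos(1)[OF kM] by (simp add: abs_mult)
    then have "real Q * \<bar>y + \<alpha> * real k - of_int t\<bar> = w k" by (simp only: abs_mult abs_of_nat)
    then have "\<bar>y + \<alpha> * real k - of_int t\<bar> = w k / real Q"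
      using Q by (simp add: eq_divide_eq mult.commute)
    then have "dist_int (y + \<alpha> * real k) \<le> w k / real Q" using dist_int_le[of "y + \<alpha> * real k" t] by simp
    also have "w k \<le> w0 - real m * d"
    proof -
      have "real (m * Q) * \<bar>\<eta>\<bar> \<le> real k * \<bar>\<eta>\<bar>" unfolding k_def by (intro mult_right_mono) auto
      then show ?thesis by (simp add: w_def d_def)
    qed
    also have "\<dots> \<le> (real (M + 1) - real m) * d" using M' by (simp add: algebra_simps)
    finally have le: "dist_int (y + \<alpha> * real k) \<le> (real (M + 1) - real m) * d / real Q"
      by (simp add: divide_right_mono)
    have "real Q / ((real (M + 1) - real m) * d) = 1 / ((real (M + 1) - real m) * d / real Q)" by simp
    also have "\<dots> \<le> 1 / dist_int (y + \<alpha> * real k)"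
      using le pos[of k] by (intro divide_left_mono mult_pos_pos) (auto intro: order_less_le_trans[OF _ le])
    also have "\<dots> \<le> (\<Sum>j<Q. 1 / dist_int (y + \<alpha> * real (m * Q + j)))"
      unfolding k_def using j by (intro member_le_sum[of j "{..<Q}" "\<lambda>j. 1 / dist_int (y + \<alpha> * real (m * Q + j))"]) auto
    finally show ?thesis .
  qed
  \<comment> \<open>The block m = 0 is left out because the window around an abscissa below Q may
    begin before the starting point of the orbit.\<close>
  have "(\<Sum>k\<in>{Q..<M * Q}. 1 / dist_int (y + \<alpha> * real k)) =
      (\<Sum>m\<in>{1..<M}. \<Sum>j<Q. 1 / dist_int (y + \<alpha> * real (m * Q + j)))"
    using M(1) by (intro sum_atLeastLessThan_blocks) simp
  also have "\<dots> \<ge> (\<Sum>m\<in>{1..<M}. real Q / ((real (M + 1) - real m) * d))"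
    using lower by (intro sum_mono) auto
  also have "(\<Sum>m\<in>{1..<M}. real Q / ((real (M + 1) - real m) * d)) =
      real Q / d * (\<Sum>m\<in>{1..<M}. 1 / (real (M + 1) - real m))"
    by (simp add: sum_distrib_left mult.commute)
  also have "(\<Sum>m\<in>{1..<M}. 1 / (real (M + 1) - real m)) = (\<Sum>l\<in>{1..<M}. 1 / real (Suc l))"
    by (rule sum.reindex_bij_witness[of _ "\<lambda>l. M - l" "\<lambda>m. M - m"]) (auto simp: of_nat_diff)
  finally have ge: "(\<Sum>k\<in>{Q..<M * Q}. 1 / dist_int (y + \<alpha> * real k)) \<ge>
      real Q / d * (\<Sum>l\<in>{1..<M}. 1 / real (Suc l))" (is "_ \<ge> _ * ?S") .
  have S: "?S \<ge> 0" "?S \<ge> ln (\<epsilon> / (2 * d)) - 1"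
  proof -
    show "?S \<ge> 0" by (intro sum_nonneg) auto
    have "\<epsilon> / (2 * d) \<le> w0 / d" using w0 d by (simp add: field_simps)
    then have "ln (\<epsilon> / (2 * d)) \<le> ln (real (Suc M))"
      using d \<epsilon> M by (intro ln_mono) auto
    also have "\<dots> \<le> (\<Sum>j<M. 1 / real (Suc j))" by (rule sum_inverse_ge_ln)
    also have "\<dots> = 1 + ?S" using M(1) by (simp add: lessThan_atLeast0 sum.atLeast_Suc_lessThan)
    finally show "?S \<ge> ln (\<epsilon> / (2 * d)) - 1" by simp
  qed
  \<comment> \<open>Trades 1/d for M/\<epsilon>, so that both final bounds are proportional to the
    number M of blocks; this is where the gain 1/\<epsilon> appears.\<close>
  have "real M / \<epsilon> \<le> 1 / d"
  proof -
    have "real M * d \<le> \<epsilon>" using M' w0 by linarith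
    then show ?thesis using d \<epsilon> by (simp add: field_simps)
  qed
  then have "real Q * (real M / \<epsilon>) * (ln (\<epsilon> / (2 * d)) - 1) \<le> real Q * (1 / d) * ?S"
    using S \<epsilon> by (intro order_trans[OF mult_left_mono[OF S(2)] mult_right_mono] mult_left_mono) auto
  then have 1: "(\<Sum>k\<in>{Q..<M * Q}. 1 / dist_int (y + \<alpha> * real k)) \<ge>
       real M * real Q / \<epsilon> * (ln (\<epsilon> / (2 * d)) - 1)"
    using ge by (simp add: mult_ac)

  \<comment> \<open>Half of 1/b: Q a / b is at least 2 \<beta> away from the integers and the
    displacement \<open>w k\<close> stays below \<epsilon> \<le> \<beta>, so the points of the
    shifted orbit keep a margin \<beta>/Q.\<close>
  define \<beta> where "\<beta> = 1 / (2 * of_int b :: real)"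
  define v where "v = - (real Q * of_int a / of_int b)"
  define c where "c = \<lfloor>v\<rfloor>"
  have \<beta>: "\<beta> > 0" using b by (simp add: \<beta>_def)
  have fv: "2 * \<beta> \<le> frac v" "frac v \<le> 1 - 2 * \<beta>"
  proof -
    have nd: "\<not> b dvd - (int Q * a)"
    proof
      assume "b dvd - (int Q * a)"
      then have "b dvd int Q * a" by simp
      then have "b dvd a" using Qb by (simp add: coprime_commute coprime_dvd_mult_right_iff)
      then have "is_unit b" using ab by (meson coprime_common_divisor dvd_refl)
      then show False using b by simp
    qed
    have "dist_int v \<ge> 2 * \<beta>"
      using dist_int_ge_fraction[OF _ nd] b by (simp add: v_def \<beta>_def)
    then show "2 * \<beta> \<le> frac v" "frac v \<le> 1 - 2 * \<beta>"
      using dist_int_le[of v c] dist_int_le[of v "c + 1"] frac_ge_0[of v] frac_lt_1[of v]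
      unfolding c_def frac_def by auto
  qed
  have upper: "(\<Sum>j<Q. 1 / dist_int (y - of_int a / of_int b + \<alpha> * real (m * Q + j))) \<le>
      2 * real Q * (2 * of_int b + 1 + ln (real Q))" if m: "m < M" for m
  proof -
    define f where "f j = nat ((c + n0 + int m * int Q * P + int j * P) mod int Q)" for j
    have bij: "bij_betw f {..<Q} {..<Q}"
      unfolding f_def using Q by (intro bij_betw_residues[OF PQ]) auto
    have "1 / dist_int (y - of_int a / of_int b + \<alpha> * real (m * Q + j)) \<le>
        real Q / (real (f j) + \<beta>) + real Q / (real (Q - Suc (f j)) + \<beta>)" if j: "j < Q" for j
    proof -
      define k where "k = m * Q + j"
      have kM: "k < M * Q"
      proof -
        have "k < (m + 1) * Q" using j by (simp add: k_def)
        also have "\<dots> \<le> M * Q" using m by (intro mult_right_mono) auto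
        finally show ?thesis .
      qed
      define t where "t = (c + n0 + int k * P) div int Q"
      have fj: "of_int (c + n0 + int k * P) = real (f j) + real Q * of_int t"
      proof -
        have "int (f j) = (c + n0 + int k * P) mod int Q"
          using Q by (simp add: f_def k_def algebra_simps)
        then have "c + n0 + int k * P = int (f j) + int Q * t"
          unfolding t_def by (simp add: mult_div_mod_eq add.commute)
        then show ?thesis by (metis of_int_add of_int_mult of_int_of_nat_eq)
      qed
      have fQ: "f j < Q" using bij j by (auto simp: bij_betw_def)
      define \<omega> where "\<omega> = frac v - of_int s * w k"
      have "\<bar>of_int s * w k\<bar> \<le> \<beta>"
        using s(4) wpos[OF kM] \<epsilon>(2) by (simp add: abs_mult \<beta>_def)
      then have \<omega>: "\<beta> \<le> \<omega>" "\<omega> \<le> 1 - \<beta>" using fv by (auto simp: \<omega>_def abs_le_iff)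
      define x where "x = (real (f j) + \<omega>) / real Q"
      have "real Q * (y - of_int a / of_int b + \<alpha> * real k) = of_int (n0 + int k * P) - of_int s * w k + v"
        using rot[of k] by (simp add: v_def algebra_simps)
      also have "\<dots> = of_int (c + n0 + int k * P) + \<omega>" by (simp add: \<omega>_def frac_def c_def)
      also have "\<dots> = real Q * (x + of_int t)" unfolding fj x_def using Q by (simp add: field_simps)
      finally have eq: "y - of_int a / of_int b + \<alpha> * real k = x + of_int t" using Q by simp
      have fQ': "real (f j) + 1 \<le> real Q" using fQ by linarith
      have x: "0 < x" "x < 1" using \<omega> \<beta> fQ' Q by (auto simp: x_def field_simps)
      have "1 / dist_int (x + of_int t) \<le> 1 / x + 1 / (1 - x)" using inverse_dist_int_le[OF x] by simp
      also have "1 / x \<le> real Q / (real (f j) + \<beta>)"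
      proof -
        have "1 / x = real Q / (real (f j) + \<omega>)" by (simp add: x_def)
        also have "\<dots> \<le> real Q / (real (f j) + \<beta>)" using \<omega> \<beta> by (intro divide_left_mono) auto
        finally show ?thesis .
      qed
      also have "1 / (1 - x) \<le> real Q / (real (Q - Suc (f j)) + \<beta>)"
      proof -
        have "1 - x = (real Q - real (f j) - \<omega>) / real Q" using Q by (simp add: x_def field_simps)
        then have "1 / (1 - x) = real Q / (real Q - real (f j) - \<omega>)" by simp
        also have "\<dots> \<le> real Q / (real (Q - Suc (f j)) + \<beta>)"
          using \<omega> \<beta> fQ fQ' by (intro divide_left_mono) (auto simp: of_nat_diff add_nonneg_pos)
        finally show ?thesis .
      qed
      finally show ?thesis unfolding k_def[symmetric] eq by simp
    qed
    then have "(\<Sum>j<Q. 1 / dist_int (y - of_int a / of_int b + \<alpha> * real (m * Q + j))) \<le>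
        (\<Sum>j<Q. real Q / (real (f j) + \<beta>) + real Q / (real (Q - Suc (f j)) + \<beta>))"
      by (intro sum_mono) auto
    also have "\<dots> = (\<Sum>i<Q. real Q / (real i + \<beta>) + real Q / (real (Q - Suc i) + \<beta>))"
      by (rule sum.reindex_bij_betw[OF bij])
    \<comment> \<open>Reflecting the residues, i to Q - 1 - i, identifies the contribution of the
      right-hand integer with that of the left-hand one.\<close>
    also have "\<dots> = 2 * real Q * (\<Sum>i<Q. 1 / (real i + \<beta>))"
      using sum.nat_diff_reindex[of "\<lambda>i. real Q / (real i + \<beta>)" Q]
      by (simp add: sum.distrib sum_distrib_left)
    also have "(\<Sum>i<Q. 1 / (real i + \<beta>)) \<le> 2 * of_int b + 1 + ln (real Q)"
    proof -
      obtain n where n: "Q = Suc n" "n > 0" using Q by (cases Q) auto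
      have "(\<Sum>i<Q. 1 / (real i + \<beta>)) = 1 / \<beta> + (\<Sum>i<n. 1 / (real (Suc i) + \<beta>))"
        unfolding n sum.lessThan_Suc_shift by simp
      also have "\<dots> \<le> 1 / \<beta> + (\<Sum>i<n. 1 / real (Suc i))"
        using \<beta> by (intro add_left_mono sum_mono divide_left_mono) auto
      also have "\<dots> \<le> 1 / \<beta> + (1 + ln (real n))" using sum_inverse_le_ln[OF n(2)] by simp
      also have "ln (real n) \<le> ln (real Q)" using n by simp
      finally show ?thesis by (simp add: \<beta>_def)
    qed
    finally show ?thesis by (simp add: mult_left_mono)
  qed
  have "(\<Sum>k<M * Q. 1 / dist_int (y - of_int a / of_int b + \<alpha> * real k)) =
      (\<Sum>m<M. \<Sum>j<Q. 1 / dist_int (y - of_int a / of_int b + \<alpha> * real (m * Q + j)))"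
    by (rule sum_lessThan_blocks)
  also have "\<dots> \<le> (\<Sum>m<M. 2 * real Q * (2 * of_int b + 1 + ln (real Q)))"
    using upper by (intro sum_mono) auto
  finally have 2: "(\<Sum>k<M * Q. 1 / dist_int (y - of_int a / of_int b + \<alpha> * real k)) \<le>
       real M * (2 * real Q * (2 * of_int b + 1 + ln (real Q)))" by simp
  show thesis by (rule that[OF M(1) 1[unfolded d_def] 2])
qed

section \<open>Almost every rotation orbit is well placed infinitely often\<close>

text \<open>A weak form of the Lebesgue density theorem. Cover a bounded part S by nonoverlapping
  intervals of total length at most |S| + e and keep finitely many, losing at most e. Thinness on
  each gives |S| \<le> \<kappa> (|S| + e) + e for every e > 0, hence |S| = 0.\<close>

lemma negligible_locally_thin:
  fixes A :: "real set"
  assumes A: "A \<in> sets lebesgue" and \<kappa>: "0 \<le> \<kappa>" "\<kappa> < 1"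
    and thin: "\<And>c d. c \<le> d \<Longrightarrow> measure lebesgue (A \<inter> {c..d}) \<le> \<kappa> * (d - c)"
  shows "negligible A"
proof -
  have bounded_part: "negligible (A \<inter> cbox (- r) r)" if r: "r > 0" for r
  proof -
    define S where "S = A \<inter> cbox (- r) r"
    have S: "S \<in> lmeasurable" "S \<subseteq> cbox (- r) r"
      using A by (auto simp: S_def intro!: bounded_set_imp_lmeasurable sets.Int bounded_Int)
    have bound: "(1 - \<kappa>) * measure lebesgue S \<le> (1 + \<kappa>) * e" if e: "e > 0" for e
    proof -
      obtain D where D: "countable D" "\<And>K. K \<in> D \<Longrightarrow> K \<subseteq> cbox (- r) r \<and> K \<noteq> {} \<and> (\<exists>c d. K = cbox c d)"
        "pairwise (\<lambda>A B. interior A \<inter> interior B = {}) D"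
        "S \<subseteq> \<Union>D" "\<Union>D \<in> lmeasurable" "measure lebesgue (\<Union>D) \<le> measure lebesgue S + e"
        using measurable_outer_intervals_bounded[OF S e] by metis
      have Dm: "K \<in> lmeasurable" if "K \<in> D" for K using D(2)[OF that] by auto
      have fin_m: "\<Union>D' \<in> lmeasurable" if "D' \<subseteq> D" "finite D'" for D'
        using that Dm by (intro fmeasurable.finite_Union) auto
      have "measure lebesgue (\<Union>D') \<le> measure lebesgue (\<Union>D)" if "D' \<subseteq> D" "finite D'" for D'
        using that D(5) fin_m[OF that] by (intro measure_mono_fmeasurable) auto
      then obtain D' where D': "D' \<subseteq> D" "finite D'"
        "measure lebesgue (\<Union>D) - e < measure lebesgue (\<Union>D')"
        using measure_countable_Union_approachable[OF D(1) e Dm] by metis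
      have m': "\<Union>D' \<in> lmeasurable" by (rule fin_m[OF D'(1,2)])
      have "measure lebesgue S \<le> measure lebesgue ((S \<inter> \<Union>D') \<union> (\<Union>D - \<Union>D'))"
        using D(4) S(1) m' D(5)
        by (intro measure_mono_fmeasurable fmeasurable.Un fmeasurable.Int fmeasurable.Diff) auto
      also have "\<dots> \<le> measure lebesgue (S \<inter> \<Union>D') + measure lebesgue (\<Union>D - \<Union>D')"
        using S(1) m' D(5) by (intro measure_Un_le fmeasurableD fmeasurable.Int fmeasurable.Diff)
      also have "measure lebesgue (\<Union>D - \<Union>D') = measure lebesgue (\<Union>D) - measure lebesgue (\<Union>D')"
        using D'(1) m' D(5) by (intro measurable_measure_Diff) (auto simp: fmeasurableD)
      also have "\<dots> \<le> e" using D'(3) by simp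
      also have "S \<inter> \<Union>D' = (\<Union>K\<in>D'. S \<inter> K)" by auto
      also have "measure lebesgue (\<Union>K\<in>D'. S \<inter> K) \<le> (\<Sum>K\<in>D'. measure lebesgue (S \<inter> K))"
        using D'(1,2) S(1) Dm by (intro measure_UNION_le fmeasurableD fmeasurable.Int) auto
      also have "\<dots> \<le> (\<Sum>K\<in>D'. \<kappa> * measure lebesgue K)"
      proof (rule sum_mono)
        fix K assume "K \<in> D'"
        then obtain c d where K: "K = {c..d}" "c \<le> d" "K \<subseteq> cbox (- r) r"
          using D(2) D'(1) by (metis atLeastatMost_empty_iff cbox_interval in_mono)
        then have "S \<inter> K = A \<inter> {c..d}" unfolding S_def by auto
        then show "measure lebesgue (S \<inter> K) \<le> \<kappa> * measure lebesgue K"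
          using thin[OF K(2)] K by simp
      qed
      also have "\<dots> = \<kappa> * measure lebesgue (\<Union>D')"
      proof -
        have "negligible (K \<inter> L)" if kl: "K \<in> D'" "L \<in> D'" "K \<noteq> L" for K L
        proof -
          obtain c d where K: "K = cbox c d" using D(2)[of K] D'(1) kl(1) by auto
          obtain c' d' where L: "L = cbox c' d'" using D(2)[of L] D'(1) kl(2) by auto
          have "interior (K \<inter> L) = {}" using D(3) D'(1) kl unfolding pairwise_def by auto
          then show ?thesis unfolding K L by (metis convex_Int convex_box(1) negligible_convex_interior)
        qed
        then have "measure lebesgue (\<Union>D') = (\<Sum>K\<in>D'. measure lebesgue K)"
          using D'(1,2) Dm by (intro measure_negligible_finite_Union) (auto simp: pairwise_def)
        then show ?thesis by (simp add: sum_distrib_left)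
      qed
      also have "\<dots> \<le> \<kappa> * (measure lebesgue S + e)"
      proof -
        have "measure lebesgue (\<Union>D') \<le> measure lebesgue (\<Union>D)"
          using D'(1) m' D(5) by (intro measure_mono_fmeasurable) auto
        then show ?thesis using D(6) \<kappa> by (intro mult_left_mono) auto
      qed
      finally show ?thesis by (simp add: algebra_simps)
    qed
    have "(1 - \<kappa>) * measure lebesgue S \<le> 0"
    proof (rule field_le_epsilon)
      fix e :: real assume "e > 0"
      then have "(1 - \<kappa>) * measure lebesgue S \<le> (1 + \<kappa>) * (e / (1 + \<kappa>))"
        using \<kappa> by (intro bound) auto
      then show "(1 - \<kappa>) * measure lebesgue S \<le> 0 + e" using \<kappa> by simp
    qed
    then have "measure lebesgue S = 0"
      using \<kappa> by (smt (verit) measure_nonneg mult_pos_pos)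
    then show ?thesis using S(1) by (simp add: S_def negligible_iff_measure)
  qed
  then have "negligible (\<Union>n. A \<inter> cbox (- real (Suc n)) (real (Suc n)))"
    by (intro negligible_Union_nat bounded_part) linarith
  moreover have "A \<subseteq> (\<Union>n. A \<inter> cbox (- real (Suc n)) (real (Suc n)))"
  proof
    fix x assume "x \<in> A"
    obtain n where "\<bar>x\<bar> \<le> real n" using real_arch_simple by blast
    then have "x \<in> cbox (- real (Suc n)) (real (Suc n))" by (auto simp: abs_le_iff)
    then show "x \<in> (\<Union>n. A \<inter> cbox (- real (Suc n)) (real (Suc n)))" using \<open>x \<in> A\<close> by blast
  qed
  ultimately show ?thesis by (rule negligible_subset)
qed

text \<open>The set has period 1/Q and proportion \<kappa>. At least Q (d - c) - 2 whole periods lie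
  in the interval, which is at least half of Q (d - c) because this is at least 4.\<close>

lemma measure_frac_mult_in_interval_ge:
  fixes c d l \<kappa> :: real and Q :: nat
  assumes cd: "c \<le> d" and Q: "real Q * (d - c) \<ge> 4" and l: "0 \<le> l" "0 \<le> \<kappa>" "l + \<kappa> \<le> 1"
  shows "measure lebesgue ({c..d} \<inter> {y. frac (real Q * y) \<in> {l<..<l + \<kappa>}}) \<ge> \<kappa> / 2 * (d - c)"
proof -
  let ?E = "{y. frac (real Q * y) \<in> {l<..<l + \<kappa>}}"
  have Q0: "Q > 0" using Q by (cases "Q = 0") auto
  define m n where "m = \<lceil>real Q * c\<rceil>" and "n = \<lfloor>real Q * d\<rfloor>"
  define J where "J j = {(of_int j + l) / real Q<..<(of_int j + l + \<kappa>) / real Q}" for j :: int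
  have mn: "real_of_int m < real Q * c + 1" "real_of_int n > real Q * d - 1"
    unfolding m_def n_def by linarith+
  have cnt: "real_of_int (n - m) \<ge> real Q * (d - c) / 2"
    using mn Q by (simp add: right_diff_distrib)
  have Jm: "J j \<in> lmeasurable" "measure lebesgue (J j) = \<kappa> / real Q" for j
    using l Q0 by (auto simp: J_def measure_lborel_Ioo divide_right_mono diff_divide_distrib[symmetric])
  have J_frac: "\<lfloor>real Q * y\<rfloor> = j \<and> frac (real Q * y) \<in> {l<..<l + \<kappa>}" if "y \<in> J j" for y j
  proof -
    have "of_int j + l < real Q * y" "real Q * y < of_int j + l + \<kappa>"
      using that Q0 by (auto simp: J_def field_simps)
    moreover from this have "\<lfloor>real Q * y\<rfloor> = j" using l by linarith
    ultimately show ?thesis by (auto simp: frac_def)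
  qed
  have sub: "(\<Union>j\<in>{m..<n}. J j) \<subseteq> {c..d} \<inter> ?E"
  proof
    fix y assume "y \<in> (\<Union>j\<in>{m..<n}. J j)"
    then obtain j where j: "m \<le> j" "j < n" "y \<in> J j" by auto
    have fl: "\<lfloor>real Q * y\<rfloor> = j" using J_frac[OF j(3)] by simp
    have "real Q * c \<le> of_int m" "of_int n \<le> real Q * d" by (auto simp: m_def n_def)
    moreover have "of_int m \<le> real Q * y" "real Q * y \<le> of_int n"
      using fl j by linarith+
    ultimately have "real Q * c \<le> real Q * y" "real Q * y \<le> real Q * d" by linarith+
    then show "y \<in> {c..d} \<inter> ?E" using J_frac[OF j(3)] Q0 by auto
  qed
  have disj: "disjoint_family_on J {m..<n}"
    unfolding disjoint_family_on_def using J_frac by blast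
  have meas: "?E \<in> sets lebesgue"
  proof -
    have "?E \<in> sets borel" unfolding frac_def by measurable
    then show ?thesis by auto
  qed
  have "\<kappa> / 2 * (d - c) = real Q * (d - c) / 2 * (\<kappa> / real Q)" using Q0 by simp
  also have "\<dots> \<le> real_of_int (n - m) * (\<kappa> / real Q)"
    using cnt l by (intro mult_right_mono) auto
  also have "\<dots> = (\<Sum>j\<in>{m..<n}. measure lebesgue (J j))"
  proof -
    have "0 \<le> real Q * (d - c) / 2" using cd by simp
    then have "n - m \<ge> 0" using cnt by linarith
    then show ?thesis unfolding Jm by simp
  qed
  also have "\<dots> = measure lebesgue (\<Union>j\<in>{m..<n}. J j)"
    using fmeasurableD2[OF Jm(1)] fmeasurableD[OF Jm(1)]
    by (intro measure_finite_Union[symmetric] disj) (simp_all add: image_subset_iff)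
  also have "\<dots> \<le> measure lebesgue ({c..d} \<inter> ?E)"
  proof (rule measure_mono_fmeasurable[OF sub])
    show "(\<Union>j\<in>{m..<n}. J j) \<in> sets lebesgue" using Jm(1) by (intro sets.finite_UN) auto
    show "{c..d} \<inter> ?E \<in> lmeasurable"
      by (rule fmeasurableI2[of "{c..d}"]) (use meas in auto)
  qed
  finally show ?thesis .
qed

text \<open>Points that miss all targets from index N on have proportion at most 1 - \<kappa>/2 in
  every interval, since an index i \<ge> N with \<open>Q i\<close> large relative to that interval
  is always available. So they form a null set.\<close>

lemma AE_frac_mult_hits_infinitely_often:
  fixes Q :: "nat \<Rightarrow> nat" and l :: "nat \<Rightarrow> real"
  assumes Q: "\<And>i. Q i \<ge> i" and l: "\<And>i. 0 \<le> l i" "\<And>i. l i + \<kappa> \<le> 1" and \<kappa>: "\<kappa> > 0"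
  shows "AE y in lborel. \<exists>\<^sub>\<infinity>i. frac (real (Q i) * y) \<in> {l i<..<l i + \<kappa>}"
proof -
  define E where "E i = {y. frac (real (Q i) * y) \<in> {l i<..<l i + \<kappa>}}" for i
  define A where "A N = (\<Inter>i\<in>{N..}. - E i)" for N
  have E: "E i \<in> sets borel" for i unfolding E_def frac_def by measurable
  have Ab: "A N \<in> sets borel" for N unfolding A_def using E by (intro sets.countable_INT) auto
  have "A N \<in> null_sets lborel" for N
  proof -
    have "negligible (A N)"
    proof (rule negligible_locally_thin)
      show "A N \<in> sets lebesgue" using Ab by auto
      show "0 \<le> 1 - \<kappa> / 2" "1 - \<kappa> / 2 < 1" using l[of 0] \<kappa> by auto
      fix c d :: real assume cd: "c \<le> d"
      show "measure lebesgue (A N \<inter> {c..d}) \<le> (1 - \<kappa> / 2) * (d - c)"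
      proof (cases "c = d")
        case False
        then have cd': "c < d" using cd by simp
        obtain i0 :: nat where i0: "4 / (d - c) \<le> real i0" using real_arch_simple by blast
        define i where "i = max N i0"
        have "4 / (d - c) \<le> real (Q i)" using i0 Q[of i] unfolding i_def by linarith
        then have "real (Q i) * (d - c) \<ge> 4" using cd' by (simp add: field_simps)
        then have *: "measure lebesgue ({c..d} \<inter> E i) \<ge> \<kappa> / 2 * (d - c)"
          unfolding E_def using l[of i] \<kappa> by (intro measure_frac_mult_in_interval_ge cd) simp_all
        have m: "{c..d} \<inter> E i \<in> lmeasurable"
          by (rule fmeasurableI2[of "{c..d}"]) (use E[of i] in auto)
        have "A N \<inter> {c..d} \<subseteq> {c..d} - ({c..d} \<inter> E i)" by (auto simp: A_def i_def)
        then have "measure lebesgue (A N \<inter> {c..d}) \<le> measure lebesgue ({c..d} - ({c..d} \<inter> E i))"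
          using Ab[of N] m by (intro measure_mono_fmeasurable fmeasurable.Diff sets.Int) auto
        also have "\<dots> = (d - c) - measure lebesgue ({c..d} \<inter> E i)"
          using m cd by (subst measurable_measure_Diff) (auto simp: fmeasurableD)
        finally have "measure lebesgue (A N \<inter> {c..d}) \<le> (d - c) - \<kappa> / 2 * (d - c)"
          using * by linarith
        then show ?thesis by (simp only: left_diff_distrib mult_1)
      next
        case True
        have "measure lebesgue (A N \<inter> {c..d}) \<le> measure lebesgue {c}"
          using True Ab[of N] by (intro measure_mono_fmeasurable lmeasurable_compact) auto
        then show ?thesis using True by simp
      qed
    qed
    then show ?thesis using Ab[of N] by (simp add: negligible_iff_null_sets null_sets_completion_iff)
  qed
  then have "(\<Union>N. A N) \<in> null_sets lborel" by (intro null_sets_UN)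
  moreover have "{y \<in> space lborel. \<not> (\<exists>\<^sub>\<infinity>i. frac (real (Q i) * y) \<in> {l i<..<l i + \<kappa>})} \<subseteq> (\<Union>N. A N)"
    unfolding A_def E_def INFM_nat_le by auto
  ultimately show ?thesis by (rule AE_I')
qed

section \<open>Intercepts that are well placed for good approximations\<close>

lemma good_approx_error:
  assumes "good_approx \<alpha> \<nu> b P Q" "\<nu> > 0" "Q > 0"
  shows "\<bar>real Q * \<alpha> - P\<bar> \<le> 1 / real Q"
proof -
  have "real Q powr (- \<nu>) \<le> 1 powr (- \<nu>)"
    using assms by (intro powr_mono2') auto
  then show ?thesis using assms by (simp add: good_approx_def field_simps)
qed

text \<open>The sign selects the side from which the drift moves Q y towards the integers.
  Restricting \<epsilon> to the values 1/j leaves countably many conditions, as needed for an almost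
  everywhere statement.\<close>

definition near_hits :: "real \<Rightarrow> real \<Rightarrow> int \<Rightarrow> real \<Rightarrow> bool" where
  "near_hits \<alpha> \<nu> b y \<longleftrightarrow> (\<forall>j>0. \<forall>N. \<exists>P Q. Q \<ge> N \<and> good_approx \<alpha> \<nu> b P Q \<and>
     frac (- sgn (real Q * \<alpha> - P) * (real Q * y)) \<in> {1 / (2 * real j)<..<1 / real j})"

lemma AE_near_hits:
  assumes W: "\<alpha> \<in> W_set \<nu> b"
  shows "AE y in lborel. near_hits \<alpha> \<nu> b y"
proof -
  have irr: "\<alpha> \<notin> \<rat>" using W by (simp add: W_set_def)
  have "\<forall>i. \<exists>P Q. Q \<ge> Suc i \<and> good_approx \<alpha> \<nu> b P Q" using W_set_good_approx[OF W] by blast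
  then obtain P Q where PQ: "\<And>i. Q i \<ge> Suc i \<and> good_approx \<alpha> \<nu> b (P i) (Q i)" by metis
  define \<eta> where "\<eta> i = real (Q i) * \<alpha> - of_int (P i)" for i
  have \<eta>: "\<eta> i \<noteq> 0" for i
  proof
    assume "\<eta> i = 0"
    moreover have "Q i > 0" using PQ[of i] by linarith
    ultimately have "\<alpha> = of_int (P i) / of_nat (Q i)" by (simp add: \<eta>_def field_simps)
    moreover have "of_int (P i) / of_nat (Q i) \<in> (\<rat> :: real set)" by (intro Rats_divide) auto
    ultimately show False using irr by simp
  qed
  have "AE y in lborel. \<exists>\<^sub>\<infinity>i. frac (- sgn (\<eta> i) * (real (Q i) * y)) \<in> {1 / (2 * real j)<..<1 / real j}"
    if j: "j > 0" for j :: nat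
  proof -
    \<comment> \<open>Negation reflects the target: -Q y has fractional part in (1/(2j), 1/j) when Q
      y has it in (1 - 1/j, 1 - 1/(2j)). Either way the target has length 1/(2j).\<close>
    define l where "l i = (if \<eta> i < 0 then 1 / (2 * real j) else 1 - 1 / real j)" for i
    have "AE y in lborel. \<exists>\<^sub>\<infinity>i. frac (real (Q i) * y) \<in> {l i<..<l i + 1 / (2 * real j)}"
    proof (rule AE_frac_mult_hits_infinitely_often)
      show "Q i \<ge> i" for i using PQ[of i] by linarith
      show "0 \<le> l i" "l i + 1 / (2 * real j) \<le> 1" for i using j by (auto simp: l_def field_simps)
    qed (use j in auto)
    moreover have "frac (- sgn (\<eta> i) * (real (Q i) * y)) \<in> {1 / (2 * real j)<..<1 / real j}"
      if *: "frac (real (Q i) * y) \<in> {l i<..<l i + 1 / (2 * real j)}" for i y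
    proof (cases "\<eta> i < 0")
      case True
      then show ?thesis using * by (auto simp: l_def)
    next
      case False
      then have "\<eta> i > 0" using \<eta>[of i] by simp
      moreover have "real (Q i) * y \<notin> \<int>"
        using * False j by (auto simp: l_def frac_eq_0_iff[symmetric] simp del: frac_eq_0_iff)
      ultimately show ?thesis using * by (auto simp: l_def frac_neg field_simps)
    qed
    ultimately show ?thesis by (auto elim!: eventually_mono frequently_elim1)
  qed
  then have "AE y in lborel. \<forall>j>0. \<exists>\<^sub>\<infinity>i. frac (- sgn (\<eta> i) * (real (Q i) * y)) \<in> {1 / (2 * real j)<..<1 / real j}"
    by (simp add: AE_all_countable)
  then show ?thesis
  proof (rule eventually_mono)
    fix y assume *: "\<forall>j>0. \<exists>\<^sub>\<infinity>i. frac (- sgn (\<eta> i) * (real (Q i) * y)) \<in> {1 / (2 * real j)<..<1 / real j}"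
    show "near_hits \<alpha> \<nu> b y"
      unfolding near_hits_def
    proof (intro allI impI)
      fix j N :: nat assume "j > 0"
      then obtain i where "i \<ge> N" "frac (- sgn (\<eta> i) * (real (Q i) * y)) \<in> {1 / (2 * real j)<..<1 / real j}"
        using * unfolding INFM_nat_le by blast
      then show "\<exists>P Q. Q \<ge> N \<and> good_approx \<alpha> \<nu> b P Q \<and>
          frac (- sgn (real Q * \<alpha> - P) * (real Q * y)) \<in> {1 / (2 * real j)<..<1 / real j}"
        using PQ[of i] unfolding \<eta>_def by (intro exI[of _ "P i"] exI[of _ "Q i"]) auto
    qed
  qed
qed

section \<open>Integrals along a line\<close>

text \<open>The squared Euclidean distance to the lattice of integer points.\<close>

definition sq_dist_int :: "real \<times> real \<Rightarrow> real" where
  "sq_dist_int x = (dist_int (fst x))\<^sup>2 + (dist_int (snd x))\<^sup>2"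

text \<open>The line of slope \<alpha> and intercept y contains no lattice point, so an orbit on it
  never meets the stopping point p.\<close>

definition avoids_lattice :: "real \<Rightarrow> real \<Rightarrow> bool" where
  "avoids_lattice \<alpha> y \<longleftrightarrow> (\<forall>k::int. y + \<alpha> * of_int k \<notin> \<int>)"

lemma sq_dist_int_nonneg [simp]: "sq_dist_int x \<ge> 0"
  by (simp add: sq_dist_int_def)

lemma sq_dist_int_eq_0_iff: "sq_dist_int x = 0 \<longleftrightarrow> fst x \<in> \<int> \<and> snd x \<in> \<int>"
  by (simp add: sq_dist_int_def sum_power2_eq_zero_iff dist_int_eq_0_iff)

lemma sq_dist_int_le: "sq_dist_int x \<le> 1 / 2"
proof -
  have "(dist_int t)\<^sup>2 \<le> (1 / 2)\<^sup>2" for t by (intro power_mono dist_int_le_half) auto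
  from this[of "fst x"] this[of "snd x"] show ?thesis
    by (simp add: sq_dist_int_def power2_eq_square)
qed

lemma continuous_on_sq_dist_int [continuous_intros]:
  "continuous_on S f \<Longrightarrow> continuous_on S (\<lambda>x. sq_dist_int (f x))"
  unfolding sq_dist_int_def by (intro continuous_intros)

lemma sq_dist_int_line_pos:
  assumes "avoids_lattice \<alpha> y"
  shows "sq_dist_int (s, y + \<alpha> * s) > 0"
proof -
  have "\<not> (s \<in> \<int> \<and> y + \<alpha> * s \<in> \<int>)"
    using assms unfolding avoids_lattice_def by (auto elim: Ints_cases)
  then show ?thesis using sq_dist_int_eq_0_iff[of "(s, y + \<alpha> * s)"] sq_dist_int_nonneg[of "(s, y + \<alpha> * s)"]
    by (simp add: order_less_le)
qed

text \<open>Up to constants, the time spent near p per unit of abscissa; for q the intercept is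
  shifted by a/b.\<close>

definition line_density :: "real \<Rightarrow> real \<Rightarrow> real \<Rightarrow> real" where
  "line_density \<alpha> y s = 1 / sq_dist_int (s, y + \<alpha> * s)"

lemma line_density_nonneg [simp]: "line_density \<alpha> y s \<ge> 0"
  by (simp add: line_density_def)

lemma continuous_on_line_density:
  "avoids_lattice \<alpha> y \<Longrightarrow> continuous_on S (line_density \<alpha> y)"
  unfolding line_density_def
  by (intro continuous_intros) (metis less_irrefl sq_dist_int_line_pos)

lemma line_density_integrable:
  "avoids_lattice \<alpha> y \<Longrightarrow> line_density \<alpha> y integrable_on {c..d}"
  by (intro integrable_continuous_interval continuous_on_line_density)

lemma dist_int_shift:
  "dist_int (y + \<alpha> * s) \<le> dist_int (y + \<alpha> * t) + \<bar>\<alpha>\<bar> * \<bar>s - t\<bar>"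
proof -
  have "(y + \<alpha> * s) - (y + \<alpha> * t) = \<alpha> * (s - t)" by (simp add: algebra_simps)
  then show ?thesis
    using dist_int_lipschitz[of "y + \<alpha> * s" "y + \<alpha> * t"] by (simp add: abs_mult)
qed

text \<open>On the interval from k to k + \<delta> both coordinates are within (1 + |\<alpha>|)
  \<delta> of integers, so the density is at least 1/(c \<delta>^2) on a length \<delta>; \<delta>
  \<le> 1/2 keeps this interval inside the window.\<close>

lemma integral_window_lower:
  assumes y: "avoids_lattice \<alpha> y"
  shows "integral {of_int k - 1/2..of_int k + 1/2} (line_density \<alpha> y) \<ge>
    1 / (1 + (1 + \<bar>\<alpha>\<bar>)\<^sup>2) * (1 / dist_int (y + \<alpha> * of_int k))"
proof -
  define \<delta> where "\<delta> = dist_int (y + \<alpha> * of_int k)"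
  define c where "c = 1 + (1 + \<bar>\<alpha>\<bar>)\<^sup>2"
  have \<delta>: "\<delta> > 0" "\<delta> \<le> 1 / 2"
    using y dist_int_le_half by (auto simp: \<delta>_def dist_int_pos_iff avoids_lattice_def)
  have c: "c > 0" by (simp add: c_def add_pos_nonneg)
  have "line_density \<alpha> y s \<ge> 1 / (\<delta>\<^sup>2 * c)" if s: "s \<in> {of_int k..of_int k + \<delta>}" for s
  proof -
    have "dist_int s \<le> \<delta>" using dist_int_le[of s k] s by auto
    moreover have "dist_int (y + \<alpha> * s) \<le> \<delta> * (1 + \<bar>\<alpha>\<bar>)"
    proof -
      have "\<bar>\<alpha>\<bar> * \<bar>s - of_int k\<bar> \<le> \<bar>\<alpha>\<bar> * \<delta>" using s by (intro mult_left_mono) auto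
      then show ?thesis using dist_int_shift[of y \<alpha> s "of_int k"] by (simp add: \<delta>_def algebra_simps)
    qed
    ultimately have "sq_dist_int (s, y + \<alpha> * s) \<le> \<delta>\<^sup>2 + (\<delta> * (1 + \<bar>\<alpha>\<bar>))\<^sup>2"
      unfolding sq_dist_int_def fst_conv snd_conv by (intro add_mono power_mono) auto
    also have "\<dots> = \<delta>\<^sup>2 * c" unfolding c_def power_mult_distrib distrib_left[of "\<delta>\<^sup>2"] by simp
    finally show ?thesis
      unfolding line_density_def using sq_dist_int_line_pos[OF y, of s] \<delta> c
      by (intro divide_left_mono mult_pos_pos) auto
  qed
  then have "integral {of_int k..of_int k + \<delta>} (\<lambda>s. 1 / (\<delta>\<^sup>2 * c)) \<le>
      integral {of_int k..of_int k + \<delta>} (line_density \<alpha> y)"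
    by (intro integral_le line_density_integrable y) auto
  also have "\<dots> \<le> integral {of_int k - 1/2..of_int k + 1/2} (line_density \<alpha> y)"
    using \<delta> by (intro integral_subset_le line_density_integrable y) auto
  also have "integral {of_int k..of_int k + \<delta>} (\<lambda>s. 1 / (\<delta>\<^sup>2 * c)) = 1 / c * (1 / \<delta>)"
    using \<delta> c by (simp add: power2_eq_square)
  finally show ?thesis unfolding \<delta>_def[symmetric] c_def[symmetric] .
qed

text \<open>In the window k is a nearest integer to s. From \<delta> \<le> u + |\<alpha>| |s - k|,
  with u the distance in the second coordinate, (s - k)^2 + \<delta>^2 is at most 3 + 2 \<alpha>^2
  times the squared distance to the lattice. The resulting majorant has an arctan primitive, which
  increases by at most \<pi>.\<close>

lemma integral_window_upper:
  assumes y: "avoids_lattice \<alpha> y"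
  shows "integral {of_int k - 1/2..of_int k + 1/2} (line_density \<alpha> y) \<le>
    (3 + 2 * \<alpha>\<^sup>2) * pi * (1 / dist_int (y + \<alpha> * of_int k))"
proof -
  define \<delta> where "\<delta> = dist_int (y + \<alpha> * of_int k)"
  define c where "c = 3 + 2 * \<alpha>\<^sup>2"
  have \<delta>: "\<delta> > 0" using y by (auto simp: \<delta>_def dist_int_pos_iff avoids_lattice_def)
  have c: "c > 0" by (simp add: c_def add_pos_nonneg)
  let ?F = "\<lambda>s. c / \<delta> * arctan ((s - of_int k) / \<delta>)"
  let ?I = "{of_int k - 1/2..of_int k + 1/2 :: real}"
  have "((\<lambda>s. c / ((s - of_int k)\<^sup>2 + \<delta>\<^sup>2)) has_integral (?F (of_int k + 1/2) - ?F (of_int k - 1/2))) ?I"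
  proof (rule fundamental_theorem_of_calculus)
    fix s assume "s \<in> ?I"
    have nz: "(s - of_int k)\<^sup>2 + \<delta>\<^sup>2 \<noteq> 0" using \<delta> by (simp add: sum_power2_eq_zero_iff)
    have nz': "1 + ((s - of_int k) / \<delta>)\<^sup>2 = ((s - of_int k)\<^sup>2 + \<delta>\<^sup>2) / \<delta>\<^sup>2"
      using \<delta> by (simp add: power_divide field_simps)
    have "(?F has_real_derivative c / \<delta> * ((1 / \<delta>) / (1 + ((s - of_int k) / \<delta>)\<^sup>2))) (at s within ?I)"
      using \<delta> by (auto intro!: derivative_eq_intros simp: inverse_eq_divide)
    also have "c / \<delta> * ((1 / \<delta>) / (1 + ((s - of_int k) / \<delta>)\<^sup>2)) = c / ((s - of_int k)\<^sup>2 + \<delta>\<^sup>2)"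
      unfolding nz' using \<delta> by (simp add: power2_eq_square)
    finally show "(?F has_vector_derivative c / ((s - of_int k)\<^sup>2 + \<delta>\<^sup>2)) (at s within ?I)"
      by (simp add: has_real_derivative_iff_has_vector_derivative)
  qed auto
  moreover have "?F (of_int k + 1/2) - ?F (of_int k - 1/2) \<le> c * pi / \<delta>"
  proof -
    have "arctan ((of_int k + 1/2 - of_int k) / \<delta>) - arctan ((of_int k - 1/2 - of_int k) / \<delta>) \<le> pi"
      using arctan_bounded[of "(of_int k + 1/2 - of_int k) / \<delta>"]
        arctan_bounded[of "(of_int k - 1/2 - of_int k) / \<delta>"] by linarith
    then have "c / \<delta> * (arctan ((of_int k + 1/2 - of_int k) / \<delta>) - arctan ((of_int k - 1/2 - of_int k) / \<delta>)) \<le> c / \<delta> * pi"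
      using c \<delta> by (intro mult_left_mono) auto
    then show ?thesis by (simp add: right_diff_distrib)
  qed
  moreover have "line_density \<alpha> y s \<le> c / ((s - of_int k)\<^sup>2 + \<delta>\<^sup>2)" if s: "s \<in> ?I" for s
  proof -
    have ds: "dist_int s = \<bar>s - of_int k\<bar>"
    proof -
      have "\<bar>s - of_int k\<bar> \<le> 1 / 2" using s unfolding atLeastAtMost_iff by linarith
      then show ?thesis
        using dist_int_small[of "s - of_int k"] dist_int_add_int[of "s - of_int k" k] by simp
    qed
    define u where "u = dist_int (y + \<alpha> * s)"
    have "\<delta> \<le> u + \<bar>\<alpha>\<bar> * \<bar>s - of_int k\<bar>"
      using dist_int_shift[of y \<alpha> "of_int k" s] by (simp add: \<delta>_def u_def abs_minus_commute)
    then have "\<delta>\<^sup>2 \<le> (u + \<bar>\<alpha>\<bar> * \<bar>s - of_int k\<bar>)\<^sup>2" using \<delta> by (intro power_mono) auto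
    also have "\<dots> \<le> 2 * u\<^sup>2 + 2 * (\<bar>\<alpha>\<bar> * \<bar>s - of_int k\<bar>)\<^sup>2"
      using sum_squares_bound[of u "\<bar>\<alpha>\<bar> * \<bar>s - of_int k\<bar>"] by (simp add: power2_sum)
    finally have "(s - of_int k)\<^sup>2 + \<delta>\<^sup>2 \<le> (1 + 2 * \<alpha>\<^sup>2) * (s - of_int k)\<^sup>2 + 2 * u\<^sup>2"
      by (simp add: power_mult_distrib algebra_simps)
    also have "\<dots> \<le> c * (s - of_int k)\<^sup>2 + c * u\<^sup>2"
      unfolding c_def by (intro add_mono mult_right_mono) auto
    also have "\<dots> = c * sq_dist_int (s, y + \<alpha> * s)"
      by (simp add: sq_dist_int_def ds u_def distrib_left)
    finally have "(s - of_int k)\<^sup>2 + \<delta>\<^sup>2 \<le> c * sq_dist_int (s, y + \<alpha> * s)" .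
    moreover have "(s - of_int k)\<^sup>2 + \<delta>\<^sup>2 > 0" using \<delta> by (simp add: add_nonneg_pos)
    ultimately show ?thesis
      unfolding line_density_def using sq_dist_int_line_pos[OF y, of s] by (simp add: field_simps)
  qed
  ultimately have "integral ?I (line_density \<alpha> y) \<le> c * pi / \<delta>"
    by (intro order_trans[OF has_integral_le[OF integrable_integral[OF line_density_integrable[OF y]]]]) auto
  then show ?thesis by (simp add: c_def \<delta>_def)
qed

lemma integral_windows:
  assumes y: "avoids_lattice \<alpha> y" and mn: "m \<le> n"
  shows "integral {real m - 1/2..real n - 1/2} (line_density \<alpha> y) =
    (\<Sum>k\<in>{m..<n}. integral {real k - 1/2..real k + 1/2} (line_density \<alpha> y))"
  using mn
proof (induction n rule: dec_induct)
  case base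
  then show ?case by simp
next
  case (step n)
  have "integral {real m - 1/2..real n + 1/2} (line_density \<alpha> y) =
      integral {real m - 1/2..real n - 1/2} (line_density \<alpha> y) +
      integral {real n - 1/2..real n + 1/2} (line_density \<alpha> y)"
    using step by (intro Henstock_Kurzweil_Integration.integral_combine[symmetric] line_density_integrable y) auto
  moreover have "real (Suc n) - 1/2 = real n + 1/2" by simp
  ultimately show ?case
    unfolding sum.atLeastLessThan_Suc[OF step(1)] step(3) by (simp only:)
qed

lemma integral_line_lower:
  assumes y: "avoids_lattice \<alpha> y" and mn: "m \<le> n" and x: "x \<le> real m - 1/2" "real n - 1/2 \<le> S"
  shows "integral {x..S} (line_density \<alpha> y) \<ge>
    1 / (1 + (1 + \<bar>\<alpha>\<bar>)\<^sup>2) * (\<Sum>k\<in>{m..<n}. 1 / dist_int (y + \<alpha> * real k))"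
proof -
  have "1 / (1 + (1 + \<bar>\<alpha>\<bar>)\<^sup>2) * (\<Sum>k\<in>{m..<n}. 1 / dist_int (y + \<alpha> * real k)) \<le>
      integral {real m - 1/2..real n - 1/2} (line_density \<alpha> y)"
    unfolding integral_windows[OF y mn] sum_distrib_left
  proof (rule sum_mono)
    fix k
    show "1 / (1 + (1 + \<bar>\<alpha>\<bar>)\<^sup>2) * (1 / dist_int (y + \<alpha> * real k)) \<le>
        integral {real k - 1/2..real k + 1/2} (line_density \<alpha> y)"
      using integral_window_lower[OF y, of "int k"] by (simp only: of_int_of_nat_eq)
  qed
  also have "\<dots> \<le> integral {x..S} (line_density \<alpha> y)"
    using x by (intro integral_subset_le line_density_integrable y) auto
  finally show ?thesis .
qed

lemma integral_line_upper:
  assumes y: "avoids_lattice \<alpha> y" and x: "- 1/2 \<le> x"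
  shows "integral {x..real n - 1/2} (line_density \<alpha> y) \<le>
    (3 + 2 * \<alpha>\<^sup>2) * pi * (\<Sum>k<n. 1 / dist_int (y + \<alpha> * real k))"
proof -
  have "integral {x..real n - 1/2} (line_density \<alpha> y) \<le> integral {real 0 - 1/2..real n - 1/2} (line_density \<alpha> y)"
    using x by (intro integral_subset_le line_density_integrable y) auto
  also have "\<dots> \<le> (3 + 2 * \<alpha>\<^sup>2) * pi * (\<Sum>k<n. 1 / dist_int (y + \<alpha> * real k))"
    unfolding integral_windows[OF y le0] sum_distrib_left lessThan_atLeast0
  proof (rule sum_mono)
    fix k
    show "integral {real k - 1/2..real k + 1/2} (line_density \<alpha> y) \<le>
        (3 + 2 * \<alpha>\<^sup>2) * pi * (1 / dist_int (y + \<alpha> * real k))"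
      using integral_window_upper[OF y, of "int k"] by (simp only: of_int_of_nat_eq)
  qed
  finally show ?thesis .
qed

section \<open>Growth and comparison of the line integrals\<close>

lemma avoids_lattice_pos: "avoids_lattice \<alpha> y \<Longrightarrow> dist_int (y + \<alpha> * real k) > 0"
  unfolding avoids_lattice_def dist_int_pos_iff by (metis of_int_of_nat_eq)

lemma avoids_lattice_shift: "avoids_lattice \<alpha> y \<Longrightarrow> avoids_lattice \<alpha> (y + \<alpha> * real k)"
  unfolding avoids_lattice_def
proof (intro allI)
  fix l :: int assume *: "\<forall>k::int. y + \<alpha> * of_int k \<notin> \<int>"
  show "y + \<alpha> * real k + \<alpha> * of_int l \<notin> \<int>"
    using *[rule_format, of "int k + l"] by (simp add: algebra_simps)
qed

text \<open>One convergent serves all large S: each block of length Q adds at least c Q (ln Q - 1),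
  so a fixed Q with ln Q large enough already gives slope K.\<close>

lemma integral_line_superlinear:
  assumes W: "\<alpha> \<in> W_set \<nu> b" and \<nu>: "\<nu> > 0" and y: "avoids_lattice \<alpha> y" and x: "x \<le> 1"
  shows "\<exists>S0. \<forall>S\<ge>S0. integral {x..S} (line_density \<alpha> y) \<ge> K * S"
proof -
  define c where "c = 1 / (1 + (1 + \<bar>\<alpha>\<bar>)\<^sup>2)"
  have c: "c > 0" by (simp add: c_def add_pos_nonneg)
  define L where "L = max 0 (2 * K / c)"
  obtain N :: nat where N: "exp (L + 1) \<le> real N" using real_arch_simple by blast
  obtain P Q where PQ: "Q \<ge> max 2 N" "good_approx \<alpha> \<nu> b P Q" using W_set_good_approx[OF W] by blast
  have Q: "Q \<ge> 2" "real Q \<ge> exp (L + 1)" using PQ N by auto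
  then have lnQ: "ln (real Q) - 1 \<ge> L" by (simp add: ln_ge_iff algebra_simps)
  have L: "L \<ge> 0" "c * L \<ge> 2 * K" using c by (auto simp: L_def max_def field_simps)
  have "integral {x..S} (line_density \<alpha> y) \<ge> K * S" if S: "S \<ge> 4 * real Q" for S
  proof -
    define M where "M = nat \<lfloor>S / real Q\<rfloor>"
    have "S / real Q \<ge> 4" using S Q by (simp add: field_simps)
    then have M: "real M \<le> S / real Q" "S / real Q < real M + 1" "M \<ge> 1"
      unfolding M_def by linarith+
    then have MQ: "real M * real Q \<le> S" "S < (real M + 1) * real Q" using Q by (auto simp: field_simps)
    have "(\<Sum>k\<in>{Q..<M * Q}. 1 / dist_int (y + \<alpha> * real k)) =
        (\<Sum>m\<in>{1..<M}. \<Sum>j<Q. 1 / dist_int (y + \<alpha> * real (m * Q + j)))"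
      using M(3) by (rule sum_atLeastLessThan_blocks)
    also have "\<dots> \<ge> (\<Sum>m\<in>{1..<M}. real Q * (ln (real Q) - 1))"
    proof (rule sum_mono)
      fix m
      have eq: "y + \<alpha> * real (m * Q + j) = (y + \<alpha> * real (m * Q)) + \<alpha> * real j" for j
        by (simp add: algebra_simps)
      show "real Q * (ln (real Q) - 1) \<le> (\<Sum>j<Q. 1 / dist_int (y + \<alpha> * real (m * Q + j)))"
        unfolding eq using PQ(2) Q \<nu>
        by (intro block_rotation_lower[of P] good_approx_error avoids_lattice_pos avoids_lattice_shift y)
          (auto simp: good_approx_def)
    qed
    also have "(\<Sum>m\<in>{1..<M}. real Q * (ln (real Q) - 1)) = (real M - 1) * real Q * (ln (real Q) - 1)"
      using M(3) by (simp add: of_nat_diff)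
    \<comment> \<open>Dropping the block m = 0 and the incomplete last block costs at most 2 Q,
      which is at most S/2 because S \<ge> 4 Q.\<close>
    also have "\<dots> \<ge> S / 2 * L"
    proof (rule mult_mono)
      show "S / 2 \<le> (real M - 1) * real Q" using MQ S by (simp add: algebra_simps)
    qed (use lnQ L M S in auto)
    finally have sum: "(\<Sum>k\<in>{Q..<M * Q}. 1 / dist_int (y + \<alpha> * real k)) \<ge> S / 2 * L" .
    have "K * S \<le> (c * L / 2) * S" using L S by (intro mult_right_mono) auto
    also have "\<dots> = c * (S / 2 * L)" by simp
    also have "\<dots> \<le> c * (\<Sum>k\<in>{Q..<M * Q}. 1 / dist_int (y + \<alpha> * real k))"
      using sum c by (intro mult_left_mono) auto
    also have "\<dots> \<le> integral {x..S} (line_density \<alpha> y)"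
      unfolding c_def using M(3) MQ x Q by (intro integral_line_lower y) auto
    finally show ?thesis .
  qed
  then show ?thesis by blast
qed

text \<open>Since ln (1/d) \<ge> \<nu> ln Q, both sums of \<open>rotation_drift\<close> are
  controlled by M Q ln Q, and their quotient is at least of order \<nu>/\<epsilon>. So \<epsilon> is
  fixed first, depending on K, and Q is taken large afterwards.\<close>

lemma integral_line_dominates:
  fixes a b :: int
  assumes \<alpha>: "\<alpha> \<notin> \<rat>" and \<nu>: "\<nu> > 0" and b: "b \<ge> 2" and ab: "coprime a b" and K: "K \<ge> 0"
    and hits: "near_hits \<alpha> \<nu> b y" and x: "x \<in> {0..1}"
    and y: "avoids_lattice \<alpha> y" and y': "avoids_lattice \<alpha> (y - of_int a / of_int b)"
  shows "\<exists>S\<ge>S0. integral {x..S} (line_density \<alpha> y) \<ge>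
    K * integral {x..S} (line_density \<alpha> (y - of_int a / of_int b))"
proof -
  define c where "c = 1 / (1 + (1 + \<bar>\<alpha>\<bar>)\<^sup>2)"
  define C where "C = (3 + 2 * \<alpha>\<^sup>2) * pi"
  have c: "c > 0" by (simp add: c_def add_pos_nonneg)
  have C: "C > 0" by (simp add: C_def add_pos_nonneg)
  \<comment> \<open>The + 1 leaves one spare ln Q, which later absorbs all terms that do not depend
    on Q.\<close>
  obtain j :: nat where j: "max (2 * of_int b) ((2 * K * C + 1) / (c * \<nu>)) \<le> real j"
    using real_arch_simple by blast
  define \<epsilon> where "\<epsilon> = 1 / real j"
  have j0: "j > 0" using j b by (cases "j = 0") auto
  then have \<epsilon>: "\<epsilon> > 0" "\<epsilon> \<le> 1 / (2 * of_int b)" "c * \<nu> / \<epsilon> \<ge> 2 * K * C + 1"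
    using j b c \<nu> by (auto simp: \<epsilon>_def field_simps)
  \<comment> \<open>The first bound on ln Q forces d \<le> \<epsilon>/8; the second makes the spare
    ln Q exceed the constant terms.\<close>
  define L where "L = max (ln (8 / \<epsilon>) / \<nu>) (2 * K * C * (2 * of_int b + 1) - c / \<epsilon> * (ln (\<epsilon> / 2) - 1))"
  obtain N :: nat where N: "max (exp L) (S0 + 2) \<le> real N" using real_arch_simple by blast
  obtain P Q where PQ: "Q \<ge> max 2 N" "good_approx \<alpha> \<nu> b P Q"
      "frac (- sgn (real Q * \<alpha> - P) * (real Q * y)) \<in> {1 / (2 * real j)<..<1 / real j}"
    using hits j0 unfolding near_hits_def by blast
  define d where "d = real Q * \<bar>real Q * \<alpha> - of_int P\<bar>"
  have Q: "Q \<ge> 2" "real Q \<ge> exp L" "real Q \<ge> S0 + 2" using PQ N by auto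
  then have lnQ: "ln (real Q) \<ge> L" by (simp add: ln_ge_iff)
  have ne: "real Q * \<alpha> - of_int P \<noteq> 0"
  proof
    assume "real Q * \<alpha> - of_int P = 0"
    then have "\<alpha> = of_int P / of_nat Q" using Q by (simp add: field_simps)
    moreover have "of_int P / of_nat Q \<in> (\<rat> :: real set)" by (intro Rats_divide) auto
    ultimately show False using \<alpha> by simp
  qed
  have d: "0 < d" "d \<le> real Q powr (- \<nu>)"
    using ne Q PQ(2) by (auto simp: d_def good_approx_def)
  have Qpow: "real Q powr (- \<nu>) = exp (- \<nu> * ln (real Q))" using Q by (simp add: powr_def)
  have "d \<le> \<epsilon> / 8"
  proof -
    have "ln (8 / \<epsilon>) \<le> \<nu> * ln (real Q)"
    proof -
      have "ln (8 / \<epsilon>) / \<nu> \<le> ln (real Q)" using lnQ by (simp add: L_def)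
      then show ?thesis using \<nu> by (simp add: field_simps)
    qed
    then have "exp (- \<nu> * ln (real Q)) \<le> exp (- ln (8 / \<epsilon>))" by simp
    also have "\<dots> = \<epsilon> / 8" using \<epsilon> by (simp add: exp_minus)
    finally show ?thesis using d Qpow by simp
  qed
  then obtain M where M: "M \<ge> 2"
    "(\<Sum>k\<in>{Q..<M * Q}. 1 / dist_int (y + \<alpha> * real k)) \<ge>
       real M * real Q / \<epsilon> * (ln (\<epsilon> / (2 * d)) - 1)"
    "(\<Sum>k<M * Q. 1 / dist_int (y - of_int a / of_int b + \<alpha> * real k)) \<le>
       real M * (2 * real Q * (2 * of_int b + 1 + ln (real Q)))"
    using rotation_drift[of P Q b a \<alpha> \<epsilon> y] PQ(2,3) ab b Q(1) ne \<epsilon> avoids_lattice_pos[OF y]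
    by (auto simp: good_approx_def d_def \<epsilon>_def)
  \<comment> \<open>The right end of the window around M Q - 1, so that exactly the windows counted
    in the upper sum lie to the left of S.\<close>
  define S where "S = real (M * Q) - 1/2"
  have MQ: "real (M * Q) \<ge> 2 * real Q"
    using M(1) by (simp add: mult_right_mono)
  have key: "2 * K * C * (2 * of_int b + 1 + ln (real Q)) \<le> c / \<epsilon> * (ln (\<epsilon> / (2 * d)) - 1)"
  proof -
    have "ln d \<le> - \<nu> * ln (real Q)" using d Qpow by (metis exp_gt_zero ln_exp ln_mono)
    then have "ln (\<epsilon> / (2 * d)) \<ge> ln (\<epsilon> / 2) + \<nu> * ln (real Q)"
      using d \<epsilon> by (simp add: ln_div ln_mult)
    then have "c / \<epsilon> * (ln (\<epsilon> / (2 * d)) - 1) \<ge> c / \<epsilon> * (ln (\<epsilon> / 2) + \<nu> * ln (real Q) - 1)"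
      using c \<epsilon> by (intro mult_left_mono) auto
    also have "c / \<epsilon> * (ln (\<epsilon> / 2) + \<nu> * ln (real Q) - 1) =
        (c * \<nu> / \<epsilon>) * ln (real Q) + c / \<epsilon> * (ln (\<epsilon> / 2) - 1)"
      by (simp add: algebra_simps)
    also have "\<dots> \<ge> (2 * K * C + 1) * ln (real Q) + c / \<epsilon> * (ln (\<epsilon> / 2) - 1)"
      using \<epsilon>(3) Q by (intro add_right_mono mult_right_mono) auto
    also have "(2 * K * C + 1) * ln (real Q) + c / \<epsilon> * (ln (\<epsilon> / 2) - 1) \<ge>
        2 * K * C * (2 * of_int b + 1 + ln (real Q))"
      using lnQ by (simp add: L_def algebra_simps)
    finally show ?thesis .
  qed
  have "K * integral {x..S} (line_density \<alpha> (y - of_int a / of_int b)) \<le>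
      K * (C * (\<Sum>k<M * Q. 1 / dist_int (y - of_int a / of_int b + \<alpha> * real k)))"
    unfolding S_def C_def using K x by (intro mult_left_mono integral_line_upper y') auto
  also have "\<dots> \<le> K * (C * (real M * (2 * real Q * (2 * of_int b + 1 + ln (real Q)))))"
    using M(3) K C by (intro mult_left_mono) auto
  also have "\<dots> = real M * real Q * (2 * K * C * (2 * of_int b + 1 + ln (real Q)))" by simp
  also have "\<dots> \<le> real M * real Q * (c / \<epsilon> * (ln (\<epsilon> / (2 * d)) - 1))"
    using key by (intro mult_left_mono) auto
  also have "\<dots> = c * (real M * real Q / \<epsilon> * (ln (\<epsilon> / (2 * d)) - 1))" by simp
  also have "\<dots> \<le> c * (\<Sum>k\<in>{Q..<M * Q}. 1 / dist_int (y + \<alpha> * real k))"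
    using M(2) c by (intro mult_left_mono) auto
  also have "\<dots> \<le> integral {x..S} (line_density \<alpha> y)"
    unfolding c_def using MQ x Q M(1) by (intro integral_line_lower y) (auto simp: S_def)
  finally have "K * integral {x..S} (line_density \<alpha> (y - of_int a / of_int b)) \<le>
      integral {x..S} (line_density \<alpha> y)" .
  moreover have "S0 \<le> S" using MQ Q unfolding S_def by linarith
  ultimately show ?thesis by blast
qed

section \<open>The speed function near its zeros\<close>

lemma Ck_continuous:
  "Ck k f \<Longrightarrow> continuous_on UNIV f"
  by (cases k) (auto intro: differentiable_imp_continuous_within continuous_at_imp_continuous_on)

lemma Ck_Suc_imp: "Ck (Suc k) f \<Longrightarrow> Ck k f"
proof (induction k arbitrary: f)
  case 0
  then show ?case using Ck_continuous[of "Suc 0" f] by simp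
next
  case (Suc k)
  then show ?case by (metis Ck.simps(2))
qed

lemma frechet_derivative_line:
  fixes f :: "'a::real_normed_vector \<Rightarrow> real"
  assumes "f differentiable (at (x + t *\<^sub>R h))"
  shows "((\<lambda>t. f (x + t *\<^sub>R h)) has_real_derivative frechet_derivative f (at (x + t *\<^sub>R h)) h) (at t)"
proof -
  have f: "(f has_derivative frechet_derivative f (at (x + t *\<^sub>R h))) (at (x + t *\<^sub>R h))"
    using assms frechet_derivative_works by blast
  have "((\<lambda>t. x + t *\<^sub>R h) has_derivative (\<lambda>s. s *\<^sub>R h)) (at t)"
    by (auto intro!: derivative_eq_intros)
  from diff_chain_at[OF this f]
  have "((\<lambda>t. f (x + t *\<^sub>R h)) has_derivative (\<lambda>s. frechet_derivative f (at (x + t *\<^sub>R h)) (s *\<^sub>R h))) (at t)"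
    by (simp add: o_def)
  moreover have "(\<lambda>s. frechet_derivative f (at (x + t *\<^sub>R h)) (s *\<^sub>R h)) =
      (*) (frechet_derivative f (at (x + t *\<^sub>R h)) h)"
    using linear_frechet_derivative[OF assms] by (auto simp: linear_cmul)
  ultimately show ?thesis by (simp add: has_field_derivative_def)
qed

lemma Taylor_second_order:
  fixes f :: "'a::real_normed_vector \<Rightarrow> real"
  assumes f: "Ck 2 f"
  shows "\<exists>t. 0 < t \<and> t < 1 \<and>
    f (x + h) = f x + frechet_derivative f (at x) h + hessian f (x + t *\<^sub>R h) h h / 2"
proof -
  have d1: "f differentiable (at y)" for y using f unfolding numeral_2_eq_2 Ck.simps by blast
  have d2: "(\<lambda>y. frechet_derivative f (at y) v) differentiable (at y)" for v y
    using f unfolding numeral_2_eq_2 Ck.simps by blast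
  define g where "g m t = (if m = 0 then f (x + t *\<^sub>R h)
    else if m = 1 then frechet_derivative f (at (x + t *\<^sub>R h)) h
    else hessian f (x + t *\<^sub>R h) h h)" for m :: nat and t
  have g: "g 0 = (\<lambda>t. f (x + t *\<^sub>R h))" "g (Suc 0) = (\<lambda>t. frechet_derivative f (at (x + t *\<^sub>R h)) h)"
    "g 2 = (\<lambda>t. hessian f (x + t *\<^sub>R h) h h)"
    by (auto simp: g_def)
  have "DERIV (g m) t :> g (Suc m) t" if "m < 2" for m t
  proof (cases "m = 0")
    case True
    then show ?thesis using frechet_derivative_line[OF d1, where x = x and t = t and h = h] by (simp add: g)
  next
    case False
    then have "m = 1" using that by simp
    then show ?thesis
      using frechet_derivative_line[OF d2, where x = x and t = t and h = h and v1 = h] by (simp add: g hessian_def flip: numeral_2_eq_2)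
  qed
  then have "\<exists>t. 0 < t \<and> t < 1 \<and> f (x + 1 *\<^sub>R h) =
      (\<Sum>m<2. g m 0 / fact m * 1 ^ m) + g 2 t / fact 2 * 1 ^ 2"
    by (intro Maclaurin) (auto simp: g)
  then show ?thesis by (simp add: g lessThan_nat_numeral add.commute)
qed

text \<open>Explicit coefficients reduce continuity and positivity of the Hessian to three scalar
  functions of the base point.\<close>

lemma hessian_basis:
  fixes f :: "real \<times> real \<Rightarrow> real"
  assumes f: "Ck 2 f"
  shows "hessian f x h h = (fst h)\<^sup>2 * hessian f x (1, 0) (1, 0) +
    fst h * snd h * (hessian f x (1, 0) (0, 1) + hessian f x (0, 1) (1, 0)) +
    (snd h)\<^sup>2 * hessian f x (0, 1) (0, 1)"
proof -
  have d1: "f differentiable (at y)" for y using f unfolding numeral_2_eq_2 Ck.simps by blast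
  have d2: "(\<lambda>y. frechet_derivative f (at y) v) differentiable (at y)" for v y
    using f unfolding numeral_2_eq_2 Ck.simps by blast
  have decomp: "L h = fst h * L (1, 0) + snd h * L (0, 1)" if "linear L" for L :: "real \<times> real \<Rightarrow> real"
  proof -
    have h: "fst h *\<^sub>R (1, 0) + snd h *\<^sub>R (0, 1) = h" by (simp add: prod_eq_iff)
    show ?thesis
      using linear_add[OF that, of "fst h *\<^sub>R (1, 0)" "snd h *\<^sub>R (0, 1)"]
      unfolding h linear_cmul[OF that] by simp
  qed
  let ?D = "\<lambda>v y. frechet_derivative f (at y) v"
  have "?D h = (\<lambda>y. fst h * ?D (1, 0) y + snd h * ?D (0, 1) y)"
    using decomp[OF linear_frechet_derivative[OF d1]] by auto
  moreover have D: "(?D v has_derivative frechet_derivative (?D v) (at x)) (at x)" for v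
    using d2[of v x] by (simp add: frechet_derivative_works)
  have "((\<lambda>y. fst h * ?D (1, 0) y + snd h * ?D (0, 1) y) has_derivative
      (\<lambda>v. fst h * frechet_derivative (?D (1, 0)) (at x) v + snd h * frechet_derivative (?D (0, 1)) (at x) v)) (at x)"
    by (intro has_derivative_add has_derivative_mult_right D)
  ultimately have "frechet_derivative (?D h) (at x) =
      (\<lambda>v. fst h * frechet_derivative (?D (1, 0)) (at x) v + snd h * frechet_derivative (?D (0, 1)) (at x) v)"
    by (simp add: frechet_derivative_at[symmetric])
  then have "hessian f x h h = fst h * frechet_derivative (?D (1, 0)) (at x) h +
      snd h * frechet_derivative (?D (0, 1)) (at x) h"
    by (simp add: hessian_def)
  then show ?thesis
    using decomp[OF linear_frechet_derivative[OF d2, of "(1, 0)" x]]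
      decomp[OF linear_frechet_derivative[OF d2, of "(0, 1)" x]]
    by (simp add: hessian_def power2_eq_square algebra_simps)
qed

lemma continuous_on_hessian: "Ck 2 f \<Longrightarrow> continuous_on UNIV (\<lambda>x. hessian f x v w)"
  unfolding numeral_2_eq_2 hessian_def Ck.simps by blast

lemma quadratic_form_bound:
  fixes h :: "real \<times> real"
  shows "\<bar>(fst h)\<^sup>2 * A + fst h * snd h * B + (snd h)\<^sup>2 * C\<bar> \<le> (norm h)\<^sup>2 * (\<bar>A\<bar> + \<bar>B\<bar> + \<bar>C\<bar>)"
proof -
  have n: "\<bar>fst h\<bar> \<le> norm h" "\<bar>snd h\<bar> \<le> norm h"
    using norm_fst_le[of "fst h" "snd h"] norm_snd_le[of "snd h" "fst h"] by auto
  have "\<bar>(fst h)\<^sup>2 * A\<bar> \<le> (norm h)\<^sup>2 * \<bar>A\<bar>" "\<bar>(snd h)\<^sup>2 * C\<bar> \<le> (norm h)\<^sup>2 * \<bar>C\<bar>"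
    using n by (auto simp: abs_mult intro!: mult_right_mono power2_le_iff_abs_le[THEN iffD2])
  moreover have "\<bar>fst h * snd h * B\<bar> \<le> (norm h)\<^sup>2 * \<bar>B\<bar>"
    using n by (auto simp: abs_mult power2_eq_square intro!: mult_mono)
  ultimately show ?thesis unfolding distrib_left by linarith
qed

text \<open>Comparison is kept local because it has different reasons near p, near q and elsewhere;
  compactness glues the pieces.\<close>

definition comparable_at :: "('a::topological_space \<Rightarrow> real) \<Rightarrow> ('a \<Rightarrow> real) \<Rightarrow> 'a \<Rightarrow> bool" where
  "comparable_at f g x \<longleftrightarrow> (\<exists>C>0. \<forall>\<^sub>F y in nhds x. f y \<le> C * g y \<and> g y \<le> C * f y)"

lemma comparable_at_sym: "comparable_at f g x \<Longrightarrow> comparable_at g f x"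
  unfolding comparable_at_def by (auto elim!: eventually_mono)

lemma comparable_at_trans:
  assumes "comparable_at f g x" "comparable_at g h x"
  shows "comparable_at f h x"
proof -
  obtain C C' where C: "C > 0" "\<forall>\<^sub>F y in nhds x. f y \<le> C * g y \<and> g y \<le> C * f y"
    and C': "C' > 0" "\<forall>\<^sub>F y in nhds x. g y \<le> C' * h y \<and> h y \<le> C' * g y"
    using assms unfolding comparable_at_def by blast
  have "\<forall>\<^sub>F y in nhds x. f y \<le> (C * C') * h y \<and> h y \<le> (C * C') * f y"
    using C(2) C'(2)
  proof eventually_elim
    case (elim y)
    have "C * g y \<le> C * (C' * h y)" "C' * g y \<le> C' * (C * f y)"
      using elim C(1) C'(1) by (auto intro!: mult_left_mono)
    then show ?case using elim by (simp add: mult_ac)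
  qed
  then show ?thesis unfolding comparable_at_def using C(1) C'(1) by (intro exI[of _ "C * C'"]) auto
qed

lemma comparable_at_mult:
  assumes "comparable_at f g x" "comparable_at f' g' x"
    and "\<And>y. f y \<ge> 0" "\<And>y. g y \<ge> 0" "\<And>y. f' y \<ge> 0" "\<And>y. g' y \<ge> 0"
  shows "comparable_at (\<lambda>y. f y * f' y) (\<lambda>y. g y * g' y) x"
proof -
  obtain C C' where C: "C > 0" "\<forall>\<^sub>F y in nhds x. f y \<le> C * g y \<and> g y \<le> C * f y"
    and C': "C' > 0" "\<forall>\<^sub>F y in nhds x. f' y \<le> C' * g' y \<and> g' y \<le> C' * f' y"
    using assms(1,2) unfolding comparable_at_def by blast
  have "\<forall>\<^sub>F y in nhds x. f y * f' y \<le> (C * C') * (g y * g' y) \<and> g y * g' y \<le> (C * C') * (f y * f' y)"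
    using C(2) C'(2)
  proof eventually_elim
    case (elim y)
    have "f y * f' y \<le> (C * g y) * (C' * g' y)" "g y * g' y \<le> (C * f y) * (C' * f' y)"
      using elim assms(3-6) C(1) C'(1) by (auto intro!: mult_mono)
    then show ?case by (simp add: mult_ac)
  qed
  then show ?thesis unfolding comparable_at_def using C(1) C'(1) by (intro exI[of _ "C * C'"]) auto
qed

lemma comparable_at_pos:
  assumes "isCont f x" "isCont g x" "f x > 0" "g x > 0"
  shows "comparable_at f g x"
proof -
  have f: "\<forall>\<^sub>F y in nhds x. f x / 2 < f y" "\<forall>\<^sub>F y in nhds x. f y < 2 * f x"
    using order_tendstoD(1)[OF assms(1)[unfolded isCont_def tendsto_at_iff_tendsto_nhds], of "f x / 2"]
      order_tendstoD(2)[OF assms(1)[unfolded isCont_def tendsto_at_iff_tendsto_nhds], of "2 * f x"] assms(3)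
    by simp_all
  have g: "\<forall>\<^sub>F y in nhds x. g x / 2 < g y" "\<forall>\<^sub>F y in nhds x. g y < 2 * g x"
    using order_tendstoD(1)[OF assms(2)[unfolded isCont_def tendsto_at_iff_tendsto_nhds], of "g x / 2"]
      order_tendstoD(2)[OF assms(2)[unfolded isCont_def tendsto_at_iff_tendsto_nhds], of "2 * g x"] assms(4)
    by simp_all
  define C where "C = max (4 * f x / g x) (4 * g x / f x)"
  have C: "C > 0" "C * g x \<ge> 4 * f x" "C * f x \<ge> 4 * g x"
    using assms(3,4) unfolding C_def
    by (auto simp: less_max_iff_disj pos_divide_le_eq[symmetric])
  have "\<forall>\<^sub>F y in nhds x. f y \<le> C * g y \<and> g y \<le> C * f y"
    using f g
  proof eventually_elim
    case (elim y)
    have "C * (g x / 2) \<le> C * g y" "C * (f x / 2) \<le> C * f y"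
      using elim C(1) by (auto intro!: mult_left_mono)
    moreover have "C * (g x / 2) \<ge> 2 * f x" "C * (f x / 2) \<ge> 2 * g x" using C by auto
    ultimately show ?case using elim by linarith
  qed
  then show ?thesis unfolding comparable_at_def using C(1) by blast
qed

lemma comparable_on_compact:
  assumes K: "compact K" and loc: "\<And>x. x \<in> K \<Longrightarrow> comparable_at f g x"
    and nonneg: "\<And>x. f x \<ge> 0" "\<And>x. g x \<ge> 0"
  shows "\<exists>C>0. \<forall>x\<in>K. f x \<le> C * g x \<and> g x \<le> C * f x"
proof -
  have "\<forall>x\<in>K. \<exists>C U. C > 0 \<and> open U \<and> x \<in> U \<and> (\<forall>y\<in>U. f y \<le> C * g y \<and> g y \<le> C * f y)"
    using loc unfolding comparable_at_def eventually_nhds by blast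
  then obtain C U where CU: "\<And>x. x \<in> K \<Longrightarrow> C x > 0 \<and> open (U x) \<and> x \<in> U x \<and>
      (\<forall>y\<in>U x. f y \<le> C x * g y \<and> g y \<le> C x * f y)"
    by metis
  obtain T where T: "T \<subseteq> K" "finite T" "K \<subseteq> (\<Union>x\<in>T. U x)"
    using compactE_image[OF K, of K U] CU by (metis UN_iff subsetI)
  define B where "B = 1 + (\<Sum>x\<in>T. C x)"
  have B: "B \<ge> C x" if "x \<in> T" for x
    using T(1,2) that CU member_le_sum[of x T C] by (force simp: B_def)
  have "B > 0" unfolding B_def using T(1) CU by (intro add_pos_nonneg sum_nonneg) (auto simp: less_imp_le)
  moreover have "f y \<le> B * g y \<and> g y \<le> B * f y" if y: "y \<in> K" for y
  proof -
    obtain x where x: "x \<in> T" "y \<in> U x" using T(3) y by blast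
    then have "f y \<le> C x * g y" "g y \<le> C x * f y" using CU T(1) by auto
    moreover have "C x * g y \<le> B * g y" "C x * f y \<le> B * f y"
      using B[OF x(1)] nonneg by (auto intro!: mult_right_mono)
    ultimately show ?thesis by linarith
  qed
  ultimately show ?thesis by blast
qed

text \<open>The gradient vanishes at a minimum, so by Taylor f (x + h) is half the Hessian form at
  an intermediate point. At x this form is at least m |h|^2 by compactness of the unit sphere, and
  nearby it changes by at most (m/2) |h|^2.\<close>

lemma comparable_at_nondegenerate_min:
  fixes f :: "real \<times> real \<Rightarrow> real"
  assumes f: "Ck 2 f" and nonneg: "\<And>y. f y \<ge> 0" and x: "f x = 0"
    and pos: "\<And>v. v \<noteq> 0 \<Longrightarrow> hessian f x v v > 0"
  shows "comparable_at f (\<lambda>y. (norm (y - x))\<^sup>2) x"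
proof -
  define A where "A y = hessian f y (1, 0) (1, 0)" for y
  define B where "B y = hessian f y (1, 0) (0, 1) + hessian f y (0, 1) (1, 0)" for y
  define C where "C y = hessian f y (0, 1) (0, 1)" for y
  have hess: "hessian f y h h = (fst h)\<^sup>2 * A y + fst h * snd h * B y + (snd h)\<^sup>2 * C y" for y h
    unfolding A_def B_def C_def by (rule hessian_basis[OF f])
  have "isCont (\<lambda>x. hessian f x v w) x" for v w
    using continuous_on_hessian[OF f, of v w] unfolding continuous_on_eq_continuous_at[OF open_UNIV] by blast
  then have cont: "isCont A x" "isCont B x" "isCont C x"
    unfolding A_def B_def C_def by (auto intro: continuous_add)
  have df0: "frechet_derivative f (at x) h = 0" for h
  proof -
    have "DERIV (\<lambda>t. f (x + t *\<^sub>R h)) 0 :> frechet_derivative f (at (x + 0 *\<^sub>R h)) h"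
      using f unfolding numeral_2_eq_2 Ck.simps by (intro frechet_derivative_line) blast
    then have "frechet_derivative f (at (x + 0 *\<^sub>R h)) h = 0"
      by (rule DERIV_local_min[of _ _ _ 1]) (auto simp: x nonneg)
    then show ?thesis by simp
  qed
  have taylor: "\<exists>t. 0 < t \<and> t < 1 \<and> f (x + h) = hessian f (x + t *\<^sub>R h) h h / 2" for h
    using Taylor_second_order[OF f, of x h] by (simp add: df0 x)
  have "\<exists>m>0. \<forall>h. hessian f x h h \<ge> m * (norm h)\<^sup>2"
  proof -
    have "\<exists>u\<in>sphere 0 1. \<forall>v\<in>sphere 0 1. hessian f x u u \<le> hessian f x (v :: real \<times> real) v"
      unfolding hess
      by (rule continuous_attains_inf) (auto intro!: continuous_intros)
    then obtain u :: "real \<times> real" where u: "norm u = 1"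
        "\<And>v. norm v = 1 \<Longrightarrow> hessian f x u u \<le> hessian f x v v" by auto
    have "hessian f x h h \<ge> hessian f x u u * (norm h)\<^sup>2" for h
    proof (cases "h = 0")
      case False
      define v where "v = (1 / norm h) *\<^sub>R h"
      have "norm v = 1" using False by (simp add: v_def)
      moreover have "hessian f x h h = (norm h)\<^sup>2 * hessian f x v v"
        unfolding hess v_def using False by (simp add: power2_eq_square field_simps)
      ultimately show ?thesis
        using mult_left_mono[OF u(2)[of v], of "(norm h)\<^sup>2"] by (simp add: mult.commute)
    qed (simp add: hess)
    moreover have "hessian f x u u > 0" using u(1) by (intro pos) auto
    ultimately show ?thesis by blast
  qed
  then obtain m where m: "m > 0" "\<And>h. hessian f x h h \<ge> m * (norm h)\<^sup>2" by blast
  define S where "S = \<bar>A x\<bar> + \<bar>B x\<bar> + \<bar>C x\<bar>"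
  define e where "e y = \<bar>A y - A x\<bar> + \<bar>B y - B x\<bar> + \<bar>C y - C x\<bar>" for y
  have "isCont e x" unfolding e_def using cont by (intro continuous_intros) auto
  then have "(e \<longlongrightarrow> 0) (nhds x)" unfolding isCont_def tendsto_at_iff_tendsto_nhds by (simp add: e_def)
  then have "\<forall>\<^sub>F y in nhds x. e y < m / 2" using m(1) by (intro order_tendstoD) auto
  then obtain r where r: "r > 0" "\<And>y. dist y x < r \<Longrightarrow> e y < m / 2"
    unfolding eventually_nhds_metric by blast
  \<comment> \<open>At the intermediate point the form is still at least (m/2) |h|^2, so f is at
    least (m/4) |h|^2; S + m is a bound from above.\<close>
  define K where "K = max (S + m) (4 / m)"
  have "\<forall>\<^sub>F y in nhds x. f y \<le> K * (norm (y - x))\<^sup>2 \<and> (norm (y - x))\<^sup>2 \<le> K * f y"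
    unfolding eventually_nhds_metric
  proof (intro exI[of _ r] conjI allI impI r(1))
    fix y assume y: "dist y x < r"
    define h where "h = y - x"
    obtain t where t: "0 < t" "t < 1" "f y = hessian f (x + t *\<^sub>R h) h h / 2"
      using taylor[of h] by (auto simp: h_def)
    define z where "z = x + t *\<^sub>R h"
    have "dist z x \<le> norm h" using t by (simp add: z_def dist_norm mult_left_le_one_le)
    also have "\<dots> < r" using y by (simp add: h_def dist_norm)
    finally have ez: "e z < m / 2" by (rule r(2))
    have "\<bar>hessian f z h h - hessian f x h h\<bar> =
        \<bar>(fst h)\<^sup>2 * (A z - A x) + fst h * snd h * (B z - B x) + (snd h)\<^sup>2 * (C z - C x)\<bar>"
      unfolding hess by (simp add: algebra_simps)
    also have "\<dots> \<le> (norm h)\<^sup>2 * e z" unfolding e_def by (rule quadratic_form_bound)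
    also have "\<dots> \<le> (norm h)\<^sup>2 * (m / 2)" using ez by (intro mult_left_mono) auto
    finally have diff: "\<bar>hessian f z h h - hessian f x h h\<bar> \<le> (norm h)\<^sup>2 * (m / 2)" .
    have up: "hessian f x h h \<le> (norm h)\<^sup>2 * S"
      using quadratic_form_bound[of h "A x" "B x" "C x"] unfolding hess S_def by linarith
    have f_up: "f y \<le> (S + m) * (norm h)\<^sup>2"
    proof -
      have "2 * f y \<le> (norm h)\<^sup>2 * S + (norm h)\<^sup>2 * (m / 2)"
        using diff up t(3) unfolding z_def by linarith
      also have "\<dots> \<le> 2 * ((S + m) * (norm h)\<^sup>2)"
        using m(1) by (simp add: S_def algebra_simps)
      finally show ?thesis by simp
    qed
    have f_lo: "(norm h)\<^sup>2 \<le> 4 / m * f y"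
    proof -
      have "m * (norm h)\<^sup>2 - (norm h)\<^sup>2 * (m / 2) \<le> 2 * f y"
        using diff m(2)[of h] t(3) unfolding z_def by linarith
      then show ?thesis using m(1) by (simp add: field_simps)
    qed
    have "(S + m) * (norm h)\<^sup>2 \<le> K * (norm h)\<^sup>2" "4 / m * f y \<le> K * f y"
      using nonneg[of y] unfolding K_def by (intro mult_right_mono max.cobounded1 max.cobounded2; simp)+
    then show "f y \<le> K * (norm (y - x))\<^sup>2" "(norm (y - x))\<^sup>2 \<le> K * f y"
      using f_up f_lo unfolding h_def by linarith+
  qed
  moreover have "K > 0" using m(1) by (simp add: K_def less_max_iff_disj)
  ultimately show ?thesis unfolding comparable_at_def by blast
qed

text \<open>Moves a comparison from the representative chosen by \<open>torus_rep\<close> to any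
  other one, and from the lattice to its translate over q.\<close>

lemma comparable_at_shift:
  fixes z :: "'a::real_normed_vector"
  assumes "comparable_at f g (x - z)"
  shows "comparable_at (\<lambda>y. f (y - z)) (\<lambda>y. g (y - z)) x"
proof -
  have "filterlim (\<lambda>y. y - z) (nhds (x - z)) (nhds x)"
    by (intro tendsto_intros filterlim_ident)
  then show ?thesis using assms unfolding comparable_at_def
    using eventually_compose_filterlim by blast
qed

lemma sq_dist_int_comparable:
  assumes "sq_dist_int x = 0"
  shows "comparable_at sq_dist_int (\<lambda>y. (norm (y - x))\<^sup>2) x"
proof -
  have i: "fst x \<in> \<int>" "snd x \<in> \<int>" using assms by (auto simp: sq_dist_int_eq_0_iff)
  have "sq_dist_int y = (norm (y - x))\<^sup>2" if y: "dist y x < 1/2" for y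
  proof -
    have n: "\<bar>fst (y - x)\<bar> \<le> 1/2" "\<bar>snd (y - x)\<bar> \<le> 1/2"
      using y norm_fst_le[of "fst (y - x)" "snd (y - x)"] norm_snd_le[of "snd (y - x)" "fst (y - x)"]
      unfolding dist_norm prod.collapse by (auto simp del: fst_diff snd_diff)
    have "dist_int (fst y) = \<bar>fst (y - x)\<bar>" "dist_int (snd y) = \<bar>snd (y - x)\<bar>"
      using dist_int_small[OF n(1)] dist_int_small[OF n(2)] i
        dist_int_eqI[of "fst y" "fst (y - x)"] dist_int_eqI[of "snd y" "snd (y - x)"] by auto
    then show ?thesis by (simp add: sq_dist_int_def norm_prod_def)
  qed
  then have "\<forall>\<^sub>F y in nhds x. sq_dist_int y \<le> 1 * (norm (y - x))\<^sup>2 \<and> (norm (y - x))\<^sup>2 \<le> 1 * sq_dist_int y"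
    unfolding eventually_nhds_metric by (intro exI[of _ "1/2"]) auto
  then show ?thesis unfolding comparable_at_def by (intro exI[of _ 1]) auto
qed

section \<open>Functions on the torus\<close>

lemma torus_proj_rep [simp]: "torus_proj (torus_rep t) = t"
  by (rule Quotient_abs_rep[OF Quotient_torus])

lemma torus_proj_surj_unit: "\<exists>x\<in>cbox (0, 0) (1, 1). t = torus_proj x"
proof -
  define r where "r = torus_rep t"
  have "torus_proj r = torus_proj (frac (fst r), frac (snd r))"
    unfolding torus_proj_eq_iff by (simp add: frac_def)
  then have "t = torus_proj (frac (fst r), frac (snd r))" by (simp add: r_def)
  moreover have "(frac (fst r), frac (snd r)) \<in> cbox (0, 0) (1, 1)"
    by (simp add: cbox_Pair_eq less_imp_le frac_lt_1)
  ultimately show ?thesis by blast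
qed

lemma continuous_on_torusI:
  fixes f :: "torus \<Rightarrow> 'b::topological_space"
  assumes "continuous_on UNIV (f \<circ> torus_proj)"
  shows "continuous_on UNIV f"
  unfolding continuous_on_open_vimage[OF open_UNIV]
proof (intro allI impI)
  fix B :: "'b set" assume "open B"
  then have "open ((f \<circ> torus_proj) -` B)"
    using assms by (metis Int_UNIV_right continuous_on_open_vimage open_UNIV)
  then show "open (f -` B \<inter> UNIV)" by (simp add: open_torus_def vimage_comp)
qed

lemma continuous_on_torus_lift:
  fixes f :: "torus \<Rightarrow> 'b::topological_space"
  assumes "continuous_on UNIV f"
  shows "continuous_on S (\<lambda>x. f (torus_proj x))"
  using continuous_on_compose2[OF assms continuous_torus_proj] continuous_on_subset by blast

lemma sq_dist_int_cong:
  "fst x - fst y \<in> \<int> \<Longrightarrow> snd x - snd y \<in> \<int> \<Longrightarrow> sq_dist_int x = sq_dist_int y"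
  unfolding sq_dist_int_def using dist_int_eqI by metis

text \<open>Substitution of the abscissa for the time, by differentiating the primitive of
  \<open>d\<close> along \<theta>. Monotonicity keeps \<theta> inside the interval where that
  primitive is differentiable.\<close>

lemma integral_time_change:
  fixes d :: "real \<Rightarrow> real"
  assumes d: "continuous_on UNIV d" and t: "t \<ge> 0"
    and \<theta>: "\<And>s. (\<theta> has_real_derivative \<theta>' s) (at s)" and mono: "mono \<theta>"
  shows "((\<lambda>s. d (\<theta> s) * \<theta>' s) has_integral integral {\<theta> 0..\<theta> t} d) {0..t}"
proof -
  let ?A = "\<lambda>S. integral {\<theta> 0..S} d"
  have "((\<lambda>s. d (\<theta> s) * \<theta>' s) has_integral (?A (\<theta> t) - ?A (\<theta> 0))) {0..t}"
  proof (rule fundamental_theorem_of_calculus[OF t])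
    fix s assume s: "s \<in> {0..t}"
    have "(?A has_real_derivative d (\<theta> s)) (at (\<theta> s) within {\<theta> 0..\<theta> t})"
      using s mono by (intro integral_has_real_derivative continuous_on_subset[OF d]) (auto simp: mono_def)
    then have "(?A has_real_derivative d (\<theta> s)) (at (\<theta> s) within \<theta> ` {0..t})"
      using mono by (rule_tac has_field_derivative_subset) (auto simp: mono_def)
    from DERIV_image_chain[OF this has_field_derivative_at_within[OF \<theta>]]
    show "((\<lambda>s. ?A (\<theta> s)) has_vector_derivative d (\<theta> s) * \<theta>' s) (at s within {0..t})"
      by (simp add: o_def has_real_derivative_iff_has_vector_derivative)
  qed
  then show ?thesis by simp
qed

locale stopped_linear_flow =
  fixes a b :: int and \<alpha> \<nu> :: real and p q :: torus and \<phi> :: "torus \<Rightarrow> real"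
    and \<Phi> :: "real \<Rightarrow> torus \<Rightarrow> torus"
  assumes b: "b \<ge> 2" and ab: "coprime a b" and \<nu>: "\<nu> > 0" and W: "\<alpha> \<in> W_set \<nu> b"
    and p: "p = torus_proj (0, 0)" and q: "q = torus_proj (0, real_of_int a / real_of_int b)"
    and smooth: "Ck_torus 2 \<phi>" and zero: "\<phi> p = 0" "\<phi> q = 0"
    and pos: "\<And>x. x \<noteq> p \<Longrightarrow> x \<noteq> q \<Longrightarrow> \<phi> x > 0"
    and hess: "hessian_pos_def_at \<phi> p" "hessian_pos_def_at \<phi> q"
    and flow: "generated_flow (\<lambda>x. \<phi> x *\<^sub>R (1, \<alpha>)) \<Phi>"
begin

definition q_rep :: "real \<times> real" where
  "q_rep = (0, real_of_int a / real_of_int b)"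

abbreviation F :: "real \<times> real \<Rightarrow> real" where
  "F x \<equiv> \<phi> (torus_proj x)"

lemma irr: "\<alpha> \<notin> \<rat>" using W by (simp add: W_set_def)

lemma dist_int_ab: "dist_int (of_int a / of_int b) \<ge> 1 / of_int b"
proof (rule dist_int_ge_fraction)
  show "\<not> b dvd a"
  proof
    assume "b dvd a"
    then have "is_unit b" using ab by (meson coprime_common_divisor dvd_refl)
    then show False using b by simp
  qed
qed (use b in auto)

lemma proj_eq_p: "torus_proj x = p \<longleftrightarrow> sq_dist_int x = 0"
  by (simp add: p torus_proj_eq_iff sq_dist_int_eq_0_iff)

lemma proj_eq_q: "torus_proj x = q \<longleftrightarrow> sq_dist_int (x - q_rep) = 0"
  by (simp add: q torus_proj_eq_iff sq_dist_int_eq_0_iff q_rep_def)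

lemma \<phi>_nonneg [simp]: "\<phi> x \<ge> 0"
  using pos[of x] zero by (cases "x = p \<or> x = q") auto

lemma \<phi>_eq_0_iff: "\<phi> x = 0 \<longleftrightarrow> x = p \<or> x = q"
  using pos[of x] zero by (metis less_irrefl)

text \<open>No point is close to both stopping points: the distances of its second coordinate to 0
  and to a/b mod 1 add up to at least 1/b, and (u + v)^2 \<le> 2 (u^2 + v^2).\<close>

lemma sum_lower: "sq_dist_int x + sq_dist_int (x - q_rep) \<ge> 1 / (2 * (of_int b)\<^sup>2)"
proof -
  define u v where "u = dist_int (snd x)" and "v = dist_int (snd x - of_int a / of_int b)"
  have "dist_int (of_int a / of_int b) \<le> u + v"
  proof -
    have "dist_int (of_int a / of_int b) \<le> \<bar>of_int a / of_int b - of_int (round (snd x) - round (snd x - of_int a / of_int b))\<bar>"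
      by (rule dist_int_le)
    also have "\<dots> \<le> u + v" unfolding u_def v_def dist_int_def of_int_diff by linarith
    finally show ?thesis .
  qed
  then have uv: "1 / of_int b \<le> u + v" using dist_int_ab by linarith
  have "(1 / of_int b)\<^sup>2 \<le> (u + v)\<^sup>2" using uv b by (intro power_mono) auto
  also have "\<dots> \<le> 2 * (u\<^sup>2 + v\<^sup>2)" using sum_squares_bound[of u v] by (simp add: power2_sum)
  also have "u\<^sup>2 + v\<^sup>2 \<le> sq_dist_int x + sq_dist_int (x - q_rep)"
    by (simp add: sq_dist_int_def q_rep_def u_def v_def)
  finally show ?thesis by (simp add: power_divide field_simps)
qed

lemma sum_pos: "sq_dist_int x + sq_dist_int (x - q_rep) > 0"
proof -
  have "0 < 1 / (2 * (real_of_int b)\<^sup>2)" using b by simp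
  then show ?thesis using sum_lower[of x] by linarith
qed

lemma continuous_\<phi>: "continuous_on UNIV \<phi>"
  using smooth unfolding Ck_torus_def by (intro continuous_on_torusI Ck_continuous)

lemma isCont_lift: "isCont F x"
  using continuous_on_torus_lift[OF continuous_\<phi>, of UNIV] continuous_on_eq_continuous_at[OF open_UNIV] by blast

lemma isCont_sq: "isCont sq_dist_int x" "isCont (\<lambda>y. sq_dist_int (y - q_rep)) x"
  using continuous_on_sq_dist_int[of UNIV "\<lambda>x. x"] continuous_on_sq_dist_int[of UNIV "\<lambda>x. x - q_rep"]
    continuous_on_eq_continuous_at[OF open_UNIV]
  by (force intro: continuous_intros)+

text \<open>The Hessian is known only at the representative \<open>r\<close>. The difference
  \<open>z\<close> is a lattice vector, so periodicity of the lift carries the comparison over to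
  \<open>x\<close>.\<close>

lemma F_comparable_at_zero:
  assumes "hessian_pos_def_at \<phi> (torus_proj x)" "F x = 0"
  shows "comparable_at F (\<lambda>y. (norm (y - x))\<^sup>2) x"
proof -
  define r where "r = torus_rep (torus_proj x)"
  define z where "z = x - r"
  have r: "torus_proj r = torus_proj x" by (simp add: r_def)
  have per: "F (y - z) = F y" for y
  proof -
    have "torus_proj (y - z) = torus_proj y"
      using r unfolding torus_proj_eq_iff z_def by (auto simp: algebra_simps intro: Ints_minus[of "_ - _", simplified])
    then show ?thesis by simp
  qed
  have "comparable_at F (\<lambda>y. (norm (y - r))\<^sup>2) r"
  proof (rule comparable_at_nondegenerate_min)
    show "Ck 2 F" using smooth by (simp add: Ck_torus_def comp_def)
    show "hessian F r v v > 0" if "v \<noteq> 0" for v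
      using assms(1) that unfolding hessian_pos_def_at_def r_def comp_def by blast
  qed (use assms(2) r in auto)
  then have "comparable_at F (\<lambda>y. (norm (y - r))\<^sup>2) (x - z)" by (simp add: z_def)
  then have "comparable_at (\<lambda>y. F (y - z)) (\<lambda>y. (norm ((y - z) - r))\<^sup>2) x"
    by (rule comparable_at_shift)
  then show ?thesis unfolding per by (simp add: z_def)
qed

text \<open>At a zero of one factor the other factor is comparable to 1, so there a single squared
  distance has to be matched. The unit square is compact and periodicity extends the constant to the
  plane.\<close>

lemma F_comparable:
  obtains C where "C > 0" "\<And>x. F x \<le> C * (sq_dist_int x * sq_dist_int (x - q_rep))"
    "\<And>x. sq_dist_int x * sq_dist_int (x - q_rep) \<le> C * F x"
proof -
  let ?E = "\<lambda>x. sq_dist_int x * sq_dist_int (x - q_rep)"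
  have loc: "comparable_at F ?E x" for x
  proof -
    consider "sq_dist_int x = 0" | "sq_dist_int (x - q_rep) = 0"
      | "sq_dist_int x \<noteq> 0" "sq_dist_int (x - q_rep) \<noteq> 0" by blast
    then show ?thesis
    proof cases
      case 1
      then have "torus_proj x = p" by (simp add: proj_eq_p)
      then have "comparable_at F (\<lambda>y. (norm (y - x))\<^sup>2) x"
        using hess zero by (intro F_comparable_at_zero) auto
      then have 2: "comparable_at F sq_dist_int x"
        using comparable_at_trans comparable_at_sym sq_dist_int_comparable[OF 1] by blast
      have "comparable_at (\<lambda>_. 1) (\<lambda>y. sq_dist_int (y - q_rep)) x"
        using 1 sum_pos[of x] isCont_sq by (intro comparable_at_pos) auto
      from comparable_at_mult[OF 2 this] show ?thesis by simp
    next
      case 2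
      then have "torus_proj x = q" by (simp add: proj_eq_q)
      then have "comparable_at F (\<lambda>y. (norm (y - x))\<^sup>2) x"
        using hess zero by (intro F_comparable_at_zero) auto
      moreover have "comparable_at (\<lambda>y. sq_dist_int (y - q_rep)) (\<lambda>y. (norm (y - x))\<^sup>2) x"
        using comparable_at_shift[OF sq_dist_int_comparable[OF 2]] by (simp add: algebra_simps)
      ultimately have 3: "comparable_at F (\<lambda>y. sq_dist_int (y - q_rep)) x"
        using comparable_at_trans comparable_at_sym by blast
      have "comparable_at (\<lambda>_. 1) sq_dist_int x"
        using 2 sum_pos[of x] isCont_sq by (intro comparable_at_pos) auto
      from comparable_at_mult[OF this 3] show ?thesis by simp
    next
      case 3
      then have "?E x > 0" by (intro mult_pos_pos) (auto simp: order_less_le)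
      moreover have "F x > 0" using 3 by (intro pos) (auto simp: proj_eq_p proj_eq_q)
      ultimately show ?thesis
        using isCont_sq isCont_lift by (intro comparable_at_pos isCont_mult) auto
    qed
  qed
  have "\<exists>C>0. \<forall>x\<in>cbox (0, 0) (1, 1). F x \<le> C * ?E x \<and> ?E x \<le> C * F x"
    using loc by (intro comparable_on_compact compact_cbox) auto
  then obtain C where C: "C > 0" "\<And>x. x \<in> cbox (0, 0) (1, 1) \<Longrightarrow> F x \<le> C * ?E x \<and> ?E x \<le> C * F x"
    by blast
  have "F x \<le> C * ?E x \<and> ?E x \<le> C * F x" for x
  proof -
    obtain x' where x': "x' \<in> cbox (0, 0) (1, 1)" "torus_proj x = torus_proj x'"
      using torus_proj_surj_unit[of "torus_proj x"] by blast
    then have "sq_dist_int x = sq_dist_int x'" "sq_dist_int (x - q_rep) = sq_dist_int (x' - q_rep)"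
      unfolding torus_proj_eq_iff by (auto intro!: sq_dist_int_cong)
    then show ?thesis using C(2)[OF x'(1)] x'(2) by simp
  qed
  then show thesis using that C(1) by blast
qed

text \<open>Any continuous function with values \<open>1\<close> at \<open>p\<close> and \<open>0\<close> at \<open>q\<close> would measure the time spent near
  \<open>p\<close>; for this one \<open>weight / \<phi>\<close> is comparable to \<open>1 / sq_dist_int\<close> on the whole torus.\<close>

definition weight :: "torus \<Rightarrow> real" where
  "weight t = sq_dist_int (torus_rep t - q_rep) /
     (sq_dist_int (torus_rep t) + sq_dist_int (torus_rep t - q_rep))"

lemma weight_proj: "weight (torus_proj x) = sq_dist_int (x - q_rep) / (sq_dist_int x + sq_dist_int (x - q_rep))"
proof -
  have "torus_proj (torus_rep (torus_proj x)) = torus_proj x" by simp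
  then have "sq_dist_int (torus_rep (torus_proj x)) = sq_dist_int x"
    "sq_dist_int (torus_rep (torus_proj x) - q_rep) = sq_dist_int (x - q_rep)"
    unfolding torus_proj_eq_iff by (auto intro!: sq_dist_int_cong)
  then show ?thesis by (simp add: weight_def)
qed

lemma weight_bounds: "0 \<le> weight t" "weight t \<le> 1"
  unfolding weight_def using sum_pos[of "torus_rep t"] by (auto simp: divide_le_eq_1)

lemma weight_p: "weight p = 1" and weight_q: "weight q = 0"
proof -
  have "sq_dist_int (0, 0) = 0" "sq_dist_int (q_rep - q_rep) = 0" by (simp_all add: sq_dist_int_eq_0_iff)
  then show "weight p = 1" "weight q = 0"
    using sum_pos[of "(0, 0)"] weight_proj[of "(0, 0)"] weight_proj[of q_rep] unfolding p q q_rep_def[symmetric] by auto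
qed

lemma continuous_weight: "continuous_on UNIV weight"
proof (rule continuous_on_torusI)
  have "continuous_on UNIV (\<lambda>x. sq_dist_int (x - q_rep) / (sq_dist_int x + sq_dist_int (x - q_rep)))"
    using sum_pos by (intro continuous_intros) (metis less_irrefl)
  then show "continuous_on UNIV (weight \<circ> torus_proj)" by (simp add: comp_def weight_proj)
qed

text \<open>Where |g| \<ge> \<epsilon> the speed has a positive minimum by compactness, so a
  multiple of \<phi> dominates |g| there. The time average of \<phi> is easy to control: it is
  displacement over time.\<close>

lemma abs_le_eps_plus_speed:
  assumes g: "continuous_on UNIV g" "g p = 0" "g q = 0" and \<epsilon>: "\<epsilon> > (0::real)"
  shows "\<exists>K\<ge>0. \<forall>t. \<bar>g t\<bar> \<le> \<epsilon> + K * \<phi> t"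
proof -
  let ?I = "cbox (0, 0) (1, 1) :: (real \<times> real) set"
  define Z where "Z = {x \<in> ?I. \<bar>g (torus_proj x)\<bar> \<ge> \<epsilon>}"
  have cont: "continuous_on S (\<lambda>x. \<bar>g (torus_proj x)\<bar>)" for S
    by (intro continuous_intros continuous_on_torus_lift g)
  have "closed {x. \<epsilon> \<le> \<bar>g (torus_proj x)\<bar>}"
    by (intro closed_Collect_le continuous_on_const cont)
  then have Z: "compact Z"
    using compact_Int_closed[OF compact_cbox, of "{x. \<epsilon> \<le> \<bar>g (torus_proj x)\<bar>}" "(0, 0)" "(1, 1)"]
    by (simp only: Z_def Int_def mem_Collect_eq)
  have "bounded ((\<lambda>x. \<bar>g (torus_proj x)\<bar>) ` ?I)"
    by (intro compact_imp_bounded compact_continuous_image cont compact_cbox)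
  then obtain B where B: "B > 0" "\<And>x. x \<in> ?I \<Longrightarrow> \<bar>g (torus_proj x)\<bar> \<le> B"
    unfolding bounded_pos by auto
  have Fpos: "F x > 0" if "x \<in> Z" for x
    using that g \<epsilon> by (intro pos) (auto simp: Z_def)
  have "\<exists>m>0. \<forall>x\<in>Z. F x \<ge> m"
  proof (cases "Z = {}")
    case False
    then obtain x where "x \<in> Z" "\<forall>y\<in>Z. F x \<le> F y"
      using continuous_attains_inf[OF Z False, of F] continuous_on_torus_lift[OF continuous_\<phi>] by blast
    then show ?thesis using Fpos by blast
  qed (auto intro: exI[of _ 1])
  then obtain m where m: "m > 0" "\<And>x. x \<in> Z \<Longrightarrow> F x \<ge> m" by blast
  have "\<bar>g t\<bar> \<le> \<epsilon> + B / m * \<phi> t" for t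
  proof -
    obtain x where x: "x \<in> ?I" "t = torus_proj x" using torus_proj_surj_unit by blast
    show ?thesis
    proof (cases "x \<in> Z")
      case True
      then have "B / m * m \<le> B / m * \<phi> t" using m(2)[OF True] B m x by (intro mult_left_mono) auto
      then show ?thesis using B(2)[OF x(1)] x(2) m(1) \<epsilon> by simp
    next
      case False
      have "0 \<le> B / m * \<phi> t" using B m by simp
      then show ?thesis using False x by (simp add: Z_def)
    qed
  qed
  then show ?thesis using B m by (intro exI[of _ "B / m"]) auto
qed

end

section \<open>Occupation times along an orbit\<close>

context stopped_linear_flow
begin

text \<open>The conditions at \<open>y - a / b\<close> express the same properties with q in the
  role of p.\<close>

definition good :: "real \<Rightarrow> bool" where
  "good y \<longleftrightarrow> avoids_lattice \<alpha> y \<and> avoids_lattice \<alpha> (y - of_int a / of_int b) \<and>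
     near_hits \<alpha> \<nu> b y \<and> near_hits \<alpha> \<nu> b (y - of_int a / of_int b)"

text \<open>Along any lift, the second coordinate minus \<alpha> times the first has derivative 0,
  so the lift stays on a line. It may start at another representative of \<open>x\<close>; \<theta>
  is its abscissa corrected by that integer difference.\<close>

lemma orbit_lift:
  assumes x: "x = torus_proj (x1, y + \<alpha> * x1)"
  obtains \<theta> where "\<theta> 0 = x1" "\<And>t. \<Phi> t x = torus_proj (\<theta> t, y + \<alpha> * \<theta> t)"
    "\<And>t. (\<theta> has_real_derivative F (\<theta> t, y + \<alpha> * \<theta> t)) (at t)"
proof -
  have fl: "\<Phi> 0 x = x" "torus_integral_curve (\<lambda>x. \<phi> x *\<^sub>R (1, \<alpha>)) (\<lambda>t. \<Phi> t x)"
    using flow by (auto simp: generated_flow_def)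
  then obtain c where c: "\<And>t. \<Phi> t x = torus_proj (c t)"
      "\<And>t. (c has_vector_derivative \<phi> (\<Phi> t x) *\<^sub>R (1, \<alpha>)) (at t)"
    unfolding torus_integral_curve_def by blast
  have d1: "((\<lambda>t. fst (c t)) has_real_derivative \<phi> (\<Phi> t x)) (at t)"
    and d2: "((\<lambda>t. snd (c t)) has_real_derivative \<phi> (\<Phi> t x) * \<alpha>) (at t)" for t
    using bounded_linear.has_vector_derivative[OF bounded_linear_fst c(2)[of t]]
      bounded_linear.has_vector_derivative[OF bounded_linear_snd c(2)[of t]]
    by (simp_all add: has_real_derivative_iff_has_vector_derivative)
  have "((\<lambda>t. snd (c t) - \<alpha> * fst (c t)) has_real_derivative 0) (at t)" for t
    using DERIV_diff[OF d2[of t] DERIV_cmult[OF d1[of t], of \<alpha>]] by (simp add: mult.commute)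
  then have const: "snd (c t) - \<alpha> * fst (c t) = snd (c 0) - \<alpha> * fst (c 0)" for t
    using DERIV_isconst_all by blast
  define \<theta> where "\<theta> t = fst (c t) + (x1 - fst (c 0))" for t
  have "torus_proj (c 0) = torus_proj (x1, y + \<alpha> * x1)" using c(1)[of 0] fl(1) x by simp
  then have int: "fst (c 0) - x1 \<in> \<int>" "snd (c 0) - (y + \<alpha> * x1) \<in> \<int>"
    unfolding torus_proj_eq_iff by auto
  have eq: "\<Phi> t x = torus_proj (\<theta> t, y + \<alpha> * \<theta> t)" for t
  proof -
    have f: "fst (c t) - \<theta> t = fst (c 0) - x1" by (simp add: \<theta>_def)
    have s: "snd (c t) - (y + \<alpha> * \<theta> t) = snd (c 0) - (y + \<alpha> * x1)"
      using const[of t] by (simp add: \<theta>_def algebra_simps)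
    show ?thesis unfolding c(1) torus_proj_eq_iff fst_conv snd_conv f s using int by simp
  qed
  show thesis
  proof (rule that)
    show "\<theta> 0 = x1" by (simp add: \<theta>_def)
    show "(\<theta> has_real_derivative F (\<theta> t, y + \<alpha> * \<theta> t)) (at t)" for t
    proof -
      have "(\<theta> has_real_derivative \<phi> (\<Phi> t x)) (at t)"
        unfolding \<theta>_def[abs_def] using DERIV_add[OF d1[of t] DERIV_const] by simp
      then show ?thesis unfolding eq .
    qed
  qed (rule eq)
qed

end

text \<open>Starting in [0, 1] places the orbit before the windows around 2, 3, ... and after -1/2,
  as the bounds on line integrals require.\<close>

locale stopped_linear_orbit = stopped_linear_flow +
  fixes x :: torus and x1 y :: real and \<theta> :: "real \<Rightarrow> real"
  assumes x1: "x1 \<in> {0..1}" and good: "good y"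
    and \<theta>0: "\<theta> 0 = x1" and orbit: "\<And>t. \<Phi> t x = torus_proj (\<theta> t, y + \<alpha> * \<theta> t)"
    and \<theta>': "\<And>t. (\<theta> has_real_derivative F (\<theta> t, y + \<alpha> * \<theta> t)) (at t)"
begin

abbreviation pt :: "real \<Rightarrow> real \<times> real" where
  "pt s \<equiv> (s, y + \<alpha> * s)"

lemma avoid: "avoids_lattice \<alpha> y" "avoids_lattice \<alpha> (y - of_int a / of_int b)"
  using good by (auto simp: good_def)

lemma pt_shift: "pt s - q_rep = (s, y - of_int a / of_int b + \<alpha> * s)"
  by (simp add: q_rep_def)

lemma sq_pos: "sq_dist_int (pt s) > 0" "sq_dist_int (pt s - q_rep) > 0"
  using sq_dist_int_line_pos[OF avoid(1)] sq_dist_int_line_pos[OF avoid(2)] unfolding pt_shift by auto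

lemma F_pos: "F (pt s) > 0"
  using sq_pos[of s] by (intro pos) (auto simp: proj_eq_p proj_eq_q simp del: diff_Pair)

lemma strict_mono_\<theta>: "strict_mono \<theta>"
  by (rule strict_monoI, rule DERIV_pos_imp_increasing) (use \<theta>' F_pos in blast)+

lemma mono_\<theta>: "mono \<theta>"
  using strict_mono_\<theta> by (rule strict_mono_mono)

lemma continuous_\<theta>: "continuous_on S \<theta>"
  using \<theta>' by (meson DERIV_continuous continuous_at_imp_continuous_on)

lemma continuous_on_pt: "continuous_on S (\<lambda>s. F (pt s))"
  by (rule continuous_on_compose2[OF continuous_on_torus_lift[OF continuous_\<phi>, of UNIV]])
    (auto intro!: continuous_intros)

text \<open>If \<theta> stayed below S, the speed would have a positive minimum m on the compact
  piece of line from x1 to S, and S would be reached by time (S - x1) / m.\<close>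

lemma \<theta>_unbounded: "\<exists>t\<ge>0. \<theta> t \<ge> S"
proof (rule ccontr)
  assume "\<not> (\<exists>t\<ge>0. \<theta> t \<ge> S)"
  then have less: "\<theta> t < S" if "t \<ge> 0" for t using that by force
  then have "x1 < S" using \<theta>0 by force
  then obtain s where s: "\<forall>u\<in>{x1..S}. F (pt s) \<le> F (pt u)"
    using continuous_attains_inf[of "{x1..S}" "\<lambda>s. F (pt s)"] continuous_on_pt by auto
  define m where "m = F (pt s)"
  have m: "m > 0" using F_pos by (simp add: m_def)
  define t where "t = (S - x1) / m"
  have t: "t > 0" using \<open>x1 < S\<close> m by (simp add: t_def)
  obtain u where u: "0 < u" "u < t" "\<theta> t - \<theta> 0 = (t - 0) * F (pt (\<theta> u))"
    using MVT2[OF t, of \<theta> "\<lambda>u. F (pt (\<theta> u))"] \<theta>' by blast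
  have "\<theta> u \<in> {x1..S}"
    using less[of u] monoD[OF mono_\<theta>, of 0 u] u \<theta>0 by auto
  then have "m \<le> F (pt (\<theta> u))" using s by (simp add: m_def)
  then have "t * m \<le> \<theta> t - x1" using u t \<theta>0 by simp
  then show False using less[of t] t m by (simp add: t_def)
qed

lemma \<theta>_surj: "S \<ge> x1 \<Longrightarrow> \<exists>t\<ge>0. \<theta> t = S"
proof -
  assume S: "S \<ge> x1"
  obtain T where T: "T \<ge> 0" "\<theta> T \<ge> S" using \<theta>_unbounded by blast
  then show ?thesis using IVT'[of \<theta> 0 S T] S \<theta>0 continuous_\<theta> by auto
qed

text \<open>Its quotient by t is asymptotically the mass that the empirical measure puts near p; the
  remainder sits near q.\<close>

definition occupation :: "real \<Rightarrow> real" where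
  "occupation t = integral {0..t} (\<lambda>s. weight (\<Phi> s x))"

lemma continuous_along:
  fixes g :: "torus \<Rightarrow> real"
  assumes "continuous_on UNIV g"
  shows "continuous_on S (\<lambda>s. g (\<Phi> s x))"
  unfolding orbit
  by (rule continuous_on_compose2[OF continuous_on_torus_lift[OF assms, of UNIV], of S "\<lambda>s. pt (\<theta> s)"])
    (auto intro!: continuous_intros continuous_\<theta>)

lemma integrable_along:
  fixes g :: "torus \<Rightarrow> real"
  shows "continuous_on UNIV g \<Longrightarrow> (\<lambda>s. g (\<Phi> s x)) integrable_on {c..d}"
  by (intro integrable_continuous_interval continuous_along)

lemma occupation_bounds: "t \<ge> 0 \<Longrightarrow> 0 \<le> occupation t" "t \<ge> 0 \<Longrightarrow> occupation t \<le> t"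
proof -
  assume t: "t \<ge> 0"
  show "0 \<le> occupation t" unfolding occupation_def
    by (intro integral_nonneg integrable_along continuous_weight) (auto simp: weight_bounds)
  have "occupation t \<le> integral {0..t} (\<lambda>s. 1)" unfolding occupation_def
    by (intro integral_le integrable_along continuous_weight) (auto simp: weight_bounds)
  then show "occupation t \<le> t" using t by simp
qed

lemma has_integral_occupation_complement: "t \<ge> 0 \<Longrightarrow> ((\<lambda>s. 1 - weight (\<Phi> s x)) has_integral (t - occupation t)) {0..t}"
  using has_integral_diff[OF has_integral_const_real[of 1 0 t]
      integrable_integral[OF integrable_along[OF continuous_weight]]]
  by (simp add: occupation_def)

text \<open>After the time change each line integral is a time integral of F over one squared
  distance, which is comparable pointwise with \<open>weight\<close> or with its complement. One
  constant serves all four bounds.\<close>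

lemma occupation_comparable:
  obtains C where "C > 0"
    "\<And>t. t \<ge> 0 \<Longrightarrow> integral {x1..\<theta> t} (line_density \<alpha> y) \<le> C * occupation t"
    "\<And>t. t \<ge> 0 \<Longrightarrow> occupation t \<le> C * integral {x1..\<theta> t} (line_density \<alpha> y)"
    "\<And>t. t \<ge> 0 \<Longrightarrow> integral {x1..\<theta> t} (line_density \<alpha> (y - of_int a / of_int b)) \<le> C * (t - occupation t)"
    "\<And>t. t \<ge> 0 \<Longrightarrow> t - occupation t \<le> C * integral {x1..\<theta> t} (line_density \<alpha> (y - of_int a / of_int b))"
proof -
  obtain B where B: "B > 0" "\<And>x. F x \<le> B * (sq_dist_int x * sq_dist_int (x - q_rep))"
    "\<And>x. sq_dist_int x * sq_dist_int (x - q_rep) \<le> B * F x"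
    using F_comparable by blast
  define \<kappa> where "\<kappa> = 2 * (real_of_int b)\<^sup>2"
  have \<kappa>: "\<kappa> \<ge> 1"
  proof -
    have "1\<^sup>2 \<le> (real_of_int b)\<^sup>2" using b by (intro power_mono) auto
    then show ?thesis by (simp add: \<kappa>_def)
  qed
  define C where "C = B * \<kappa>"
  have C: "C > 0" using B \<kappa> by (simp add: C_def)
  \<comment> \<open>Stated for abstract u and v so that exchanging them yields the estimate for
    q.\<close>
  have ineq: "F z / u \<le> C * (v / (u + v)) \<and> v / (u + v) \<le> C * (F z / u)"
    if "u > 0" "v > 0" "u + v \<le> 1" "1 \<le> \<kappa> * (u + v)" "F z \<le> B * (u * v)" "u * v \<le> B * F z" for u v z
  proof
    have "F z / u \<le> B * v" using that by (simp add: divide_le_eq mult_ac)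
    also have "\<dots> \<le> B * (v / (u + v))"
      using that B by (intro mult_left_mono) (auto simp: le_divide_eq mult_left_le)
    also have "\<dots> \<le> C * (v / (u + v))"
      using that B \<kappa> by (intro mult_right_mono) (auto simp: C_def)
    finally show "F z / u \<le> C * (v / (u + v))" .
    have "v / (u + v) \<le> \<kappa> * v"
      using that mult_left_mono[of 1 "\<kappa> * (u + v)" v] by (simp add: divide_le_eq mult_ac)
    also have "\<kappa> * v \<le> \<kappa> * (B * (F z / u))"
      using that \<kappa> by (intro mult_left_mono) (auto simp: le_divide_eq mult_ac)
    finally show "v / (u + v) \<le> C * (F z / u)" by (simp add: C_def mult_ac)
  qed
  have pq: "F (pt s) / sq_dist_int (pt s) \<le> C * weight (torus_proj (pt s)) \<and>
      weight (torus_proj (pt s)) \<le> C * (F (pt s) / sq_dist_int (pt s)) \<and>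
      F (pt s) / sq_dist_int (pt s - q_rep) \<le> C * (1 - weight (torus_proj (pt s))) \<and>
      1 - weight (torus_proj (pt s)) \<le> C * (F (pt s) / sq_dist_int (pt s - q_rep))" for s
  proof -
    define u v where "u = sq_dist_int (pt s)" and "v = sq_dist_int (pt s - q_rep)"
    have uv: "u > 0" "v > 0" using sq_pos[of s] by (simp_all only: u_def v_def)
    have le1: "u + v \<le> 1" using sq_dist_int_le[of "pt s"] sq_dist_int_le[of "pt s - q_rep"]
      unfolding u_def v_def by linarith
    have "1 / \<kappa> \<le> u + v" using sum_lower[of "pt s"] by (simp only: u_def v_def \<kappa>_def)
    then have ge1: "1 \<le> \<kappa> * (u + v)" using \<kappa> by (simp add: divide_le_eq mult.commute)
    have FB: "F (pt s) \<le> B * (u * v)" "u * v \<le> B * F (pt s)"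
      using B(2,3)[of "pt s"] by (simp_all only: u_def v_def)
    have h: "weight (torus_proj (pt s)) = v / (u + v)" using weight_proj[of "pt s"] by (simp only: u_def v_def)
    have h': "1 - weight (torus_proj (pt s)) = u / (v + u)" unfolding h using uv by (simp add: field_simps)
    show ?thesis
      unfolding h' unfolding h u_def[symmetric] v_def[symmetric]
      using ineq[OF uv le1 ge1 FB] ineq[OF uv(2,1), of "pt s"] le1 ge1 FB by (simp add: add.commute mult.commute)
  qed
  have I: "((\<lambda>s. F (pt (\<theta> s)) / sq_dist_int (pt (\<theta> s))) has_integral
      integral {x1..\<theta> t} (line_density \<alpha> y)) {0..t}"
    "((\<lambda>s. F (pt (\<theta> s)) / sq_dist_int (pt (\<theta> s) - q_rep)) has_integral
      integral {x1..\<theta> t} (line_density \<alpha> (y - of_int a / of_int b))) {0..t}"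
    if "t \<ge> 0" for t
    using integral_time_change[OF continuous_on_line_density[OF avoid(1)] that \<theta>' mono_\<theta>]
      integral_time_change[OF continuous_on_line_density[OF avoid(2)] that \<theta>' mono_\<theta>]
    unfolding pt_shift by (simp_all add: line_density_def \<theta>0)
  have Ip: "((\<lambda>s. weight (\<Phi> s x)) has_integral occupation t) {0..t}" for t
    unfolding occupation_def by (intro integrable_integral integrable_along continuous_weight)
  show thesis
  proof (rule that[OF C])
    fix t :: real assume t: "t \<ge> 0"
    show "integral {x1..\<theta> t} (line_density \<alpha> y) \<le> C * occupation t"
      by (rule has_integral_le[OF I(1)[OF t] has_integral_mult_right[OF Ip]]) (use pq in \<open>simp add: orbit\<close>)
    show "occupation t \<le> C * integral {x1..\<theta> t} (line_density \<alpha> y)"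
      by (rule has_integral_le[OF Ip has_integral_mult_right[OF I(1)[OF t]]]) (use pq in \<open>simp add: orbit\<close>)
    show "integral {x1..\<theta> t} (line_density \<alpha> (y - of_int a / of_int b)) \<le> C * (t - occupation t)"
      by (rule has_integral_le[OF I(2)[OF t] has_integral_mult_right[OF has_integral_occupation_complement[OF t]]])
        (use pq in \<open>simp only: orbit\<close>)
    show "t - occupation t \<le> C * integral {x1..\<theta> t} (line_density \<alpha> (y - of_int a / of_int b))"
      by (rule has_integral_le[OF has_integral_occupation_complement[OF t] has_integral_mult_right[OF I(2)[OF t]]])
        (use pq in \<open>simp only: orbit\<close>)
  qed
qed

text \<open>The line integral grows superlinearly in \<theta> t, but it is at most C times the
  occupation time and hence at most C t.\<close>

lemma \<theta>_sublinear: "\<epsilon> > 0 \<Longrightarrow> \<exists>T>0. \<forall>t\<ge>T. \<theta> t \<le> \<epsilon> * t"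
proof -
  assume \<epsilon>: "\<epsilon> > 0"
  obtain C where C: "C > 0" "\<And>t. t \<ge> 0 \<Longrightarrow> integral {x1..\<theta> t} (line_density \<alpha> y) \<le> C * occupation t"
    using occupation_comparable by metis
  obtain S0 where S0: "\<And>S. S \<ge> S0 \<Longrightarrow> integral {x1..S} (line_density \<alpha> y) \<ge> C / \<epsilon> * S"
    using integral_line_superlinear[OF W \<nu> avoid(1), of x1 "C / \<epsilon>"] x1 by auto
  obtain T where T: "T \<ge> 0" "\<theta> T \<ge> S0" using \<theta>_unbounded by blast
  have "\<theta> t \<le> \<epsilon> * t" if t: "t \<ge> T + 1" for t
  proof -
    have "\<theta> t \<ge> S0" using T monoD[OF mono_\<theta>, of T t] t by simp
    then have "C / \<epsilon> * \<theta> t \<le> C * occupation t" using S0 C(2)[of t] t T by fastforce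
    also have "\<dots> \<le> C * t" using occupation_bounds(2)[of t] t T C(1) by (intro mult_left_mono) auto
    finally show ?thesis using C(1) \<epsilon> by (simp add: field_simps)
  qed
  then show ?thesis using T by (intro exI[of _ "T + 1"]) auto
qed

lemma occupation_frequently_large: "\<epsilon> > 0 \<Longrightarrow> \<exists>t\<ge>T. t > 0 \<and> t - occupation t \<le> \<epsilon> * t"
  and occupation_frequently_small: "\<epsilon> > 0 \<Longrightarrow> \<exists>t\<ge>T. t > 0 \<and> occupation t \<le> \<epsilon> * t"
proof -
  assume \<epsilon>: "\<epsilon> > 0"
  obtain C where C: "C > 0"
    "\<And>t. t \<ge> 0 \<Longrightarrow> integral {x1..\<theta> t} (line_density \<alpha> y) \<le> C * occupation t"
    "\<And>t. t \<ge> 0 \<Longrightarrow> occupation t \<le> C * integral {x1..\<theta> t} (line_density \<alpha> y)"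
    "\<And>t. t \<ge> 0 \<Longrightarrow> integral {x1..\<theta> t} (line_density \<alpha> (y - of_int a / of_int b)) \<le> C * (t - occupation t)"
    "\<And>t. t \<ge> 0 \<Longrightarrow> t - occupation t \<le> C * integral {x1..\<theta> t} (line_density \<alpha> (y - of_int a / of_int b))"
    using occupation_comparable by metis
  define K where "K = C * C / \<epsilon>"
  have K: "K \<ge> 0" using C(1) \<epsilon> by (simp add: K_def)
  \<comment> \<open>With K = C^2/\<epsilon>, domination of the line integrals by the factor K
    survives the two losses of C and leaves Y \<le> \<epsilon> t.\<close>
  have bound: "Y \<le> \<epsilon> * t"
    if "K * J \<le> I" "I \<le> C * X" "Y \<le> C * J" "X \<le> t" for I J X Y t
  proof -
    have "C / \<epsilon> * Y \<le> C / \<epsilon> * (C * J)" using that C(1) \<epsilon> by (intro mult_left_mono) auto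
    also have "\<dots> = K * J" by (simp add: K_def)
    also have "\<dots> \<le> C * t"
      using that mult_left_mono[of X t C] C(1) by linarith
    finally show ?thesis using C(1) \<epsilon> by (simp add: field_simps)
  qed
  define S0 where "S0 = \<theta> (max T 1)"
  have time: "t \<ge> T \<and> t > 0" if "\<theta> t \<ge> S0" for t
  proof -
    have "t \<ge> max T 1" using that strict_mono_less_eq[OF strict_mono_\<theta>] by (simp add: S0_def)
    then show ?thesis by simp
  qed
  have S0: "S0 \<ge> x1" using monoD[OF mono_\<theta>, of 0 "max T 1"] \<theta>0 by (simp add: S0_def)
  show "\<exists>t\<ge>T. t > 0 \<and> t - occupation t \<le> \<epsilon> * t"
  proof -
    obtain S where S: "S \<ge> S0" "integral {x1..S} (line_density \<alpha> y) \<ge>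
        K * integral {x1..S} (line_density \<alpha> (y - of_int a / of_int b))"
      using integral_line_dominates[OF irr \<nu> b ab K _ x1 avoid, of S0] good by (auto simp: good_def)
    obtain t where t: "t \<ge> 0" "\<theta> t = S" using \<theta>_surj[of S] S S0 by auto
    have "t - occupation t \<le> \<epsilon> * t"
      using bound[OF S(2)[folded t(2)] C(2)[OF t(1)] C(5)[OF t(1)] occupation_bounds(2)[OF t(1)]] .
    then show ?thesis using time[of t] t S by auto
  qed
  show "\<exists>t\<ge>T. t > 0 \<and> occupation t \<le> \<epsilon> * t"
  proof -
    \<comment> \<open>The roles of p and q are exchanged by taking the intercept y - a/b and
      replacing a by -a, which leads back to y.\<close>
    have ab': "coprime (- a) b" using ab by simp
    have eq: "(y - of_int a / of_int b) - of_int (- a) / of_int b = y" by simp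
    obtain S where S: "S \<ge> S0" "integral {x1..S} (line_density \<alpha> (y - of_int a / of_int b)) \<ge>
        K * integral {x1..S} (line_density \<alpha> y)"
      using integral_line_dominates[OF irr \<nu> b ab' K _ x1 avoid(2), of S0] good avoid(1)
      unfolding eq by (auto simp: good_def)
    obtain t where t: "t \<ge> 0" "\<theta> t = S" using \<theta>_surj[of S] S S0 by auto
    have "t - occupation t \<le> t" using occupation_bounds(1)[OF t(1)] by simp
    then have "occupation t \<le> \<epsilon> * t"
      by (rule bound[OF S(2)[folded t(2)] C(4)[OF t(1)] C(3)[OF t(1)]])
    then show ?thesis using time[of t] t S by auto
  qed
qed

text \<open>The quotient is continuous and passes from at most \<epsilon> to at least 1 -
  \<epsilon>, so it attains s in between unless s lies within \<epsilon> of one of these extreme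
  values.\<close>

lemma occupation_intermediate:
  assumes s: "0 \<le> s" "s \<le> 1" and \<epsilon>: "\<epsilon> > 0"
  shows "\<exists>t\<ge>T. t > 0 \<and> \<bar>occupation t / t - s\<bar> \<le> \<epsilon>"
proof -
  obtain t1 where t1: "t1 \<ge> T" "t1 > 0" "occupation t1 \<le> \<epsilon> * t1" using occupation_frequently_small[OF \<epsilon>] by blast
  obtain t2 where t2: "t2 \<ge> t1" "t2 > 0" "t2 - occupation t2 \<le> \<epsilon> * t2" using occupation_frequently_large[OF \<epsilon>] by blast
  have r1: "occupation t1 / t1 \<le> \<epsilon>" using t1 by (simp add: divide_le_eq)
  have r2: "1 - \<epsilon> \<le> occupation t2 / t2" using t2 by (simp add: le_divide_eq algebra_simps)
  have r: "0 \<le> occupation t1 / t1" "occupation t2 / t2 \<le> 1" using occupation_bounds t1 t2 by auto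
  consider "s \<le> occupation t1 / t1" | "s \<ge> occupation t2 / t2" | "occupation t1 / t1 \<le> s" "s \<le> occupation t2 / t2" by linarith
  then show ?thesis
  proof cases
    case 1
    then show ?thesis using r1 r s t1 by (intro exI[of _ t1]) auto
  next
    case 2
    then show ?thesis using r2 r s t1 t2 by (intro exI[of _ t2]) auto
  next
    case 3
    have "continuous_on {0..t2} occupation"
      unfolding occupation_def by (intro indefinite_integral_continuous_1 integrable_along continuous_weight)
    then have "continuous_on {t1..t2} occupation" using t1 by (auto intro: continuous_on_subset)
    then have "continuous_on {t1..t2} (\<lambda>t. occupation t / t)"
      using t1 by (intro continuous_intros) auto
    then obtain t where "t1 \<le> t" "t \<le> t2" "occupation t / t = s" using IVT'[OF 3 t2(1)] by blast
    then show ?thesis using t1 \<epsilon> by (intro exI[of _ t]) auto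
  qed
qed

lemma average_tendsto_zero:
  assumes g: "continuous_on UNIV g" "g p = 0" "g q = 0"
  shows "((\<lambda>t. (1 / t) * integral {0..t} (\<lambda>s. g (\<Phi> s x))) \<longlongrightarrow> (0::real)) at_top"
proof (rule tendstoI)
  fix e :: real assume e: "e > 0"
  obtain K where K: "K \<ge> 0" "\<And>t. \<bar>g t\<bar> \<le> e / 3 + K * \<phi> t"
    using abs_le_eps_plus_speed[OF g, of "e / 3"] e by auto
  \<comment> \<open>K + 1 in place of K keeps the denominator positive when K = 0.\<close>
  obtain T where T: "T > 0" "\<And>t. t \<ge> T \<Longrightarrow> \<theta> t \<le> e / (3 * (K + 1)) * t"
    using \<theta>_sublinear[of "e / (3 * (K + 1))"] e K by auto
  have "dist ((1 / t) * integral {0..t} (\<lambda>s. g (\<Phi> s x))) 0 < e" if t: "t \<ge> T" for t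
  proof -
    have t0: "t > 0" using t T by simp
    have speed: "((\<lambda>s. \<phi> (\<Phi> s x)) has_integral (\<theta> t - \<theta> 0)) {0..t}"
      using t0 \<theta>' unfolding orbit
      by (intro fundamental_theorem_of_calculus)
        (auto simp: has_real_derivative_iff_has_vector_derivative intro: has_vector_derivative_at_within)
    have int: "((\<lambda>s. e / 3 + K * \<phi> (\<Phi> s x)) has_integral (e / 3 * t + K * (\<theta> t - \<theta> 0))) {0..t}"
      using has_integral_add[OF has_integral_const_real[of "e / 3" 0 t] has_integral_mult_right[OF speed, of K]] t0
      by (simp add: mult.commute)
    have "\<bar>integral {0..t} (\<lambda>s. g (\<Phi> s x))\<bar> \<le> integral {0..t} (\<lambda>s. e / 3 + K * \<phi> (\<Phi> s x))"
      using integral_norm_bound_integral[OF integrable_along[OF g(1)] has_integral_integrable[OF int]] K(2)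
      by auto
    also have "\<dots> = e / 3 * t + K * (\<theta> t - \<theta> 0)" using int by (rule integral_unique)
    also have "\<dots> \<le> e / 3 * t + K * \<theta> t"
      using K x1 \<theta>0 by (intro add_left_mono mult_left_mono) auto
    also have "K * \<theta> t \<le> K * (e / (3 * (K + 1)) * t)" using T(2)[OF t] K by (intro mult_left_mono)
    also have "K * (e / (3 * (K + 1)) * t) = (K / (K + 1)) * (e / 3 * t)"
      by simp
    also have "\<dots> \<le> 1 * (e / 3 * t)" using K e t0 by (intro mult_right_mono) auto
    finally have "\<bar>integral {0..t} (\<lambda>s. g (\<Phi> s x))\<bar> \<le> 2 / 3 * (e * t)" by simp
    also have "\<dots> < e * t" using e t0 by simp
    finally show ?thesis using t0 by (simp add: dist_real_def abs_mult pos_divide_less_eq)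
  qed
  then show "\<forall>\<^sub>F t in at_top. dist ((1 / t) * integral {0..t} (\<lambda>s. g (\<Phi> s x))) 0 < e"
    unfolding eventually_at_top_linorder by blast
qed

lemma average_difference_tendsto_zero:
  assumes f: "continuous_on UNIV f"
  shows "((\<lambda>t. (1 / t) * integral {0..t} (\<lambda>s. f (\<Phi> s x)) -
    (occupation t / t * f p + (1 - occupation t / t) * f q)) \<longlongrightarrow> (0::real)) at_top"
proof (rule Lim_transform_eventually)
  \<comment> \<open>Subtracting the interpolation of f by \<open>weight\<close> leaves a function
    that vanishes at both p and q, to which \<open>average_tendsto_zero\<close> applies.\<close>
  define g where "g z = f z - (f q + (f p - f q) * weight z)" for z
  have g: "continuous_on UNIV g" unfolding g_def by (intro continuous_intros f continuous_weight)
  show "((\<lambda>t. (1 / t) * integral {0..t} (\<lambda>s. g (\<Phi> s x))) \<longlongrightarrow> 0) at_top"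
    by (rule average_tendsto_zero[OF g]) (simp_all add: g_def weight_p weight_q)
  show "\<forall>\<^sub>F t in at_top. (1 / t) * integral {0..t} (\<lambda>s. g (\<Phi> s x)) =
      (1 / t) * integral {0..t} (\<lambda>s. f (\<Phi> s x)) - (occupation t / t * f p + (1 - occupation t / t) * f q)"
    using eventually_gt_at_top[of 0]
  proof eventually_elim
    case (elim t)
    have "((\<lambda>s. g (\<Phi> s x)) has_integral
        (integral {0..t} (\<lambda>s. f (\<Phi> s x)) - (t * f q + (f p - f q) * occupation t))) {0..t}"
      unfolding g_def occupation_def using has_integral_const_real[of "f q" 0 t] elim
      by (intro has_integral_diff has_integral_add has_integral_mult_right integrable_integral
          integrable_along f continuous_weight) simp
    then show ?case using elim by (simp add: integral_unique field_simps)
  qed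
qed

end

section \<open>Weak-* limits\<close>

lemma topspace_weak_star: "topspace weak_star = borel_probs"
proof -
  have "borel_probs \<in> {{\<mu> \<in> borel_probs. (\<integral>x. f x \<partial>\<mu>) \<in> U} | (f :: torus \<Rightarrow> real) U.
        continuous_on UNIV f \<and> open U}"
    by (rule CollectI, rule exI[of _ "\<lambda>_. 0"], rule exI[of _ UNIV]) auto
  then show ?thesis unfolding weak_star_def topology_generated_by_topspace by blast
qed

lemma openin_weak_star:
  fixes f :: "torus \<Rightarrow> real"
  assumes "continuous_on UNIV f" "open U"
  shows "openin weak_star {\<mu> \<in> borel_probs. (\<integral>x. f x \<partial>\<mu>) \<in> U}"
  unfolding weak_star_def by (rule topology_generated_by_Basis) (use assms in blast)

text \<open>The topology is given by a subbasis, so the claim is proved by induction on the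
  generation of open sets; convergence of integrals settles the subbasic ones.\<close>

lemma weak_star_eventually_in_open:
  assumes \<mu>: "\<And>n. \<mu> n \<in> borel_probs"
    and lim: "\<And>f :: torus \<Rightarrow> real. continuous_on UNIV f \<Longrightarrow>
      (\<lambda>n. \<integral>x. f x \<partial>\<mu> n) \<longlonglongrightarrow> (\<integral>x. f x \<partial>m)"
    and U: "openin weak_star U" "m \<in> U"
  shows "\<forall>\<^sub>F n in sequentially. \<mu> n \<in> U"
proof -
  have "generate_topology_on {{\<mu> \<in> borel_probs. (\<integral>x. f x \<partial>\<mu>) \<in> U} | (f :: torus \<Rightarrow> real) U.
        continuous_on UNIV f \<and> open U} U"
    using U(1) by (simp add: weak_star_def openin_topology_generated_by_iff)
  then show ?thesis using U(2)
  proof induction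
    case (Int A B)
    then show ?case by (auto intro: eventually_conj)
  next
    case (UN K)
    then obtain k where "k \<in> K" "m \<in> k" by blast
    then have "\<forall>\<^sub>F n in sequentially. \<mu> n \<in> k" using UN by blast
    then show ?case by (rule eventually_mono) (use \<open>k \<in> K\<close> in blast)
  next
    case (Basis V)
    then obtain f :: "torus \<Rightarrow> real" and W where f: "continuous_on UNIV f" "open W"
        "V = {\<mu> \<in> borel_probs. (\<integral>x. f x \<partial>\<mu>) \<in> W}" by blast
    have "\<forall>\<^sub>F n in sequentially. (\<integral>x. f x \<partial>\<mu> n) \<in> W"
      using topological_tendstoD[OF lim[OF f(1)] f(2)] Basis f(3) by blast
    then show ?case unfolding f(3) using \<mu> by simp
  qed simp
qed

section \<open>Integration of continuous functions on the torus\<close>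

lemma continuous_on_torus_bounded:
  fixes g :: "torus \<Rightarrow> real"
  assumes "continuous_on UNIV g"
  obtains B where "\<And>t. \<bar>g t\<bar> \<le> B"
proof -
  have "bounded ((\<lambda>x. g (torus_proj x)) ` cbox (0, 0) (1, 1))"
    by (intro compact_imp_bounded compact_continuous_image continuous_on_torus_lift assms compact_cbox)
  then obtain B where "\<forall>x\<in>cbox (0, 0) (1, 1). \<bar>g (torus_proj x)\<bar> \<le> B"
    unfolding bounded_iff by auto
  then have "\<bar>g t\<bar> \<le> B" for t using torus_proj_surj_unit[of t] by auto
  then show thesis by (rule that)
qed

lemma integrable_continuous_torus:
  fixes g :: "torus \<Rightarrow> real"
  assumes g: "continuous_on UNIV g" and \<mu>: "\<mu> \<in> borel_probs"
  shows "integrable \<mu> g"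
proof -
  obtain B where B: "\<And>t. \<bar>g t\<bar> \<le> B" using continuous_on_torus_bounded[OF g] by blast
  interpret prob_space \<mu> using \<mu> by (simp add: borel_probs_def)
  have "g \<in> borel_measurable \<mu>"
    using borel_measurable_continuous_onI[OF g] \<mu> by (simp add: borel_probs_def cong: measurable_cong_sets)
  then show ?thesis using B by (intro integrable_const_bound[of _ B]) auto
qed

lemma sets_dirac_mix [simp]: "sets (dirac_mix s p q) = sets borel"
  by (simp add: dirac_mix_def sets.sigma_sets_eq[of borel, simplified])

lemma space_dirac_mix [simp]: "space (dirac_mix s p q) = UNIV"
  using sets_eq_imp_space_eq[OF sets_dirac_mix] by simp

lemma dirac_mix_in_borel_probs:
  assumes "0 \<le> s" "s \<le> 1"
  shows "dirac_mix s p q \<in> borel_probs"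
proof -
  have "emeasure (dirac_mix s p q) UNIV = 1"
    using ennreal_plus[of s "1 - s"] assms by (simp add: emeasure_dirac_mix)
  then show ?thesis by (simp add: borel_probs_def prob_spaceI)
qed

context stopped_linear_flow
begin

lemma p_ne_q: "p \<noteq> q"
  using weight_p weight_q by auto

lemma measurable_\<phi>_weight [measurable]: "\<phi> \<in> borel_measurable borel" "weight \<in> borel_measurable borel"
  by (intro borel_measurable_continuous_onI continuous_\<phi> continuous_weight)+

text \<open>The continuous function \<phi> singles out {p, q} as its zero set and
  \<open>weight\<close> separates the two points.\<close>

lemma singletons_borel: "{p} \<in> sets borel" "{q} \<in> sets borel"
proof -
  have "{p} = {z \<in> space borel. \<phi> z = 0 \<and> weight z = 1}" "{q} = {z \<in> space borel. \<phi> z = 0 \<and> weight z = 0}"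
    using weight_p weight_q by (auto simp: \<phi>_eq_0_iff)
  moreover have "{z \<in> space borel. \<phi> z = 0 \<and> weight z = 1} \<in> sets borel"
    "{z \<in> space borel. \<phi> z = 0 \<and> weight z = 0} \<in> sets borel" by measurable
  ultimately show "{p} \<in> sets borel" "{q} \<in> sets borel" by auto
qed

lemma integral_dirac_mix:
  fixes f :: "torus \<Rightarrow> real"
  assumes s: "0 \<le> s" "s \<le> 1" and f: "continuous_on UNIV f"
  shows "(\<integral>x. f x \<partial>dirac_mix s p q) = s * f p + (1 - s) * f q"
proof -
  let ?m = "dirac_mix s p q"
  interpret prob_space ?m using dirac_mix_in_borel_probs[OF s] by (simp add: borel_probs_def)
  note [measurable] = singletons_borel borel_measurable_continuous_onI[OF f]
  have pq: "- {p, q} \<in> sets borel"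
    using sets.Un[OF singletons_borel] by (metis borel_comp insert_is_Un)
  then have "emeasure ?m (- {p, q}) = 0" by (simp add: emeasure_dirac_mix)
  then have "AE x in ?m. x \<in> {p, q}"
    using pq by (intro AE_I[of _ _ "- {p, q}"]) auto
  then have "AE x in ?m. f x = f p * indicator {p} x + f q * indicator {q} x"
    by (rule eventually_mono) (use p_ne_q in auto)
  then have "(\<integral>x. f x \<partial>?m) = (\<integral>x. f p * indicator {p} x + f q * indicator {q} x \<partial>?m)"
    by (intro integral_cong_AE) (simp_all cong: measurable_cong_sets)
  also have "\<dots> = f p * measure ?m {p} + f q * measure ?m {q}"
  proof -
    have "integrable ?m (indicat_real {p})" "integrable ?m (indicat_real {q})"
      using singletons_borel by (auto intro!: integrable_real_indicator simp: less_top[symmetric])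
    then show ?thesis by (subst Bochner_Integration.integral_add) auto
  qed
  finally have "(\<integral>x. f x \<partial>?m) = f p * measure ?m {p} + f q * measure ?m {q}" .
  moreover have "measure ?m {p} = s" "measure ?m {q} = 1 - s"
    using singletons_borel p_ne_q s by (simp_all add: measure_def emeasure_dirac_mix)
  ultimately show ?thesis by (simp add: mult.commute)
qed

text \<open>A nonnegative continuous function with integral 0 vanishes almost everywhere, so the
  measure lives on {p, q}, and its mass at p is the integral of \<open>weight\<close>.\<close>

lemma eq_dirac_mixI:
  assumes \<mu>: "\<mu> \<in> borel_probs" and zero_speed: "(\<integral>x. \<phi> x \<partial>\<mu>) = 0"
  shows "\<exists>s. 0 \<le> s \<and> s \<le> 1 \<and> \<mu> = dirac_mix s p q"
proof -
  interpret prob_space \<mu> using \<mu> by (simp add: borel_probs_def)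
  have sets: "sets \<mu> = sets borel" using \<mu> by (simp add: borel_probs_def)
  define s where "s = (\<integral>x. weight x \<partial>\<mu>)"
  have int: "integrable \<mu> \<phi>" "integrable \<mu> weight"
    using \<mu> by (intro integrable_continuous_torus continuous_\<phi> continuous_weight; simp)+
  have s: "0 \<le> s" "s \<le> 1"
    using int(2) weight_bounds by (auto simp: s_def intro!: integral_le_const)
  have "AE x in \<mu>. \<phi> x = 0"
    using zero_speed int(1) by (subst (asm) integral_nonneg_eq_0_iff_AE) auto
  then have AE: "AE x in \<mu>. x = p \<or> x = q" by (simp add: \<phi>_eq_0_iff)
  have "emeasure \<mu> A = emeasure (dirac_mix s p q) A" if A: "A \<in> sets \<mu>" for A
  proof -
    have A': "A \<in> sets borel" using A sets by simp
    \<comment> \<open>On {p, q}, \<open>weight\<close> is the indicator of p.\<close>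
    have "AE x in \<mu>. indicator A x = indicat_real A p * weight x + indicat_real A q * (1 - weight x)"
      using AE by (rule eventually_mono) (auto simp: weight_p weight_q)
    then have "(\<integral>x. indicator A x \<partial>\<mu>) = (\<integral>x. indicat_real A p * weight x + indicat_real A q * (1 - weight x) \<partial>\<mu>)"
      using A int(2) by (intro integral_cong_AE) auto
    also have "\<dots> = indicat_real A p * s + indicat_real A q * (1 - s)"
      using int(2) by (simp add: s_def prob_space)
    finally have "measure \<mu> A = indicat_real A p * s + indicat_real A q * (1 - s)"
      using A sets.sets_into_space[OF A] by (simp add: Int_absorb2)
    then have "emeasure \<mu> A = ennreal (indicat_real A p * s + indicat_real A q * (1 - s))"
      by (simp add: emeasure_eq_measure)
    also have "\<dots> = ennreal s * indicator A p + ennreal (1 - s) * indicator A q"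
      using s by (auto simp: indicator_def simp flip: ennreal_plus)
    also have "\<dots> = emeasure (dirac_mix s p q) A"
      using A' by (simp add: emeasure_dirac_mix)
    finally show ?thesis .
  qed
  then have "\<mu> = dirac_mix s p q" by (intro measure_eqI) (simp_all add: sets)
  then show ?thesis using s by blast
qed

end

context stopped_linear_orbit
begin

text \<open>Along times at which the occupation fraction tends to s, all averages of a continuous f
  tend to s f p + (1 - s) f q.\<close>

lemma dirac_mix_in_p_omega:
  assumes s: "0 \<le> s" "s \<le> 1"
  shows "dirac_mix s p q \<in> p_omega \<Phi> x"
proof -
  have "dirac_mix s p q \<in> weak_star closure_of {\<mu>. \<exists>t\<ge>T. is_empirical_measure \<Phi> x t \<mu>}"
    if T: "T > 0" for T
  proof -
    have "\<exists>t\<ge>T + real n. t > 0 \<and> \<bar>occupation t / t - s\<bar> \<le> 1 / real (Suc n)" for n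
      by (rule occupation_intermediate[OF s]) simp
    then obtain t where t: "\<And>n. t n \<ge> T + real n" "\<And>n. t n > 0"
        "\<And>n. \<bar>occupation (t n) / t n - s\<bar> \<le> 1 / real (Suc n)"
      by metis
    define \<mu> where "\<mu> n = distr (uniform_measure lborel {0..t n}) borel (\<lambda>s. \<Phi> s x)" for n
    have emp: "is_empirical_measure \<Phi> x (t n) (\<mu> n)" for n
      unfolding \<mu>_def using flow t(2) by (intro is_empirical_measure_distr) (auto simp: generated_flow_def)
    have t_lim: "filterlim t at_top sequentially"
      using t(1) T by (intro filterlim_at_top_mono[OF filterlim_real_sequentially])
        (auto intro!: always_eventually order_trans[OF _ t(1)])
    have "(\<lambda>n. occupation (t n) / t n - s) \<longlonglongrightarrow> 0"
      by (rule Lim_null_comparison[OF _ LIMSEQ_Suc[OF lim_1_over_n]]) (use t(3) in auto)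
    then have r_lim: "(\<lambda>n. occupation (t n) / t n) \<longlonglongrightarrow> s" by (simp add: LIM_zero_iff)
    have lim: "(\<lambda>n. \<integral>x. f x \<partial>\<mu> n) \<longlonglongrightarrow> (\<integral>x. f x \<partial>dirac_mix s p q)"
      if f: "continuous_on UNIV f" for f :: "torus \<Rightarrow> real"
    proof -
      have "(\<lambda>n. (1 / t n) * integral {0..t n} (\<lambda>s. f (\<Phi> s x)) -
          (occupation (t n) / t n * f p + (1 - occupation (t n) / t n) * f q) +
          (occupation (t n) / t n * f p + (1 - occupation (t n) / t n) * f q)) \<longlonglongrightarrow> 0 + (s * f p + (1 - s) * f q)"
        by (intro tendsto_intros r_lim filterlim_compose[OF average_difference_tendsto_zero[OF f] t_lim])
      then show ?thesis
        using emp f by (simp add: integral_dirac_mix[OF s f] is_empirical_measure_def)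
    qed
    show ?thesis
      unfolding in_closure_of topspace_weak_star
    proof (intro conjI allI impI dirac_mix_in_borel_probs s)
      fix U assume U: "dirac_mix s p q \<in> U \<and> openin weak_star U"
      have "\<forall>\<^sub>F n in sequentially. \<mu> n \<in> U"
        using emp lim U by (intro weak_star_eventually_in_open[of \<mu> "dirac_mix s p q"])
          (auto simp: is_empirical_measure_def)
      then obtain n where "\<mu> n \<in> U" by (meson eventually_sequentially order_refl)
      moreover have "t n \<ge> T" using t(1)[of n] by simp
      ultimately show "\<exists>y. y \<in> {\<mu>. \<exists>t\<ge>T. is_empirical_measure \<Phi> x t \<mu>} \<and> y \<in> U"
        using emp by blast
    qed
  qed
  then show ?thesis by (simp add: p_omega_def)
qed

text \<open>The test function \<phi> decides: its time averages tend to 0, and this passes to every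
  measure in the closure.\<close>

lemma p_omega_is_dirac_mix:
  assumes \<mu>: "\<mu> \<in> p_omega \<Phi> x"
  shows "\<exists>s. 0 \<le> s \<and> s \<le> 1 \<and> \<mu> = dirac_mix s p q"
proof -
  have cl: "\<mu> \<in> weak_star closure_of {\<mu>. \<exists>t\<ge>T. is_empirical_measure \<Phi> x t \<mu>}" if "T > 0" for T
    using \<mu> that by (simp add: p_omega_def)
  have prob: "\<mu> \<in> borel_probs"
    using cl[of 1] closure_of_subset_topspace[of weak_star] topspace_weak_star by auto
  have "\<bar>\<integral>x. \<phi> x \<partial>\<mu>\<bar> \<le> 0 + e" if e: "e > 0" for e :: real
  proof -
    have "\<forall>\<^sub>F t in at_top. \<bar>(1 / t) * integral {0..t} (\<lambda>s. \<phi> (\<Phi> s x))\<bar> < e / 2"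
      using tendstoD[OF average_tendsto_zero[OF continuous_\<phi> zero], of "e / 2"] e by simp
    then obtain T where T: "\<And>t. t \<ge> T \<Longrightarrow> \<bar>(1 / t) * integral {0..t} (\<lambda>s. \<phi> (\<Phi> s x))\<bar> < e / 2"
      unfolding eventually_at_top_linorder by blast
    define U where "U = {\<mu>' \<in> borel_probs. (\<integral>x. \<phi> x \<partial>\<mu>') \<in> ball (\<integral>x. \<phi> x \<partial>\<mu>) (e / 2)}"
    have "openin weak_star U" unfolding U_def by (intro openin_weak_star continuous_\<phi> open_ball)
    moreover have "\<mu> \<in> U" using prob e by (simp add: U_def)
    moreover have "\<forall>U. \<mu> \<in> U \<and> openin weak_star U \<longrightarrow>
        (\<exists>\<mu>'. \<mu>' \<in> {\<mu>. \<exists>t\<ge>max T 1. is_empirical_measure \<Phi> x t \<mu>} \<and> \<mu>' \<in> U)"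
      using cl[of "max T 1"] unfolding in_closure_of by simp
    ultimately obtain \<mu>' t where \<mu>': "t \<ge> max T 1" "is_empirical_measure \<Phi> x t \<mu>'" "\<mu>' \<in> U"
      by blast
    have "(\<integral>x. \<phi> x \<partial>\<mu>') = (1 / t) * integral {0..t} (\<lambda>s. \<phi> (\<Phi> s x))"
      using \<mu>'(2) continuous_\<phi> by (simp add: is_empirical_measure_def)
    then have "\<bar>\<integral>x. \<phi> x \<partial>\<mu>'\<bar> < e / 2" using T[of t] \<mu>'(1) by simp
    moreover have "\<bar>(\<integral>x. \<phi> x \<partial>\<mu>) - (\<integral>x. \<phi> x \<partial>\<mu>')\<bar> < e / 2"
      using \<mu>'(3) by (simp add: U_def dist_real_def)
    ultimately show ?thesis by linarith
  qed
  then have "\<bar>\<integral>x. \<phi> x \<partial>\<mu>\<bar> \<le> 0" by (rule field_le_epsilon)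
  then show ?thesis by (intro eq_dirac_mixI prob) (simp only: abs_le_zero_iff)
qed

lemma p_omega_eq: "p_omega \<Phi> x = {dirac_mix s p q | s. 0 \<le> s \<and> s \<le> 1}"
  using dirac_mix_in_p_omega p_omega_is_dirac_mix by blast

end

section \<open>Almost every point of the torus\<close>

lemma AE_avoids_lattice: "AE y in lborel. avoids_lattice \<alpha> (y - c)"
proof -
  have "{y. \<not> avoids_lattice \<alpha> (y - c)} \<subseteq> (\<Union>k. \<Union>l. {of_int l + c - \<alpha> * of_int k})"
  proof
    fix y assume "y \<in> {y. \<not> avoids_lattice \<alpha> (y - c)}"
    then obtain k :: int where "y - c + \<alpha> * of_int k \<in> \<int>" unfolding avoids_lattice_def by blast
    then obtain l where "y - c + \<alpha> * of_int k = of_int l" by (elim Ints_cases)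
    then have "y = of_int l + c - \<alpha> * of_int k" by simp
    then show "y \<in> (\<Union>k. \<Union>l. {of_int l + c - \<alpha> * of_int k})" by blast
  qed
  moreover have "countable (\<Union>k::int. \<Union>l::int. {of_int l + c - \<alpha> * of_int k})" by auto
  ultimately have "countable {y. \<not> avoids_lattice \<alpha> (y - c)}" using countable_subset by blast
  then have "{y. \<not> avoids_lattice \<alpha> (y - c)} \<in> null_sets lborel" by (rule countable_imp_null_set_lborel)
  then show ?thesis by (rule AE_I') simp
qed

lemma AE_lborel_shift:
  fixes c :: real
  assumes "AE y in lborel. P y"
  shows "AE y in lborel. P (y - c)"
proof -
  obtain N where N: "N \<in> null_sets lborel" "{y \<in> space lborel. \<not> P y} \<subseteq> N"
    using assms unfolding eventually_ae_filter by blast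
  then have "{y. y - c \<in> N} \<in> null_sets lborel" by (intro null_sets_translation)
  then show ?thesis by (rule AE_I') (use N(2) in auto)
qed

text \<open>For fixed abscissa u the intercept is the second coordinate translated by -\<alpha> u,
  so null sets of intercepts pull back to null sets of the plane by Fubini.\<close>

lemma AE_haar_torus_line:
  assumes "AE y in lborel. G y"
  shows "AE x in haar_torus. \<exists>x1\<in>{0..1}. \<exists>y. x = torus_proj (x1, y + \<alpha> * x1) \<and> G y"
proof -
  obtain N where N: "N \<in> null_sets lborel" "{y \<in> space lborel. \<not> G y} \<subseteq> N"
    using assms unfolding eventually_ae_filter by blast
  have N': "N \<in> sets borel" using N(1) by auto
  let ?I = "{0..<1} \<times> {0..<1} :: (real \<times> real) set"
  text \<open>A measurable section of the projection: the fractional part of \<open>t\<close> is recovered from the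
    continuous functions \<open>dist_int t\<close> and \<open>dist_int (t - 1/4)\<close> of \<open>t\<close> mod 1.\<close>
  define \<rho> where "\<rho> d e = (if e \<le> 1/4 then d else 1 - d)" for d e :: real
  define r1 where "r1 t = \<rho> (dist_int (fst (torus_rep t))) (dist_int (fst (torus_rep t) - 1/4))" for t
  define r2 where "r2 t = \<rho> (dist_int (snd (torus_rep t))) (dist_int (snd (torus_rep t) - 1/4))" for t
  have rep: "fst (torus_rep (torus_proj x)) - fst x \<in> \<int>" "snd (torus_rep (torus_proj x)) - snd x \<in> \<int>" for x
    using torus_proj_rep[of "torus_proj x"] unfolding torus_proj_eq_iff by auto
  have dist_rep: "dist_int (fst (torus_rep (torus_proj x)) - c) = dist_int (fst x - c)"
    "dist_int (snd (torus_rep (torus_proj x)) - c) = dist_int (snd x - c)" for x c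
    using rep[of x] by (auto intro!: dist_int_eqI)
  have \<rho>_frac: "\<rho> (dist_int t) (dist_int (t - 1/4)) = frac t" for t
  proof -
    have f: "dist_int t = dist_int (frac t)" "dist_int (t - 1/4) = dist_int (frac t - 1/4)"
      by (auto intro!: dist_int_eqI simp: frac_def)
    show ?thesis
    proof (cases "frac t \<le> 1/2")
      case True
      then have "\<bar>frac t\<bar> \<le> 1/2" "\<bar>frac t - 1/4\<bar> \<le> 1/4"
        using frac_ge_0[of t] by linarith+
      then show ?thesis
        unfolding f \<rho>_def using dist_int_small[of "frac t"] dist_int_small[of "frac t - 1/4"] by simp
    next
      case False
      have "dist_int (frac t) = dist_int (frac t - 1)" by (intro dist_int_eqI) simp
      also have "\<dots> = 1 - frac t"
        using dist_int_small[of "frac t - 1"] False frac_lt_1[of t] by (simp add: abs_le_iff abs_if)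
      finally have 1: "dist_int (frac t) = 1 - frac t" .
      have "dist_int (frac t - 1/4) > 1/4"
      proof (cases "frac t \<le> 3/4")
        case True
        then show ?thesis using dist_int_small[of "frac t - 1/4"] False by (simp add: abs_le_iff)
      next
        case False2: False
        have "dist_int (frac t - 1/4) = dist_int (frac t - 1/4 - 1)" by (intro dist_int_eqI) simp
        also have "\<dots> = 5/4 - frac t"
          using dist_int_small[of "frac t - 1/4 - 1"] False2 frac_lt_1[of t] by (simp add: abs_le_iff abs_if)
        finally show ?thesis using frac_lt_1[of t] by simp
      qed
      then show ?thesis unfolding f \<rho>_def 1 by simp
    qed
  qed
  have r_proj: "r1 (torus_proj x) = frac (fst x)" "r2 (torus_proj x) = frac (snd x)" for x
    unfolding r1_def r2_def using dist_rep[of x 0] dist_rep[of x "1/4"] \<rho>_frac by simp_all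
  have cont: "continuous_on UNIV (\<lambda>t. dist_int (fst (torus_rep t) - c))"
    "continuous_on UNIV (\<lambda>t. dist_int (snd (torus_rep t) - c))" for c
    by (rule continuous_on_torusI, simp only: comp_def dist_rep, intro continuous_intros)+
  note [measurable] = borel_measurable_continuous_onI[OF cont(1)] borel_measurable_continuous_onI[OF cont(2)]
    borel_measurable_continuous_onI[OF cont(1)[of 0], simplified]
    borel_measurable_continuous_onI[OF cont(2)[of 0], simplified]
  have [measurable]: "r1 \<in> borel_measurable borel" "r2 \<in> borel_measurable borel"
    unfolding r1_def[abs_def] r2_def[abs_def] \<rho>_def by measurable
  \<comment> \<open>The transfer to \<open>haar_torus\<close> through \<open>AE_distr_iff\<close>
    asks for a measurable set, and \<open>G\<close> may fail to give one; avoiding the Borel null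
    set \<open>N\<close> replaces it.\<close>
  define Good where "Good t \<longleftrightarrow> r2 t - \<alpha> * r1 t \<notin> N" for t
  have Good: "\<exists>x1\<in>{0..1}. \<exists>y. t = torus_proj (x1, y + \<alpha> * x1) \<and> G y" if "Good t" for t
  proof -
    define x where "x = torus_rep t"
    have t: "t = torus_proj x" by (simp add: x_def)
    have "t = torus_proj (r1 t, r2 t)"
      unfolding t r_proj torus_proj_eq_iff by (simp add: frac_def)
    moreover have "r1 t \<in> {0..1}" unfolding t r_proj using frac_lt_1[of "fst x"] by simp
    moreover have "G (r2 t - \<alpha> * r1 t)" using that N(2) by (auto simp: Good_def)
    ultimately show ?thesis
      by (intro bexI[of _ "r1 t"] exI[of _ "r2 t - \<alpha> * r1 t"]) auto
  qed
  have "AE x in lborel \<Otimes>\<^sub>M lborel. snd x - \<alpha> * fst x \<notin> N"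
  proof (rule lborel_pair.AE_pair_measure)
    have "(\<lambda>x. snd x - \<alpha> * fst x) \<in> borel_measurable (lborel \<Otimes>\<^sub>M lborel)" by measurable
    then show "{x \<in> space (lborel \<Otimes>\<^sub>M lborel). snd x - \<alpha> * fst x \<notin> N} \<in> sets (lborel \<Otimes>\<^sub>M lborel)"
      using N' by measurable
    have "AE y in lborel. y \<notin> N" using N(1) by (rule AE_not_in)
    from AE_lborel_shift[OF this]
    show "AE u in lborel. AE y in lborel. snd (u, y) - \<alpha> * fst (u, y) \<notin> N" by simp
  qed
  then have ae: "AE x in (lborel :: (real \<times> real) measure). snd x - \<alpha> * fst x \<notin> N"
    unfolding lborel_prod .
  have "AE x in restrict_space lborel ?I. Good (torus_proj x)"
  proof (subst AE_restrict_space_iff)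
    show "?I \<inter> space lborel \<in> sets lborel" by (simp add: borel_Times)
    show "AE x in lborel. x \<in> ?I \<longrightarrow> Good (torus_proj x)"
      using ae by (rule eventually_mono) (auto simp: Good_def r_proj frac_eq)
  qed
  moreover have "torus_proj \<in> measurable (restrict_space lborel ?I) borel"
    using borel_measurable_continuous_onI[OF continuous_torus_proj]
    by (intro measurable_restrict_space1) simp
  moreover have "{t \<in> space borel. Good t} \<in> sets borel" unfolding Good_def using N' by measurable
  ultimately have "AE t in haar_torus. Good t"
    unfolding haar_torus_def by (subst AE_distr_iff) auto
  then show ?thesis by (rule eventually_mono) (rule Good)
qed

lemma (in stopped_linear_flow) extreme_historic: "extreme_historic_behaviour p q \<Phi>"
proof -
  have "AE y in lborel. good y"
    unfolding good_def using AE_avoids_lattice[of \<alpha> 0] AE_avoids_lattice[of \<alpha> "of_int a / of_int b"]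
      AE_near_hits[OF W] AE_lborel_shift[OF AE_near_hits[OF W]]
    by (simp add: AE_conj_iff)
  from AE_haar_torus_line[OF this, of \<alpha>]
  show ?thesis unfolding extreme_historic_behaviour_def
  proof (rule eventually_mono)
    fix x assume "\<exists>x1\<in>{0..1}. \<exists>y. x = torus_proj (x1, y + \<alpha> * x1) \<and> good y"
    then obtain x1 y where x: "x1 \<in> {0..1}" "x = torus_proj (x1, y + \<alpha> * x1)" "good y" by blast
    obtain \<theta> where "\<theta> 0 = x1" "\<And>t. \<Phi> t x = torus_proj (\<theta> t, y + \<alpha> * \<theta> t)"
        "\<And>t. (\<theta> has_real_derivative F (\<theta> t, y + \<alpha> * \<theta> t)) (at t)"
      using orbit_lift[OF x(2)] by blast
    then interpret stopped_linear_orbit a b \<alpha> \<nu> p q \<phi> \<Phi> x x1 y \<theta>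
      using x by unfold_locales auto
    show "p_omega \<Phi> x = {dirac_mix s p q | s. 0 \<le> s \<and> s \<le> 1}" by (rule p_omega_eq)
  qed
qed

theorem theorem6p4:
  fixes a b :: int and \<alpha> \<nu> :: real
    and p q :: torus and \<Phi> :: "real \<Rightarrow> torus \<Rightarrow> torus"
  assumes "b \<ge> 2" and "gcd a b = 1"
    and "p = torus_proj (0, 0)"
    and "q = torus_proj (0, real_of_int a / real_of_int b)"
    and "\<nu> > 0" and "\<alpha> \<in> W_set \<nu> b"
    and "reparametrized_linear_flow \<alpha> p q \<Phi>"
  shows "extreme_historic_behaviour p q \<Phi>"
proof -
  obtain \<phi> where \<phi>: "Ck_torus 3 \<phi>" "\<phi> p = 0" "\<phi> q = 0" "\<And>x. x \<noteq> p \<Longrightarrow> x \<noteq> q \<Longrightarrow> \<phi> x > 0"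
      "hessian_pos_def_at \<phi> p" "hessian_pos_def_at \<phi> q"
      "generated_flow (\<lambda>x. \<phi> x *\<^sub>R (1, \<alpha>)) \<Phi>"
    using assms(7) unfolding reparametrized_linear_flow_def by blast
  have "Ck_torus 2 \<phi>"
    using \<phi>(1) unfolding Ck_torus_def numeral_3_eq_3 numeral_2_eq_2 by (rule Ck_Suc_imp)
  then interpret stopped_linear_flow a b \<alpha> \<nu> p q \<phi> \<Phi>
    using assms \<phi> by unfold_locales (auto simp: coprime_iff_gcd_eq_1)
  show ?thesis by (rule extreme_historic)
qed

end
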